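(* Let $f$ be an element of the group $\mathrm{GIET}$ of generalized interval exchange transformations. The following are equivalent. (1) The element $f$ is distorted in $\mathrm{GIET}$. (2) The sequence $(d(f^n))_{n\ge0}$ is bounded. (3) The element $f$ is a multihomeomorphism of the circle.
   Context: A generalized interval exchange transformation is a map defined on $[0,1]\setminus F$, for some finite subset $F$ of $[0,1]$, with values in $[0,1]$, which is continuous on each connected component of $[0,1]\setminus F$ and which is a bijection from $[0,1]\setminus F$ onto the complement of a finite subset of $[0,1]$. Such a map is monotone on each component of $[0,1]\setminus F$, so it has one-sided limits at every point. Write $f\sim g$ if $f$ and $g$ coincide outside a finite subset of $[0,1]$. $\mathrm{GIET}$ is the quotient of the set of generalized interval exchange transformations by $\sim$; it is a group under composition (defined outside finite sets). Discontinuities: for $f\in\mathrm{GIET}$, a discontinuity of $f$ is a point $a\in(0,1)$ such that $\lim_{a^-}f\ne\lim_{a^+}f$; this does not depend on the representative of $f$. $d(f)$ is the number of discontinuities of $f$. Distortion: for a group $G$ generated by a finite set $S$, $\ell_S$ is the word length with respect to $S$. An element $f\in G$ is distorted in $G$ if $\lim_{n\to+\infty}\ell_S(f^n)/n=0$ (independent of $S$). An element of an arbitrary group is distorted if it belongs to some finitely generated subgroup in which it is distorted. Multihomeomorphism: for $n\ge 1$, $\mathbb{S}^1_n$ is the disjoint union of $n$ circles. An element $f\in\mathrm{GIET}$ is a multihomeomorphism of the circle if there exist $n\ge1$, a continuous bijection $h$ from the complement of a finite subset of $[0,1]$ onto the complement of a finite subset of $\mathbb{S}^1_n$, and a homeomorphism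 $g:\mathbb{S}^1_n\to\mathbb{S}^1_n$ such that $hfh^{-1}=g$ outside a finite subset of $\mathbb{S}^1_n$. *)

theory Defs
  imports "HOL-Analysis.Analysis" "HOL-Algebra.Generated_Groups"
begin

section \<open>Distorted elements\<close>

definition word_length :: "('a, 'b) monoid_scheme \<Rightarrow> 'a set \<Rightarrow> 'a \<Rightarrow> nat" where
  "word_length G S x = (LEAST n. \<exists>ws. length ws = n \<and> set ws \<subseteq> S \<union> m_inv G ` S \<and>
      foldr (mult G) ws (one G) = x)"

text \<open>Distortion of \<open>x\<close> in a finitely generated group \<open>G\<close>; finite generation of \<open>G\<close> is part of the
  definition. The limit does not depend on the finite generating set.\<close>

definition fg_distorted :: "('a, 'b) monoid_scheme \<Rightarrow> 'a \<Rightarrow> bool" where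
  "fg_distorted G x \<longleftrightarrow> (\<exists>S. finite S \<and> S \<subseteq> carrier G \<and> generate G S = carrier G \<and>
      (\<lambda>n. real (word_length G S (x [^]\<^bsub>G\<^esub> (n::nat))) / real n) \<longlonglongrightarrow> 0)"

definition distorted :: "('a, 'b) monoid_scheme \<Rightarrow> 'a \<Rightarrow> bool" where
  "distorted G x \<longleftrightarrow> (\<exists>H. subgroup H G \<and> x \<in> H \<and> fg_distorted (G\<lparr>carrier := H\<rparr>) x)"


section \<open>Generalized interval exchange transformations\<close>

text \<open>A map defined on \<open>[0,1]\<close> minus a finite set is a partial function whose domain is that set;
  \<open>\<circ>\<^sub>m\<close> is then composition on the largest set where it makes sense.\<close>

abbreviation pval :: "('a \<rightharpoonup> 'b) \<Rightarrow> 'a \<Rightarrow> 'b" where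
  "pval f x \<equiv> the (f x)"

definition pinv :: "('a \<rightharpoonup> 'b) \<Rightarrow> 'b \<rightharpoonup> 'a" where
  "pinv f y = (if y \<in> ran f then Some (THE x. f x = Some y) else None)"

definition is_giet :: "(real \<rightharpoonup> real) \<Rightarrow> bool" where
  "is_giet f \<longleftrightarrow>
     (\<exists>F E. finite F \<and> F \<subseteq> {0..1} \<and> finite E \<and> E \<subseteq> {0..1} \<and>
        dom f = {0..1} - F \<and>
        (\<forall>C \<in> components ({0..1} - F). continuous_on C (pval f)) \<and>
        bij_betw (pval f) ({0..1} - F) ({0..1} - E))"

definition giet_rel :: "((real \<rightharpoonup> real) \<times> (real \<rightharpoonup> real)) set" where
  "giet_rel = {(f, g). is_giet f \<and> is_giet g \<and> finite {x \<in> {0..1}. f x \<noteq> g x}}"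

definition giet_id :: "real \<rightharpoonup> real" where
  "giet_id x = (if x \<in> {0..1} then Some x else None)"

definition GIET :: "(real \<rightharpoonup> real) set monoid" where
  "GIET = \<lparr>carrier = {f. is_giet f} // giet_rel,
           mult = (\<lambda>A B. \<Union>f\<in>A. \<Union>g\<in>B. giet_rel `` {f \<circ>\<^sub>m g}),
           one = giet_rel `` {giet_id}\<rparr>"

text \<open>The limits below exist and do not depend on the representative \<open>\<phi>\<close> of the class \<open>f\<close>.\<close>

definition discontinuities :: "(real \<rightharpoonup> real) set \<Rightarrow> real set" where
  "discontinuities f =
     {a \<in> {0<..<1}. \<exists>\<phi>\<in>f. Lim (at_left a) (pval \<phi>) \<noteq> Lim (at_right a) (pval \<phi>)}"

definition disc_count :: "(real \<rightharpoonup> real) set \<Rightarrow> nat" where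
  "disc_count f = card (discontinuities f)"

text \<open>The disjoint union of \<open>n\<close> circles; \<open>nat\<close> carries the discrete topology.\<close>

definition circles :: "nat \<Rightarrow> (nat \<times> complex) set" where
  "circles n = {..<n} \<times> sphere 0 1"

definition multihomeomorphism :: "(real \<rightharpoonup> real) set \<Rightarrow> bool" where
  "multihomeomorphism f \<longleftrightarrow>
     (\<exists>n\<ge>1. \<exists>(h :: real \<rightharpoonup> nat \<times> complex) A B g g'.
        finite A \<and> A \<subseteq> {0..1} \<and> finite B \<and> B \<subseteq> circles n \<and>
        dom h = {0..1} - A \<and>
        continuous_on ({0..1} - A) (pval h) \<and>
        bij_betw (pval h) ({0..1} - A) (circles n - B) \<and>
        homeomorphism (circles n) (circles n) g g' \<and>
        (\<exists>\<phi>\<in>f. finite {y \<in> circles n. (h \<circ>\<^sub>m \<phi> \<circ>\<^sub>m pinv h) y \<noteq> Some (g y)}))"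


section \<open>\<open>GIET\<close> is a group\<close>

lemma pval_eq_iff: "f x = Some y \<longleftrightarrow> x \<in> dom f \<and> pval f x = y"
  by force

lemma ran_pval: "ran f = pval f ` dom f"
  by (force simp: ran_def image_iff)

lemma is_giet_iff:
  "is_giet f \<longleftrightarrow> dom f \<subseteq> {0..1} \<and> finite ({0..1} - dom f) \<and> continuous_on (dom f) (pval f) \<and>
     inj_on (pval f) (dom f) \<and> ran f \<subseteq> {0..1} \<and> finite ({0..1} - ran f)" (is "_ \<longleftrightarrow> ?R")
proof
  assume "is_giet f"
  then obtain F E where *: "finite F" "F \<subseteq> {0..1}" "finite E" "E \<subseteq> {0..1}" "dom f = {0..1} - F"
     "\<And>C. C \<in> components ({0..1} - F) \<Longrightarrow> continuous_on C (pval f)"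
     "bij_betw (pval f) ({0..1} - F) ({0..1} - E)"
    unfolding is_giet_def by blast
  have "openin (top_of_set {0..1}) ({0..1} - F)"
    using * by (simp add: finite_imp_closed openin_diff closed_subset)
  then have "locally connected ({0..1} - F)"
    using locally_open_subset convex_imp_locally_connected convex_real_interval by blast
  then have "continuous_on ({0..1} - F) (pval f)"
    using * continuous_on_components by blast
  moreover have "{0..1} - dom f = F" "{0..1} - ran f = E" "ran f = {0..1} - E"
    using * by (auto simp: ran_pval bij_betw_def)
  ultimately show ?R
    using * by (auto simp: bij_betw_def)
next
  assume R: ?R
  have eq: "{0..1} - ({0..1} - dom f) = dom f" "{0..1} - ({0..1} - ran f) = ran f"
    using R by auto
  show "is_giet f"
    unfolding is_giet_def
    apply (rule exI[of _ "{0..1} - dom f"], rule exI[of _ "{0..1} - ran f"])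
    unfolding eq
    using R by (auto simp: bij_betw_def ran_pval dest: in_components_subset intro: continuous_on_subset)
qed

lemma dom_map_comp: "dom (f \<circ>\<^sub>m g) = {x \<in> dom g. pval g x \<in> dom f}"
  by (auto simp: dom_def map_comp_Some_iff)

lemma pval_map_comp: "x \<in> dom g \<Longrightarrow> pval (f \<circ>\<^sub>m g) x = pval f (pval g x)"
  by (auto simp: map_comp_def)

lemma ran_map_comp: "ran (f \<circ>\<^sub>m g) = {z. \<exists>y\<in>ran g. f y = Some z}"
  by (auto simp: ran_def map_comp_Some_iff)

lemma finite_giet_vimage:
  assumes "is_giet g" "finite Y"
  shows "finite {x \<in> dom g. pval g x \<in> Y}"
  using finite_vimage_IntI[of Y "pval g" "dom g"] assms
  by (simp add: is_giet_iff vimage_def Int_def conj_commute)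

lemma giet_comp:
  assumes "is_giet f" "is_giet g"
  shows "is_giet (f \<circ>\<^sub>m g)"
proof -
  note f = assms(1)[unfolded is_giet_iff] and g = assms(2)[unfolded is_giet_iff]
  have "{0..1} - dom (f \<circ>\<^sub>m g) \<subseteq> ({0..1} - dom g) \<union> {x \<in> dom g. pval g x \<in> {0..1} - dom f}"
    using g by (auto simp: dom_map_comp ran_def)
  moreover have "finite {x \<in> dom g. pval g x \<in> {0..1} - dom f}"
    using finite_giet_vimage[OF assms(2)] f by blast
  ultimately have 1: "finite ({0..1} - dom (f \<circ>\<^sub>m g))"
    using g by (elim finite_subset) simp
  have "{0..1} - ran (f \<circ>\<^sub>m g) \<subseteq> ({0..1} - ran f) \<union> pval f ` ({0..1} - ran g)"
  proof
    fix z assume z: "z \<in> {0..1} - ran (f \<circ>\<^sub>m g)"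
    show "z \<in> ({0..1} - ran f) \<union> pval f ` ({0..1} - ran g)"
    proof (cases "z \<in> ran f")
      case True
      then obtain y where y: "f y = Some z" by (auto simp: ran_def)
      then have "y \<in> {0..1} - ran g" "pval f y = z"
        using z f by (auto simp: ran_map_comp)
      then show ?thesis by blast
    qed (use z in auto)
  qed
  then have 2: "finite ({0..1} - ran (f \<circ>\<^sub>m g))"
    using f g by (elim finite_subset) simp
  have "continuous_on (dom (f \<circ>\<^sub>m g)) (pval f \<circ> pval g)"
    using f g by (intro continuous_on_compose) (auto simp: dom_map_comp elim!: continuous_on_subset)
  then have 3: "continuous_on (dom (f \<circ>\<^sub>m g)) (pval (f \<circ>\<^sub>m g))"
    by (rule continuous_on_eq) (auto simp: dom_map_comp pval_map_comp)
  have "inj_on (pval f \<circ> pval g) (dom (f \<circ>\<^sub>m g))"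
    using f g by (auto simp: inj_on_def dom_map_comp)
  then have 4: "inj_on (pval (f \<circ>\<^sub>m g)) (dom (f \<circ>\<^sub>m g))"
    by (rule inj_on_cong[THEN iffD1, rotated]) (auto simp: dom_map_comp pval_map_comp)
  have 5: "dom (f \<circ>\<^sub>m g) \<subseteq> {0..1}" "ran (f \<circ>\<^sub>m g) \<subseteq> {0..1}"
    using f g by (auto simp: dom_map_comp ran_map_comp dest: ranI)
  show ?thesis
    unfolding is_giet_iff using 1 2 3 4 5 by blast
qed

lemma giet_comp_cong:
  assumes "(f, f') \<in> giet_rel" "(g, g') \<in> giet_rel"
  shows "(f \<circ>\<^sub>m g, f' \<circ>\<^sub>m g') \<in> giet_rel"
proof -
  have g: "is_giet g" and fin: "finite {x \<in> {0..1}. f x \<noteq> f' x}" "finite {x \<in> {0..1}. g x \<noteq> g' x}"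
    using assms by (auto simp: giet_rel_def)
  have "ran g \<subseteq> {0..1}" using g by (simp add: is_giet_iff)
  then have "{x \<in> {0..1}. (f \<circ>\<^sub>m g) x \<noteq> (f' \<circ>\<^sub>m g') x} \<subseteq>
    {x \<in> {0..1}. g x \<noteq> g' x} \<union> {x \<in> dom g. pval g x \<in> {y \<in> {0..1}. f y \<noteq> f' y}}"
    by (force simp: map_comp_def ran_def split: option.splits)
  then show ?thesis
    using assms finite_subset[OF _ finite_UnI[OF fin(2) finite_giet_vimage[OF g fin(1)]]]
    by (simp add: giet_rel_def giet_comp)
qed

lemma equiv_giet_rel: "equiv {f. is_giet f} giet_rel"
proof (rule equivI)
  show "trans giet_rel"
  proof (rule transI)
    fix f g h assume fgh: "(f, g) \<in> giet_rel" "(g, h) \<in> giet_rel"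
    then have "finite ({x \<in> {0..1}. f x \<noteq> g x} \<union> {x \<in> {0..1}. g x \<noteq> h x})"
      by (simp add: giet_rel_def)
    moreover have "{x \<in> {0..1}. f x \<noteq> h x} \<subseteq> {x \<in> {0..1}. f x \<noteq> g x} \<union> {x \<in> {0..1}. g x \<noteq> h x}"
      by auto
    ultimately have "finite {x \<in> {0..1}. f x \<noteq> h x}"
      by (rule rev_finite_subset)
    then show "(f, h) \<in> giet_rel"
      using fgh by (simp add: giet_rel_def)
  qed
qed (auto simp: giet_rel_def refl_on_def sym_def eq_commute)

lemma GIET_mult_class:
  assumes "is_giet f" "is_giet g"
  shows "giet_rel `` {f} \<otimes>\<^bsub>GIET\<^esub> giet_rel `` {g} = giet_rel `` {f \<circ>\<^sub>m g}"
proof -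
  have "(\<lambda>f g. giet_rel `` {f \<circ>\<^sub>m g}) respects2 giet_rel"
    by (intro congruent2I') (metis giet_comp_cong equiv_giet_rel equiv_class_eq)
  from UN_equiv_class2[OF equiv_giet_rel equiv_giet_rel this, of f g] show ?thesis
    using assms by (simp add: GIET_def)
qed

lemma is_giet_id: "is_giet giet_id"
proof -
  have [simp]: "dom giet_id = {0..1}" "ran giet_id = {0..1}"
    by (auto simp: giet_id_def dom_def ran_def)
  have "continuous_on {0..1::real} (pval giet_id)"
    by (rule continuous_on_eq[OF continuous_on_id]) (simp add: giet_id_def)
  then show ?thesis
    by (auto simp: is_giet_iff inj_on_def giet_id_def)
qed

lemma giet_inverse_exists:
  assumes "is_giet f"
  shows "\<exists>g. is_giet g \<and> (g \<circ>\<^sub>m f, giet_id) \<in> giet_rel"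
proof -
  note f = assms[unfolded is_giet_iff]
  define D where "D = dom f \<inter> {0<..<1}"
  define R where "R = pval f ` D"
  define g where "g = (\<lambda>y. if y \<in> R then Some (inv_into D (pval f) y) else None)"
  have D: "D = {0<..<1} - ({0..1} - dom f)"
    unfolding D_def by auto
  have "open D" unfolding D
    using f by (intro open_Diff finite_imp_closed) auto
  moreover have inj: "inj_on (pval f) D" and "continuous_on D (pval f)"
    using f by (auto simp: D_def inj_on_def elim: continuous_on_subset)
  ultimately have cont: "continuous_on R (inv_into D (pval f))"
    unfolding R_def by (intro continuous_on_inverse_open) (auto intro: inv_into_f_f)
  have dom: "dom g = R" and "ran g = inv_into D (pval f) ` R"
    by (auto simp: g_def ran_def dom_def)
  then have ran: "ran g = D"
    using inj by (simp add: R_def)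
  have "continuous_on (dom g) (pval g)" "inj_on (pval g) (dom g)"
    unfolding dom
     apply (rule continuous_on_eq[OF cont], simp add: g_def)
    unfolding inj_on_def g_def R_def by (auto simp: inv_into_f_f[OF inj])
  moreover have sub: "dom g \<subseteq> {0..1}" "ran g \<subseteq> {0..1}"
    unfolding dom ran R_def using f by (auto simp: D_def ran_pval)
  have DD: "{0..1} - D \<subseteq> ({0..1} - dom f) \<union> {0, 1}"
    by (auto simp: D_def)
  then have finD: "finite ({0..1} - D)"
    using f by (elim finite_subset) simp
  have "{0..1} - R \<subseteq> ({0..1} - ran f) \<union> pval f ` ({0..1} - D)"
    using f by (auto simp: R_def ran_pval)
  then have finR: "finite ({0..1} - R)"
    using f finD by (elim finite_subset) simp
  ultimately have g: "is_giet g"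
    using finD finR sub
    by (simp add: is_giet_iff dom ran)
  have "(g \<circ>\<^sub>m f) x = giet_id x" if "x \<in> D" for x
  proof -
    have "f x = Some (pval f x)" "x \<in> {0..1}"
      using that by (auto simp: D_def)
    moreover have "pval f x \<in> R" "inv_into D (pval f) (pval f x) = x"
      using that by (auto simp: R_def inv_into_f_f[OF inj])
    ultimately show ?thesis
      by (metis g_def giet_id_def map_comp_simps(2))
  qed
  then have "{x \<in> {0..1}. (g \<circ>\<^sub>m f) x \<noteq> giet_id x} \<subseteq> {0..1} - D"
    by auto
  then show ?thesis
    using g assms giet_comp[OF g assms] is_giet_id finite_subset[OF _ finD]
    by (auto simp: giet_rel_def)
qed

theorem group_GIET: "group GIET"
proof (rule groupI)
  have carr: "\<exists>f. is_giet f \<and> x = giet_rel `` {f}" if "x \<in> carrier GIET" for x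
    using that by (auto simp: GIET_def quotient_def)
  have in_carr: "giet_rel `` {f} \<in> carrier GIET" if "is_giet f" for f
    using that by (auto simp: GIET_def quotient_def)
  have one: "\<one>\<^bsub>GIET\<^esub> = giet_rel `` {giet_id}"
    by (simp add: GIET_def)
  show "\<one>\<^bsub>GIET\<^esub> \<in> carrier GIET"
    using in_carr one is_giet_id by simp
  fix x assume "x \<in> carrier GIET"
  then obtain f where f: "is_giet f" "x = giet_rel `` {f}"
    using carr by blast
  have "giet_id \<circ>\<^sub>m f = f"
    using f(1) by (force simp: is_giet_iff map_comp_def giet_id_def ran_def split: option.split)
  then show "\<one>\<^bsub>GIET\<^esub> \<otimes>\<^bsub>GIET\<^esub> x = x"
    using f is_giet_id by (simp add: one GIET_mult_class)
  show "\<exists>y\<in>carrier GIET. y \<otimes>\<^bsub>GIET\<^esub> x = \<one>\<^bsub>GIET\<^esub>"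
    using giet_inverse_exists[OF f(1)] in_carr equiv_class_eq[OF equiv_giet_rel] f
    by (metis GIET_mult_class one)
  fix y assume "y \<in> carrier GIET"
  then obtain g where g: "is_giet g" "y = giet_rel `` {g}"
    using carr by blast
  show "x \<otimes>\<^bsub>GIET\<^esub> y \<in> carrier GIET"
    using f g by (simp add: GIET_mult_class in_carr giet_comp)
  fix z assume "z \<in> carrier GIET"
  then obtain h where h: "is_giet h" "z = giet_rel `` {h}"
    using carr by blast
  have "f \<circ>\<^sub>m g \<circ>\<^sub>m h = f \<circ>\<^sub>m (g \<circ>\<^sub>m h)"
    by (auto simp: map_comp_def split: option.split)
  then show "x \<otimes>\<^bsub>GIET\<^esub> y \<otimes>\<^bsub>GIET\<^esub> z = x \<otimes>\<^bsub>GIET\<^esub> (y \<otimes>\<^bsub>GIET\<^esub> z)"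
    using f g h by (simp add: GIET_mult_class giet_comp)
qed

end

theory Submission
  imports Defs
begin

text \<open>The three properties are proved equivalent in a cycle: distorted elements are multihomeomorphisms,
  multihomeomorphisms have powers with boundedly many discontinuities, and this makes them distorted.

  \<^item> Everything is read off the action of an exchange \<open>f\<close> on the one-sided germs of points of the
  interval, which it permutes. Let \<open>opp\<close> be the involution that exchanges the two germs at an interior
  point, and the two germs at the ends of the interval. The set of germs at which \<open>f\<close> and \<open>opp\<close> do not
  commute is finite, and its size is subadditive under composition. If \<open>f\<close> is distorted, this size
  therefore grows sublinearly along the powers of \<open>f\<close>. On the other hand it grows linearly as soon as
  infinitely many germs \<open>x\<close> satisfy \<open>f\<^sup>n (opp x) \<noteq> opp (f\<^sup>n x)\<close> for infinitely many \<open>n\<close>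
  (\<open>linear_growth\<close>). Hence the relation ``eventually \<open>f\<^sup>n y = opp (f\<^sup>n x)\<close>'' is a partial matching of germs that
  is invariant under \<open>f\<close> and agrees with \<open>opp\<close> off a finite set. Cut the interval at finitely many points
  and glue the pieces along this matching: the result is a union of circles and arcs, and each arc is
  closed up to a circle. The map \<open>f\<close> extends continuously over all points where matched germs meet. It
  extends over the point that closes an arc because the arc is connected, so that its image stays in one
  circle, and each circle contains at most one closing point (\<open>gluing_respects\<close>). The same holds for the
  inverse of \<open>f\<close>, and the two extensions are inverse homeomorphisms.

  \<^item> If a chart \<open>h\<close> conjugates \<open>f\<close> to a homeomorphism \<open>g\<close> of circles, then \<open>f\<^sup>n\<close> can only be discontinuous at
  a point that is singular for \<open>h\<close> or that \<open>f\<^sup>n\<close> sends, on one side, to a singular point of \<open>h\<close>. The number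
  of such points does not depend on \<open>n\<close> (\<open>multihomeomorphism_imp_bounded\<close>).

  \<^item> An exchange with at most \<open>M\<close> discontinuities is a product \<open>V T W\<close>, where \<open>V\<close> and \<open>W\<close> are increasing
  homeomorphisms of the interval and \<open>T\<close> belongs to a finite set that depends only on \<open>M\<close>, one element
  for each way in which the pieces may be arranged (\<open>same_pattern\<close>, \<open>normalize\<close>). Arbitrary sequences
  of increasing homeomorphisms can be packed into finitely many exchanges: there is a finite set over
  which the \<open>n\<close>-th term of the sequence is a word of length \<open>O(n)\<close> (\<open>cheap_nested\<close>, \<open>cheap_line_homeos\<close>).
  Applied to the powers of \<open>f\<close> with square exponents, this bounds the word length of \<open>f\<^sup>n\<close> by \<open>O(sqrt n)\<close>.\<close>

section \<open>Word length and cheap sequences\<close>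

context group
begin

definition word_in :: "'a set \<Rightarrow> nat \<Rightarrow> 'a \<Rightarrow> bool" where
  "word_in S k x \<longleftrightarrow> (\<exists>ws. length ws \<le> k \<and> set ws \<subseteq> S \<union> m_inv G ` S \<and> foldr (mult G) ws \<one> = x)"

lemma foldr_mult_closed: "set ws \<subseteq> carrier G \<Longrightarrow> foldr (mult G) ws \<one> \<in> carrier G"
  by (induction ws) auto

lemma foldr_mult_append:
  "set us \<subseteq> carrier G \<Longrightarrow> set vs \<subseteq> carrier G \<Longrightarrow>
    foldr (mult G) (us @ vs) \<one> = foldr (mult G) us \<one> \<otimes> foldr (mult G) vs \<one>"
  by (induction us) (auto simp: m_assoc foldr_mult_closed simp del: foldr_append)

lemma letters_subset: "S \<subseteq> carrier G \<Longrightarrow> S \<union> m_inv G ` S \<subseteq> carrier G"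
  by auto

lemma word_in_mono: "word_in S k x \<Longrightarrow> k \<le> l \<Longrightarrow> S \<subseteq> T \<Longrightarrow> word_in T l x"
  unfolding word_in_def by (elim exE, rule_tac x = ws in exI) fastforce

lemma word_in_one: "word_in S k \<one>"
  unfolding word_in_def by (rule exI[of _ "[]"]) simp

lemma word_in_letter: "S \<subseteq> carrier G \<Longrightarrow> x \<in> S \<Longrightarrow> word_in S 1 x"
  unfolding word_in_def by (rule exI[of _ "[x]"]) auto

lemma word_in_mult:
  assumes "S \<subseteq> carrier G" "word_in S k x" "word_in S l y"
  shows "word_in S (k + l) (x \<otimes> y)"
proof -
  obtain us vs where "length us \<le> k" "set us \<subseteq> S \<union> m_inv G ` S" "foldr (mult G) us \<one> = x"
     "length vs \<le> l" "set vs \<subseteq> S \<union> m_inv G ` S" "foldr (mult G) vs \<one> = y"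
    using assms unfolding word_in_def by blast
  then show ?thesis
    unfolding word_in_def using letters_subset[OF assms(1)]
    by (intro exI[of _ "us @ vs"]) (use foldr_mult_append[of us vs] in auto)
qed

lemma word_in_inv:
  assumes "S \<subseteq> carrier G" "word_in S k x"
  shows "word_in S k (inv x)"
proof -
  have *: "foldr (mult G) (rev (map (m_inv G) us)) \<one> = inv (foldr (mult G) us \<one>)"
    if "set us \<subseteq> carrier G" for us
    using that
  proof (induction us)
    case (Cons a us)
    then show ?case
      using foldr_mult_append[of "rev (map (m_inv G) us)" "[inv a]"]
      by (auto simp: inv_mult_group foldr_mult_closed simp del: foldr_append)
  qed simp
  obtain us where us: "length us \<le> k" "set us \<subseteq> S \<union> m_inv G ` S" "foldr (mult G) us \<one> = x"
    using assms unfolding word_in_def by blast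
  have "set (rev (map (m_inv G) us)) \<subseteq> S \<union> m_inv G ` S"
    using us(2) assms(1) by (force simp: image_iff)
  then show ?thesis
    unfolding word_in_def using us letters_subset[OF assms(1)]
    by (intro exI[of _ "rev (map (m_inv G) us)"]) (use *[of us] in auto)
qed

lemma word_in_pow: "S \<subseteq> carrier G \<Longrightarrow> word_in S k x \<Longrightarrow> word_in S (k * n) (x [^] (n::nat))"
proof (induction n)
  case (Suc n)
  then show ?case
    using word_in_mult[of S "k * n" "x [^] n" k x] by (simp add: add.commute)
qed (simp add: word_in_one)

lemma word_in_generate:
  assumes "S \<subseteq> carrier G" "x \<in> generate G S"
  shows "\<exists>k. word_in S k x"
  using assms(2)
proof induction
  case one then show ?case using word_in_one by blast
next
  case (incl h) then show ?case using word_in_letter[OF assms(1)] by blast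
next
  case (inv h) then show ?case using word_in_letter[OF assms(1)] word_in_inv[OF assms(1)] by blast
next
  case (eng h1 h2) then show ?case using word_in_mult[OF assms(1)] by blast
qed

text \<open>Linear growth is all that is needed, since it will be applied to powers with square exponents. This
  property survives products, inverses, conjugation and the merging of two sequences.\<close>

definition cheap :: "(nat \<Rightarrow> 'a) \<Rightarrow> bool" where
  "cheap x \<longleftrightarrow> (\<exists>S C. finite S \<and> S \<subseteq> carrier G \<and> (\<forall>n. word_in S (C * Suc n) (x n)))"

lemma cheapI: "finite S \<Longrightarrow> S \<subseteq> carrier G \<Longrightarrow> (\<And>n. word_in S (C * Suc n) (x n)) \<Longrightarrow> cheap x"
  unfolding cheap_def by blast

lemma cheap_mult:
  assumes "cheap x" "cheap y"
  shows "cheap (\<lambda>n. x n \<otimes> y n)"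
proof -
  obtain S C T D where *: "finite S" "S \<subseteq> carrier G" "finite T" "T \<subseteq> carrier G"
    "\<And>n. word_in S (C * Suc n) (x n)" "\<And>n. word_in T (D * Suc n) (y n)"
    using assms unfolding cheap_def by blast
  have "word_in (S \<union> T) (C * Suc n) (x n)" "word_in (S \<union> T) (D * Suc n) (y n)" for n
    using *(5)[of n] *(6)[of n] by (auto elim: word_in_mono)
  then have "word_in (S \<union> T) ((C + D) * Suc n) (x n \<otimes> y n)" for n
    using word_in_mult[of "S \<union> T"] * by (metis Un_subset_iff distrib_right)
  then show ?thesis
    using * by (intro cheapI[of "S \<union> T" "C + D"]) auto
qed

lemma cheap_inv: "cheap x \<Longrightarrow> cheap (\<lambda>n. inv (x n))"
  unfolding cheap_def by (elim exE conjE) (blast intro: word_in_inv)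

lemma cheap_finite_range:
  assumes "finite T" "T \<subseteq> carrier G" "\<And>n. x n \<in> T"
  shows "cheap x"
  using assms word_in_mono[OF word_in_letter[of T] _ subset_refl] by (intro cheapI[of T 1]) auto

lemma cheap_conj:
  assumes "cheap x" "c \<in> carrier G"
  shows "cheap (\<lambda>n. c \<otimes> x n \<otimes> inv c)"
  using assms cheap_finite_range[of "{c}" "\<lambda>_. c"] cheap_finite_range[of "{inv c}" "\<lambda>_. inv c"]
  by (intro cheap_mult) auto

lemma cheap_if:
  assumes "cheap x" "cheap y"
  shows "cheap (\<lambda>n. if P n then x n else y n)"
proof -
  obtain S C T D where *: "finite S" "S \<subseteq> carrier G" "finite T" "T \<subseteq> carrier G"
    "\<And>n. word_in S (C * Suc n) (x n)" "\<And>n. word_in T (D * Suc n) (y n)"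
    using assms unfolding cheap_def by blast
  have "word_in (S \<union> T) ((C + D) * Suc n) (x n)" "word_in (S \<union> T) ((C + D) * Suc n) (y n)" for n
    using *(5)[of n] *(6)[of n] by (auto elim!: word_in_mono intro!: add_mono mult_right_mono simp del: mult_Suc_right)
  then show ?thesis
    using * by (intro cheapI[of "S \<union> T" "C + D"]) auto
qed

text \<open>Write \<open>n = m\<^sup>2 + r\<close> with \<open>r \<le> 2 * m\<close>: the square power costs \<open>O(m)\<close> letters, the remaining \<open>r\<close>
  factors one letter each.\<close>

lemma word_length_sqrt:
  assumes S: "S \<subseteq> carrier G" and f: "f \<in> S"
    and w: "\<And>n. word_in S (C * Suc n) (f [^] (n\<^sup>2))"
  shows "\<exists>k. word_in S k (f [^] (n::nat)) \<and> real k \<le> (real C + 2) * sqrt n + C"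
proof -
  define m where "m = nat \<lfloor>sqrt n\<rfloor>"
  have m: "real m \<le> sqrt n" "sqrt n < real m + 1"
    unfolding m_def by (auto simp: of_nat_nat) 
  have "real (m\<^sup>2) \<le> n"
    using m(1) by (metis of_nat_0_le_iff of_nat_power real_sqrt_le_iff real_sqrt_unique)
  then have mn: "m\<^sup>2 \<le> n" by linarith
  have "real n < real ((m + 1)\<^sup>2)"
    using m(2) by (metis of_nat_1 of_nat_add of_nat_power real_less_rsqrt real_sqrt_less_iff real_sqrt_abs abs_of_nat)
  then have "n < (m + 1)\<^sup>2" using of_nat_less_iff by blast
  then have r: "n - m\<^sup>2 \<le> 2 * m"
    by (simp add: power2_eq_square)
  have "word_in S (C * Suc m + 1 * (n - m\<^sup>2)) (f [^] (m\<^sup>2) \<otimes> f [^] (n - m\<^sup>2))"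
    by (intro word_in_mult[OF S] w word_in_pow[OF S] word_in_letter[OF S f])
  moreover have "f [^] (m\<^sup>2) \<otimes> f [^] (n - m\<^sup>2) = f [^] n"
    using mn S f by (auto simp: nat_pow_mult)
  ultimately have "word_in S (C * Suc m + (n - m\<^sup>2)) (f [^] n)" by simp
  moreover have "real (C * Suc m + (n - m\<^sup>2)) \<le> (real C + 2) * sqrt n + C"
  proof -
    have "real (n - m\<^sup>2) \<le> 2 * real m" using r by linarith
    then have "real (C * Suc m + (n - m\<^sup>2)) \<le> (real C + 2) * real m + C"
      by (simp add: algebra_simps)
    also have "\<dots> \<le> (real C + 2) * sqrt n + C"
      using m(1) by (intro add_right_mono mult_left_mono) auto
    finally show ?thesis .
  qed
  ultimately show ?thesis by blast
qed

lemma word_length_subgroup_le: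
  assumes S: "S \<subseteq> carrier G" and x: "word_in S k x" and H: "subgroup H G" "S \<subseteq> H"
  shows "word_length (G\<lparr>carrier := H\<rparr>) S x \<le> k"
proof -
  obtain ws where ws: "length ws \<le> k" "set ws \<subseteq> S \<union> m_inv G ` S" "foldr (mult G) ws \<one> = x"
    using x unfolding word_in_def by blast
  have "m_inv (G\<lparr>carrier := H\<rparr>) ` S = m_inv G ` S"
    using m_inv_consistent[OF H(1)] H(2) by (intro image_cong) auto
  then have "word_length (G\<lparr>carrier := H\<rparr>) S x \<le> length ws"
    unfolding word_length_def using ws by (intro Least_le) auto
  then show ?thesis using ws by simp
qed

lemma word_in_word_length:
  assumes H: "subgroup H G" and S: "S \<subseteq> H" and gen: "generate G S = H" and x: "x \<in> H"
  shows "word_in S (word_length (G\<lparr>carrier := H\<rparr>) S x) x"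
proof -
  have sub: "S \<subseteq> carrier G" using H S subgroup.subset by blast
  have eq: "m_inv (G\<lparr>carrier := H\<rparr>) ` S = m_inv G ` S"
    using m_inv_consistent[OF H(1)] S by (intro image_cong) auto
  obtain k where "word_in S k x" using word_in_generate[OF sub] gen x by blast
  then have "\<exists>n ws. length ws = n \<and> set ws \<subseteq> S \<union> m_inv (G\<lparr>carrier := H\<rparr>) ` S \<and>
      foldr (mult (G\<lparr>carrier := H\<rparr>)) ws (one (G\<lparr>carrier := H\<rparr>)) = x"
    unfolding word_in_def eq by auto
  from LeastI_ex[OF this, folded word_length_def] show ?thesis
    unfolding word_in_def eq by (elim exE, rule_tac x = ws in exI) auto
qed

text \<open>The subgroup is generated by \<open>f\<close> together with the finite set that makes the square powers cheap;
  in it \<open>f\<^sup>n\<close> has word length \<open>O(sqrt n)\<close>.\<close>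

lemma distorted_if_cheap_squares:
  assumes f: "f \<in> carrier G" and c: "cheap (\<lambda>n. f [^] (n\<^sup>2))"
  shows "distorted G f"
proof -
  obtain S0 C where S0: "finite S0" "S0 \<subseteq> carrier G" and w: "\<And>n. word_in S0 (C * Suc n) (f [^] (n\<^sup>2))"
    using c unfolding cheap_def by blast
  define S where "S = insert f S0"
  define H where "H = generate G S"
  have S: "finite S" "S \<subseteq> carrier G" "f \<in> S" using S0 f by (auto simp: S_def)
  have H: "subgroup H G" "S \<subseteq> H"
    using S by (auto simp: H_def generate_is_subgroup intro: generate.incl)
  have w': "word_in S (C * Suc n) (f [^] (n\<^sup>2))" for n
    using w[of n] by (auto simp: S_def elim: word_in_mono)
  have pow: "f [^]\<^bsub>G\<lparr>carrier := H\<rparr>\<^esub> n = f [^] n" for n :: nat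
    by (simp add: nat_pow_def)
  have bound: "real (word_length (G\<lparr>carrier := H\<rparr>) S (f [^] n)) \<le> (real C + 2) * sqrt n + C" for n :: nat
  proof -
    obtain k where k: "word_in S k (f [^] n)" "real k \<le> (real C + 2) * sqrt n + C"
      using word_length_sqrt[OF S(2,3) w'] by blast
    show ?thesis using word_length_subgroup_le[OF S(2) k(1) H] k(2) by linarith
  qed
  have "(\<lambda>n. real (word_length (G\<lparr>carrier := H\<rparr>) S (f [^] n)) / real n) \<longlonglongrightarrow> 0"
  proof (rule tendsto_sandwich[OF _ _ tendsto_const])
    have "(\<lambda>n. inverse (sqrt (real n))) \<longlonglongrightarrow> 0"
      by (rule filterlim_compose[OF tendsto_inverse_0_at_top filterlim_ident])
         (rule filterlim_compose[OF sqrt_at_top filterlim_real_sequentially])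
    from tendsto_add[OF tendsto_mult_right_zero[OF this, of "real C + 2"]
        tendsto_mult_right_zero[OF lim_inverse_n, of "real C"]]
    have "(\<lambda>n. (real C + 2) * inverse (sqrt (real n)) + real C * inverse (real n)) \<longlonglongrightarrow> 0"
      by simp
    moreover have "((real C + 2) * sqrt n + C) / n = (real C + 2) * inverse (sqrt n) + C * inverse (real n)"
      for n :: nat
      by (cases "n = 0") (auto simp: field_simps)
    ultimately show "(\<lambda>n. ((real C + 2) * sqrt (real n) + C) / real n) \<longlonglongrightarrow> 0" by presburger
    show "\<forall>\<^sub>F n in sequentially. real (word_length (G\<lparr>carrier := H\<rparr>) S (f [^] n)) / real n
        \<le> ((real C + 2) * sqrt (real n) + C) / real n"
      by (rule always_eventually) (blast intro: divide_right_mono bound of_nat_0_le_iff)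
  qed simp
  moreover have "generate (G\<lparr>carrier := H\<rparr>) S = H"
    using generate_consistent[OF H(2,1)] by (simp add: H_def)
  ultimately have "fg_distorted (G\<lparr>carrier := H\<rparr>) f"
    unfolding fg_distorted_def using S(1) H pow by (intro exI[of _ S]) simp
  then show ?thesis
    unfolding distorted_def using H S(3) by (intro exI[of _ H]) auto
qed

end

section \<open>Germs\<close>

text \<open>A germ is represented by its filter of one-sided neighbourhoods, so that exchanges act on germs by
  pushing filters forward.\<close>

definition germs :: "real filter set" where
  "germs = at_right ` {0..<1} \<union> at_left ` {0<..1}"

definition loc :: "real filter \<Rightarrow> real" where
  "loc F = Lim F (\<lambda>x. x)"

lemma germsI [intro]:
  "0 \<le> a \<Longrightarrow> a < 1 \<Longrightarrow> at_right a \<in> germs"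
  "0 < a \<Longrightarrow> a \<le> 1 \<Longrightarrow> at_left a \<in> germs"
  by (auto simp: germs_def)

lemma germs_cases:
  assumes "F \<in> germs"
  obtains (right) a where "0 \<le> a" "a < 1" "F = at_right a" | (left) a where "0 < a" "a \<le> 1" "F = at_left a"
  using assms by (auto simp: germs_def)

lemma loc_at_right [simp]: "loc (at_right a) = a" and loc_at_left [simp]: "loc (at_left a) = a"
  by (auto simp: loc_def intro!: tendsto_Lim tendsto_ident_at)

lemma germ_neq_bot: "F \<in> germs \<Longrightarrow> F \<noteq> bot"
  by (elim germs_cases) auto

lemma germ_tendsto_loc: "F \<in> germs \<Longrightarrow> ((\<lambda>x. x) \<longlongrightarrow> loc F) F"
  by (elim germs_cases) (auto intro!: tendsto_ident_at)

lemma tendsto_imp_loc: "F \<in> germs \<Longrightarrow> ((\<lambda>x. x) \<longlongrightarrow> a) F \<Longrightarrow> loc F = a"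
  using germ_tendsto_loc germ_neq_bot tendsto_unique by blast

lemma loc_bounds: "F \<in> germs \<Longrightarrow> 0 \<le> loc F" "F \<in> germs \<Longrightarrow> loc F \<le> 1"
  by (elim germs_cases; simp)+

lemma eventually_germ_interior: "F \<in> germs \<Longrightarrow> \<forall>\<^sub>F x in F. x \<in> {0<..<1}"
  by (elim germs_cases) (auto intro: eventually_mono[OF eventually_at_right_real] eventually_mono[OF eventually_at_left_real])

lemma eventually_germ_notin:
  assumes "F \<in> germs" "finite A"
  shows "\<forall>\<^sub>F x in F. x \<notin> A"
proof -
  have "\<forall>\<^sub>F x in F. x \<noteq> a" for a
    using assms(1)
  proof (cases rule: germs_cases)
    case (right b)
    then show ?thesis
      by (cases "b < a") (auto simp: eventually_at_right_field intro!: exI[of _ "if b < a then a else b + 1"])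
  next
    case (left b)
    then show ?thesis
      by (cases "a < b") (auto simp: eventually_at_left_field intro!: exI[of _ "if a < b then a else b - 1"])
  qed
  then have "\<forall>\<^sub>F x in F. \<forall>a\<in>A. x \<noteq> a"
    using assms(2) by (intro eventually_ball_finite) auto
  then show ?thesis by (auto elim: eventually_mono)
qed

lemma eventually_germ_in:
  assumes "F \<in> germs" "finite ({0..1} - S)"
  shows "\<forall>\<^sub>F x in F. x \<in> S"
  using eventually_germ_notin[OF assms] eventually_germ_interior[OF assms(1)]
  by eventually_elim auto

lemma at_left_neq_at_right [simp]: "at_left (a::real) \<noteq> at_right b" "at_right b \<noteq> at_left (a::real)"
proof -
  show "at_left a \<noteq> at_right b"
  proof
    assume eq: "at_left a = at_right b"
    then have "a = b" by (metis loc_at_left loc_at_right)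
    then have "\<forall>\<^sub>F x in at_left a. x < a \<and> x > a"
      using eq eventually_at_right_less[of b] eventually_at_left_real[of "a - 1" a]
      by (intro eventually_conj) (auto elim: eventually_mono)
    then have "\<forall>\<^sub>F x in at_left a. False" by (rule eventually_mono) auto
    then show False by simp
  qed
  then show "at_right b \<noteq> at_left a" by metis
qed

lemma germs_at:
  assumes "F \<in> germs" "loc F = a"
  shows "F = at_left a \<or> F = at_right a"
  using assms by (elim germs_cases) auto

lemma germs_at_0: "F \<in> germs \<Longrightarrow> loc F = 0 \<Longrightarrow> F = at_right 0"
  and germs_at_1: "F \<in> germs \<Longrightarrow> loc F = 1 \<Longrightarrow> F = at_left 1"
  by (auto elim!: germs_cases)

lemma finite_germs_over:
  assumes "finite A"
  shows "finite {F \<in> germs. loc F \<in> A}" "card {F \<in> germs. loc F \<in> A} \<le> 2 * card A"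
proof -
  have sub: "{F \<in> germs. loc F \<in> A} \<subseteq> at_left ` A \<union> at_right ` A"
    using germs_at by blast
  then show "finite {F \<in> germs. loc F \<in> A}"
    using assms finite_subset by blast
  have "card {F \<in> germs. loc F \<in> A} \<le> card (at_left ` A \<union> at_right ` A)"
    using sub assms by (intro card_mono) auto
  also have "\<dots> \<le> card (at_left ` A) + card (at_right ` A)" by (rule card_Un_le)
  also have "\<dots> \<le> card A + card A" using assms by (intro add_mono card_image_le)
  finally show "card {F \<in> germs. loc F \<in> A} \<le> 2 * card A" by simp
qed

text \<open>Pairing the germs at the two ends of the interval as well makes this an involution without fixed
  points on all germs, as if the interval were closed up to a circle.\<close>

definition opp :: "real filter \<Rightarrow> real filter" where
  "opp F = (if F = at_right 0 then at_left 1 else if F = at_left 1 then at_right 0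
     else if F = at_right (loc F) then at_left (loc F) else at_right (loc F))"

lemma opp_right: "0 < a \<Longrightarrow> opp (at_right a) = at_left a"
  and opp_left: "a < 1 \<Longrightarrow> opp (at_left a) = at_right a"
  and opp_0: "opp (at_right 0) = at_left 1" and opp_1: "opp (at_left 1) = at_right 0"
proof -
  have "at_right a \<noteq> at_right (0::real)" if "0 < a" for a
    using that by (metis loc_at_right less_irrefl)
  then show "0 < a \<Longrightarrow> opp (at_right a) = at_left a" by (simp add: opp_def)
  have "at_left a \<noteq> at_left (1::real)" if "a < 1" for a
    using that by (metis loc_at_left less_irrefl)
  then show "a < 1 \<Longrightarrow> opp (at_left a) = at_right a" by (simp add: opp_def)
qed (auto simp: opp_def)

lemma opp_germs: "F \<in> germs \<Longrightarrow> opp F \<in> germs"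
  and opp_opp: "F \<in> germs \<Longrightarrow> opp (opp F) = F"
  and opp_neq: "F \<in> germs \<Longrightarrow> opp F \<noteq> F"
proof -
  assume F: "F \<in> germs"
  show "opp F \<in> germs"
    using F
  proof (cases rule: germs_cases)
    case (right a) then show ?thesis by (cases "a = 0") (auto simp: opp_right opp_0)
  next
    case (left a) then show ?thesis by (cases "a = 1") (auto simp: opp_left opp_1)
  qed
  show "opp (opp F) = F"
    using F
  proof (cases rule: germs_cases)
    case (right a) then show ?thesis by (cases "a = 0") (auto simp: opp_right opp_0 opp_left opp_1)
  next
    case (left a) then show ?thesis by (cases "a = 1") (auto simp: opp_left opp_1 opp_right opp_0)
  qed
  show "opp F \<noteq> F"
    using F
  proof (cases rule: germs_cases)
    case (right a) then show ?thesis by (cases "a = 0") (auto simp: opp_right opp_0)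
  next
    case (left a) then show ?thesis by (cases "a = 1") (auto simp: opp_left opp_1)
  qed
qed

lemma loc_opp: "F \<in> germs \<Longrightarrow> loc F \<noteq> 0 \<Longrightarrow> loc F \<noteq> 1 \<Longrightarrow> loc (opp F) = loc F"
  by (elim germs_cases) (auto simp: opp_right opp_left)

lemma same_loc_imp_opp:
  assumes "F \<in> germs" "G \<in> germs" "loc F = loc G" "F \<noteq> G"
  shows "G = opp F"
  using assms(1)
proof (cases rule: germs_cases)
  case (right a) then show ?thesis
    using assms germs_at[OF assms(2), of a] germs_at_0[OF assms(2)] by (cases "a = 0") (auto simp: opp_right)
next
  case (left a) then show ?thesis
    using assms germs_at[OF assms(2), of a] germs_at_1[OF assms(2)] by (cases "a = 1") (auto simp: opp_left)
qed

section \<open>The action on germs\<close>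

lemma filtermap_reflect:
  "filtermap (\<lambda>x. c - x) (at_right a) = at_left (c - a :: real)"
  "filtermap (\<lambda>x. c - x) (at_left a) = at_right (c - a :: real)"
proof -
  have *: "(\<exists>b>a. \<forall>y>a. y < b \<longrightarrow> P (c - y)) \<longleftrightarrow> (\<exists>b<c - a. \<forall>y>b. y < c - a \<longrightarrow> P y)" for a P
  proof safe
    fix b assume b: "b > a" "\<forall>y>a. y < b \<longrightarrow> P (c - y)"
    have "P y" if "c - b < y" "y < c - a" for y
      using that b(2)[rule_format, of "c - y"] by simp
    then show "\<exists>b<c - a. \<forall>y>b. y < c - a \<longrightarrow> P y"
      using b(1) by (intro exI[of _ "c - b"]) auto
  next
    fix b assume b: "b < c - a" "\<forall>y>b. y < c - a \<longrightarrow> P y"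
    then show "\<exists>b>a. \<forall>y>a. y < b \<longrightarrow> P (c - y)"
      by (intro exI[of _ "c - b"]) auto
  qed
  show 1: "filtermap (\<lambda>x. c - x) (at_right a) = at_left (c - a)" for a
    by (rule filter_eqI) (simp add: eventually_filtermap eventually_at_right_field eventually_at_left_field *)
  show "filtermap (\<lambda>x. c - x) (at_left a) = at_right (c - a)"
    unfolding 1[of "c - a", simplified, symmetric] by (simp add: filtermap_filtermap)
qed

text \<open>The image sits just above the infimum \<open>c\<close> of the values: all values slightly larger than \<open>c\<close> are
  attained, by the intermediate value theorem, and by monotonicity only close to \<open>a\<close>.\<close>

lemma filtermap_at_right_mono:
  fixes f :: "real \<Rightarrow> real"
  assumes "a < b" and cont: "continuous_on {a<..<b} f" and mono: "strict_mono_on {a<..<b} f"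
    and bnd: "f ` {a<..<b} \<subseteq> {0..1}"
  shows "filtermap f (at_right a) \<in> at_right ` {0..<1}"
proof -
  define c where "c = Inf (f ` {a<..<b})"
  have ne: "f ` {a<..<b} \<noteq> {}" using assms(1) by simp
  have bdd: "bdd_below (f ` {a<..<b})" using bnd by (intro bdd_belowI[of _ 0]) auto
  have le: "c \<le> f x" if "x \<in> {a<..<b}" for x
    unfolding c_def using bdd that by (intro cInf_lower) auto
  have less: "c < f x" if "x \<in> {a<..<b}" for x
  proof -
    have "f ((a + x) / 2) < f x" using mono that by (auto simp: strict_mono_on_def)
    moreover have "c \<le> f ((a + x) / 2)" using that by (intro le) auto
    ultimately show ?thesis by linarith
  qed
  have close: "\<exists>x\<in>{a<..<b}. f x < d" if "c < d" for d
    using that cInf_less_iff[OF ne bdd, of d] by (auto simp: c_def)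
  have "0 \<le> c" unfolding c_def using bnd ne by (intro cInf_greatest) auto
  moreover have mid: "(a + b) / 2 \<in> {a<..<b}" using assms(1) by simp
  then have "f ((a + b) / 2) \<in> {0..1}" using bnd by blast
  then have "c < 1" using less[OF mid] by simp
  moreover have "filtermap f (at_right a) = at_right c"
  proof (rule filter_eqI)
    fix P
    have "eventually P (at_right c)" if "\<exists>d>a. \<forall>y>a. y < d \<longrightarrow> P (f y)"
    proof -
      obtain d where d: "d > a" "\<And>y. y > a \<Longrightarrow> y < d \<Longrightarrow> P (f y)" using \<open>\<exists>d>a. _\<close> by blast
      define u where "u = min ((a + d) / 2) ((a + b) / 2)"
      have u: "u \<in> {a<..<b}" "u < d" using d(1) assms(1) by (auto simp: u_def min_def)
      have "P z" if z: "c < z" "z < f u" for z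
      proof -
        obtain x where x: "x \<in> {a<..<b}" "f x < z" using close z(1) by blast
        have "x < u"
          using x z mono u by (metis less_trans not_less_iff_gr_or_eq strict_mono_onD)
        then have "\<exists>y\<ge>x. y \<le> u \<and> f y = z"
          using x u z by (intro IVT') (auto intro: continuous_on_subset[OF cont])
        then show ?thesis using d(2) x(1) u z by force
      qed
      then show ?thesis using less[OF u(1)] unfolding eventually_at_right_field by blast
    qed
    moreover have "\<exists>d>a. \<forall>y>a. y < d \<longrightarrow> P (f y)" if ev: "eventually P (at_right c)"
    proof -
      obtain d where d: "d > c" "\<And>z. z > c \<Longrightarrow> z < d \<Longrightarrow> P z"
        using ev unfolding eventually_at_right_field by blast
      obtain x where x: "x \<in> {a<..<b}" "f x < d" using close d(1) by blast
      have "P (f y)" if "a < y" "y < x" for y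
      proof -
        have "y \<in> {a<..<b}" "f y < f x" using that x mono by (auto simp: strict_mono_on_def)
        then show ?thesis using d less x by force
      qed
      then show ?thesis using x by auto
    qed
    ultimately show "eventually P (filtermap f (at_right a)) = eventually P (at_right c)"
      unfolding eventually_filtermap eventually_at_right_field[of _ a] by blast
  qed
  ultimately show ?thesis by auto
qed

lemma filtermap_at_right_inj:
  fixes f :: "real \<Rightarrow> real"
  assumes "a < b" and cont: "continuous_on {a<..<b} f" and inj: "inj_on f {a<..<b}"
    and bnd: "f ` {a<..<b} \<subseteq> {0..1}"
  shows "filtermap f (at_right a) \<in> germs"
proof -
  have "strict_mono_on {a<..<b} f \<or> strict_antimono_on {a<..<b} f"
    using injective_eq_monotone_map[of "{a<..<b}" f] inj cont
    by (simp add: is_interval_convex_1)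
  then show ?thesis
  proof
    assume "strict_antimono_on {a<..<b} f"
    then have "strict_mono_on {a<..<b} (\<lambda>x. 1 - f x)"
      by (auto simp: strict_mono_on_def monotone_on_def)
    then have "filtermap (\<lambda>x. 1 - f x) (at_right a) \<in> at_right ` {0..<1}"
      using bnd by (intro filtermap_at_right_mono[OF assms(1)] continuous_intros cont) auto
    then obtain c where c: "0 \<le> c" "c < 1" "filtermap (\<lambda>x. 1 - f x) (at_right a) = at_right c" by auto
    have "filtermap f (at_right a) = filtermap (\<lambda>x. 1 - x) (filtermap (\<lambda>x. 1 - f x) (at_right a))"
      by (simp add: filtermap_filtermap)
    also have "\<dots> = at_left (1 - c)" by (simp add: c filtermap_reflect)
    finally show ?thesis using c by auto
  qed (use filtermap_at_right_mono[OF assms(1) cont _ bnd] in \<open>auto simp: germs_def\<close>)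
qed

lemma filtermap_at_left_inj:
  fixes f :: "real \<Rightarrow> real"
  assumes "b < a" and cont: "continuous_on {b<..<a} f" and inj: "inj_on f {b<..<a}"
    and bnd: "f ` {b<..<a} \<subseteq> {0..1}"
  shows "filtermap f (at_left a) \<in> germs"
proof -
  have "filtermap (\<lambda>x. f (0 - x)) (at_right (0 - a)) \<in> germs"
  proof (rule filtermap_at_right_inj)
    show "continuous_on {0 - a<..<0 - b} (\<lambda>x. f (0 - x))"
      by (rule continuous_on_compose2[OF cont]) (auto intro!: continuous_intros)
    show "inj_on (\<lambda>x. f (0 - x)) {0 - a<..<0 - b}"
    proof (rule inj_onI)
      fix x y assume "x \<in> {0 - a<..<0 - b}" "y \<in> {0 - a<..<0 - b}" "f (0 - x) = f (0 - y)"
      then have "0 - x = 0 - y" using inj_onD[OF inj, of "0 - x" "0 - y"] by simp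
      then show "x = y" by simp
    qed
    show "(\<lambda>x. f (0 - x)) ` {0 - a<..<0 - b} \<subseteq> {0..1}" 
      by (rule image_subsetI, rule subsetD[OF bnd], rule imageI) auto
  qed (use assms(1) in simp)
  moreover have "filtermap (\<lambda>x. f (0 - x)) (at_right (0 - a)) = filtermap f (filtermap (\<lambda>x. 0 - x) (at_right (0 - a)))"
    by (simp add: filtermap_filtermap)
  ultimately show ?thesis using filtermap_reflect(1)[of 0 "0 - a"] by simp
qed

text \<open>Along a germ an exchange is defined, continuous and injective, hence strictly monotone.\<close>

lemma filtermap_giet_germ:
  assumes "is_giet \<phi>" "F \<in> germs"
  shows "filtermap (pval \<phi>) F \<in> germs"
proof -
  note g = assms(1)[unfolded is_giet_iff]
  have ev: "\<forall>\<^sub>F x in F. x \<in> dom \<phi>" using eventually_germ_in assms(2) g by blast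
  have sub: "pval \<phi> ` S \<subseteq> {0..1}" if "S \<subseteq> dom \<phi>" for S using that g image_mono[OF that, of "pval \<phi>"] unfolding ran_pval by (meson order_trans)
  show ?thesis
    using assms(2)
  proof (cases rule: germs_cases)
    case (right a)
    then obtain b where "b > a" "{a<..<b} \<subseteq> dom \<phi>"
      using ev by (force simp: eventually_at_right_field simp del: domIff)
    then show ?thesis unfolding right
      using g by (intro filtermap_at_right_inj[of a b] sub) (auto intro: continuous_on_subset inj_on_subset)
  next
    case (left a)
    then obtain b where "b < a" "{b<..<a} \<subseteq> dom \<phi>"
      using ev by (force simp: eventually_at_left_field simp del: domIff)
    then show ?thesis unfolding left
      using g by (intro filtermap_at_left_inj[of b a] sub) (auto intro: continuous_on_subset inj_on_subset)
  qed
qed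

text \<open>Any representative gives the same action on germs, because two representatives differ only at
  finitely many points, and these are avoided by every germ.\<close>

definition gact :: "(real \<rightharpoonup> real) set \<Rightarrow> real filter \<Rightarrow> real filter" where
  "gact A F = filtermap (pval (SOME \<phi>. \<phi> \<in> A)) F"

interpretation GIET: group GIET by (rule group_GIET)

lemma GIET_class: "is_giet \<phi> \<Longrightarrow> giet_rel `` {\<phi>} \<in> carrier GIET"
  by (auto simp: GIET_def quotient_def)

lemma GIET_obtain:
  assumes "A \<in> carrier GIET"
  obtains \<phi> where "is_giet \<phi>" "A = giet_rel `` {\<phi>}"
proof -
  have "A \<in> {f. is_giet f} // giet_rel" using assms by (simp add: GIET_def)
  then show ?thesis by (rule quotientE) (use that in simp)
qed

lemma GIET_rep_class: "A \<in> carrier GIET \<Longrightarrow> \<phi> \<in> A \<Longrightarrow> is_giet \<phi> \<and> A = giet_rel `` {\<phi>}"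
proof (elim GIET_obtain)
  fix \<psi> assume "\<phi> \<in> A" "A = giet_rel `` {\<psi>}"
  then have "(\<psi>, \<phi>) \<in> giet_rel" "A = giet_rel `` {\<psi>}" by auto
  then show "is_giet \<phi> \<and> A = giet_rel `` {\<phi>}"
    using equiv_class_eq[OF equiv_giet_rel] by (simp add: giet_rel_def)
qed

lemma class_self: "is_giet \<phi> \<Longrightarrow> \<phi> \<in> giet_rel `` {\<phi>}"
  by (auto simp: giet_rel_def)

lemma GIET_rep_exists: "A \<in> carrier GIET \<Longrightarrow> \<exists>\<phi>. \<phi> \<in> A"
  by (elim GIET_obtain) (auto dest: class_self)

lemma GIET_one: "\<one>\<^bsub>GIET\<^esub> = giet_rel `` {giet_id}"
  by (simp add: GIET_def)

lemma filtermap_eventually_eq: "\<forall>\<^sub>F x in F. f x = g x \<Longrightarrow> filtermap f F = filtermap g F"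
  by (auto simp: filter_eq_iff eventually_filtermap elim: eventually_elim2)

lemma gact_rep:
  assumes "A \<in> carrier GIET" "\<phi> \<in> A" "F \<in> germs"
  shows "gact A F = filtermap (pval \<phi>) F"
proof -
  define \<psi> where "\<psi> = (SOME \<phi>. \<phi> \<in> A)"
  have "\<psi> \<in> A" using assms(2) unfolding \<psi>_def by (rule someI[of "\<lambda>\<phi>. \<phi> \<in> A"])
  then have "(\<phi>, \<psi>) \<in> giet_rel"
    using GIET_rep_class[OF assms(1,2)] by auto
  then have "finite {x \<in> {0..1}. \<phi> x \<noteq> \<psi> x}" by (simp add: giet_rel_def)
  from eventually_germ_notin[OF assms(3) this] eventually_germ_interior[OF assms(3)]
  have "\<forall>\<^sub>F x in F. pval \<psi> x = pval \<phi> x"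
    by eventually_elim auto
  then show ?thesis
    unfolding gact_def \<psi>_def[symmetric] by (rule filtermap_eventually_eq)
qed

lemma gact_class: "is_giet \<phi> \<Longrightarrow> F \<in> germs \<Longrightarrow> gact (giet_rel `` {\<phi>}) F = filtermap (pval \<phi>) F"
  using gact_rep GIET_class class_self by blast

lemma gact_germs: "A \<in> carrier GIET \<Longrightarrow> F \<in> germs \<Longrightarrow> gact A F \<in> germs"
  by (elim GIET_obtain) (simp add: gact_class filtermap_giet_germ)

lemma gact_mult:
  assumes "A \<in> carrier GIET" "B \<in> carrier GIET" "F \<in> germs"
  shows "gact (A \<otimes>\<^bsub>GIET\<^esub> B) F = gact A (gact B F)"
proof -
  obtain \<phi> \<psi> where *: "is_giet \<phi>" "A = giet_rel `` {\<phi>}" "is_giet \<psi>" "B = giet_rel `` {\<psi>}"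
    using assms by (elim GIET_obtain) blast
  have "\<forall>\<^sub>F x in F. x \<in> dom \<psi>"
    using * assms(3) by (intro eventually_germ_in) (auto simp: is_giet_iff)
  then have "filtermap (pval (\<phi> \<circ>\<^sub>m \<psi>)) F = filtermap (pval \<phi> \<circ> pval \<psi>) F"
    by (intro filtermap_eventually_eq) (auto elim!: eventually_mono simp: pval_map_comp simp del: domIff)
  then show ?thesis
    using * assms(3) by (simp add: GIET_mult_class gact_class giet_comp filtermap_giet_germ filtermap_filtermap o_def)
qed

lemma gact_one: "F \<in> germs \<Longrightarrow> gact \<one>\<^bsub>GIET\<^esub> F = F"
proof -
  assume F: "F \<in> germs"
  have "filtermap (pval giet_id) F = filtermap (\<lambda>x. x) F"
    using eventually_germ_interior[OF F] by (intro filtermap_eventually_eq) (auto elim!: eventually_mono simp: giet_id_def)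
  then show ?thesis by (simp add: GIET_one gact_class F is_giet_id filtermap_ident)
qed

lemma gact_inv:
  assumes "A \<in> carrier GIET" "F \<in> germs"
  shows "gact (inv\<^bsub>GIET\<^esub> A) (gact A F) = F" "gact A (gact (inv\<^bsub>GIET\<^esub> A) F) = F"
  using assms by (simp_all add: gact_mult[symmetric] gact_one)

lemma gact_inj: "A \<in> carrier GIET \<Longrightarrow> F \<in> germs \<Longrightarrow> G \<in> germs \<Longrightarrow> gact A F = gact A G \<longleftrightarrow> F = G"
  by (metis gact_inv(1))

lemma bij_betw_gact: "A \<in> carrier GIET \<Longrightarrow> bij_betw (gact A) germs germs"
  by (rule bij_betw_byWitness[of _ "gact (inv\<^bsub>GIET\<^esub> A)"]) (auto simp: gact_inv gact_germs)

lemma gact_pow: "A \<in> carrier GIET \<Longrightarrow> F \<in> germs \<Longrightarrow> gact (A [^]\<^bsub>GIET\<^esub> (n::nat)) F = (gact A ^^ n) F"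
proof (induction n arbitrary: F)
  case (Suc n)
  then show ?case by (simp add: gact_mult gact_germs funpow_swap1)
qed (simp add: gact_one)

lemma loc_gact_rep:
  assumes "A \<in> carrier GIET" "\<phi> \<in> A" "F \<in> germs" "(pval \<phi> \<longlongrightarrow> c) F"
  shows "loc (gact A F) = c"
proof (rule tendsto_imp_loc)
  show "gact A F \<in> germs" using assms by (simp add: gact_germs)
  show "((\<lambda>x. x) \<longlongrightarrow> c) (gact A F)"
    using assms by (simp add: gact_rep filterlim_filtermap)
qed

lemma tendsto_loc_gact:
  assumes "A \<in> carrier GIET" "\<phi> \<in> A" "F \<in> germs"
  shows "(pval \<phi> \<longlongrightarrow> loc (gact A F)) F"
  using germ_tendsto_loc[OF gact_germs[OF assms(1,3)]]
  by (simp add: gact_rep[OF assms] filterlim_filtermap)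

lemma germ_le_at:
  assumes "F \<in> germs" "finite ({0..1} - S)"
  shows "F \<le> at (loc F) within S"
proof -
  have "filtermap (\<lambda>x. x) F \<le> at (loc F) within S"
    using eventually_germ_in[OF assms] eventually_germ_notin[OF assms(1), of "{loc F}"] germ_tendsto_loc[OF assms(1)]
    unfolding filterlim_def[symmetric] filterlim_at by (auto elim: eventually_elim2)
  then show ?thesis by (simp add: filtermap_ident)
qed

text \<open>An exchange is continuous at the points of its domain.\<close>

lemma loc_gact_dom:
  assumes "A \<in> carrier GIET" "\<phi> \<in> A" "F \<in> germs" "loc F \<in> dom \<phi>"
  shows "loc (gact A F) = pval \<phi> (loc F)"
proof (rule loc_gact_rep[OF assms(1-3)])
  have g: "is_giet \<phi>" using GIET_rep_class[OF assms(1,2)] by simp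
  then have "(pval \<phi> \<longlongrightarrow> pval \<phi> (loc F)) (at (loc F) within dom \<phi>)"
    using assms(4) by (auto simp: is_giet_iff continuous_on_def)
  then show "(pval \<phi> \<longlongrightarrow> pval \<phi> (loc F)) F"
    using germ_le_at[OF assms(3)] g by (auto simp: is_giet_iff intro: tendsto_mono)
qed

lemma discontinuities_germs:
  assumes "A \<in> carrier GIET"
  shows "discontinuities A = {a \<in> {0<..<1}. loc (gact A (at_left a)) \<noteq> loc (gact A (at_right a))}"
proof -
  have "Lim (at_left a) (pval \<phi>) = loc (gact A (at_left a))" "Lim (at_right a) (pval \<phi>) = loc (gact A (at_right a))"
    if "\<phi> \<in> A" "a \<in> {0<..<1}" for \<phi> a
    using that by (auto intro!: tendsto_Lim tendsto_loc_gact[OF assms])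
  then show ?thesis
    unfolding discontinuities_def using GIET_rep_exists[OF assms] by auto
qed

lemma finite_discontinuities:
  assumes "A \<in> carrier GIET"
  shows "finite (discontinuities A)"
proof -
  obtain \<phi> where \<phi>: "\<phi> \<in> A" using GIET_rep_exists[OF assms] by blast
  have "discontinuities A \<subseteq> {0..1} - dom \<phi>"
  proof
    fix a assume a: "a \<in> discontinuities A"
    then have "a \<in> {0<..<1}" "loc (gact A (at_left a)) \<noteq> loc (gact A (at_right a))"
      by (auto simp: discontinuities_germs[OF assms])
    then have "a \<notin> dom \<phi>"
      using loc_gact_dom[OF assms \<phi>, of "at_left a"] loc_gact_dom[OF assms \<phi>, of "at_right a"]
        germsI[of a] by (metis greaterThanLessThan_iff less_imp_le loc_at_left loc_at_right)
    then show "a \<in> {0..1} - dom \<phi>" using \<open>a \<in> {0<..<1}\<close> by simp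
  qed
  then show ?thesis
    using GIET_rep_class[OF assms \<phi>] by (auto simp: is_giet_iff intro: finite_subset)
qed

section \<open>Defects\<close>

text \<open>If the ends of the interval are joined to a circle, these germs are the two sides of the
  discontinuities.\<close>

definition defect :: "(real \<rightharpoonup> real) set \<Rightarrow> real filter set" where
  "defect A = {F \<in> germs. gact A (opp F) \<noteq> opp (gact A F)}"

text \<open>By continuity both germs at an interior point of the domain are sent to germs at the same point,
  and these are different because exchanges are injective on germs.\<close>

lemma finite_defect:
  assumes "A \<in> carrier GIET"
  shows "finite (defect A)"
proof -
  obtain \<phi> where \<phi>: "\<phi> \<in> A" using GIET_rep_exists[OF assms] by blast
  have g: "is_giet \<phi>" using GIET_rep_class[OF assms \<phi>] by blast
  define S where "S = ({0..1} - dom \<phi>) \<union> {0, 1}"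
  have S: "finite S" using g by (auto simp: S_def is_giet_iff)
  have "defect A \<subseteq> {F \<in> germs. loc F \<in> S}"
  proof
    fix F assume F: "F \<in> defect A"
    then have F': "F \<in> germs" "gact A (opp F) \<noteq> opp (gact A F)" by (auto simp: defect_def)
    show "F \<in> {F \<in> germs. loc F \<in> S}"
    proof (rule ccontr)
      assume "F \<notin> {F \<in> germs. loc F \<in> S}"
      then have d: "loc F \<in> dom \<phi>" "loc F \<noteq> 0" "loc F \<noteq> 1"
        using F' loc_bounds[of F] by (auto simp: S_def)
      then have "loc (gact A F) = loc (gact A (opp F))"
        using F' by (simp add: loc_gact_dom[OF assms \<phi>] opp_germs loc_opp)
      moreover have "gact A F \<noteq> gact A (opp F)"
        using gact_inj[OF assms F'(1) opp_germs[OF F'(1)]] opp_neq[OF F'(1)] by auto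
      ultimately show False
        using F' same_loc_imp_opp gact_germs[OF assms] opp_germs by blast
    qed
  qed
  then show ?thesis using finite_germs_over(1)[OF S] finite_subset by blast
qed

lemma defect_mult:
  assumes "A \<in> carrier GIET" "B \<in> carrier GIET"
  shows "card (defect (A \<otimes>\<^bsub>GIET\<^esub> B)) \<le> card (defect A) + card (defect B)"
proof -
  have "defect (A \<otimes>\<^bsub>GIET\<^esub> B) \<subseteq> gact (inv\<^bsub>GIET\<^esub> B) ` defect A \<union> defect B"
  proof
    fix F assume "F \<in> defect (A \<otimes>\<^bsub>GIET\<^esub> B)"
    then have F: "F \<in> germs" "gact A (gact B (opp F)) \<noteq> opp (gact A (gact B F))"
      using assms by (auto simp: defect_def gact_mult opp_germs)
    show "F \<in> gact (inv\<^bsub>GIET\<^esub> B) ` defect A \<union> defect B"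
    proof (cases "F \<in> defect B")
      case False
      then have "gact B (opp F) = opp (gact B F)" using F by (auto simp: defect_def)
      then have "gact B F \<in> defect A" using F assms by (auto simp: defect_def gact_germs)
      then show ?thesis using gact_inv(1)[OF assms(2) F(1)] by (metis UnI1 imageI)
    qed auto
  qed
  then have "card (defect (A \<otimes>\<^bsub>GIET\<^esub> B)) \<le> card (gact (inv\<^bsub>GIET\<^esub> B) ` defect A \<union> defect B)"
    using assms by (intro card_mono) (auto simp: finite_defect)
  also have "\<dots> \<le> card (gact (inv\<^bsub>GIET\<^esub> B) ` defect A) + card (defect B)" by (rule card_Un_le)
  also have "\<dots> \<le> card (defect A) + card (defect B)"
    using assms by (simp add: card_image_le finite_defect)
  finally show ?thesis .
qed

lemma defect_inv:
  assumes "A \<in> carrier GIET"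
  shows "card (defect (inv\<^bsub>GIET\<^esub> A)) \<le> card (defect A)"
proof -
  have "defect (inv\<^bsub>GIET\<^esub> A) \<subseteq> gact A ` defect A"
  proof
    fix F assume "F \<in> defect (inv\<^bsub>GIET\<^esub> A)"
    then have F: "F \<in> germs" "gact (inv\<^bsub>GIET\<^esub> A) (opp F) \<noteq> opp (gact (inv\<^bsub>GIET\<^esub> A) F)"
      by (auto simp: defect_def)
    define G where "G = gact (inv\<^bsub>GIET\<^esub> A) F"
    have G: "G \<in> germs" "F = gact A G" using F assms by (auto simp: G_def gact_germs gact_inv)
    have "G \<in> defect A"
      using F(2) G gact_inv(1)[OF assms opp_germs[OF G(1)]] gact_inv(1)[OF assms G(1)]
      by (auto simp: defect_def)
    then show "F \<in> gact A ` defect A" using G by blast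
  qed
  then have "card (defect (inv\<^bsub>GIET\<^esub> A)) \<le> card (gact A ` defect A)"
    using assms by (intro card_mono) (auto simp: finite_defect)
  also have "\<dots> \<le> card (defect A)" using assms by (simp add: card_image_le finite_defect)
  finally show ?thesis .
qed

section \<open>Permutations almost commuting with an involution\<close>

text \<open>The combinatorics of the action of one exchange on the set \<open>X\<close> of germs, with \<open>t\<close> for the
  involution \<open>opp\<close>. The growth of \<open>bad n\<close>, the set of points that the \<open>n\<close>-th iterate separates from their
  partner, is at stake.\<close>

locale almost_commuting =
  fixes X :: "'a set" and f t :: "'a \<Rightarrow> 'a"
  assumes bij: "bij_betw f X X"
    and t_closed: "x \<in> X \<Longrightarrow> t x \<in> X"
    and t_invol: "x \<in> X \<Longrightarrow> t (t x) = x"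
    and t_free: "x \<in> X \<Longrightarrow> t x \<noteq> x"
    and finite_exceptional: "finite {x \<in> X. f (t x) \<noteq> t (f x)}"
begin

abbreviation exceptional :: "'a set" where
  "exceptional \<equiv> {x \<in> X. f (t x) \<noteq> t (f x)}"

definition bad :: "nat \<Rightarrow> 'a set" where
  "bad n = {x \<in> X. (f ^^ n) (t x) \<noteq> t ((f ^^ n) x)}"

definition recurrent_bad :: "'a set" where
  "recurrent_bad = {x \<in> X. \<not> (\<forall>\<^sub>F n in sequentially. x \<notin> bad n)}"

lemma funpow_bij: "bij_betw (f ^^ n) X X"
  using bij by (rule bij_betw_funpow)

lemma funpow_closed: "x \<in> X \<Longrightarrow> (f ^^ n) x \<in> X"
  using funpow_bij bij_betwE by blast

lemma funpow_inj: "x \<in> X \<Longrightarrow> y \<in> X \<Longrightarrow> (f ^^ n) x = (f ^^ n) y \<longleftrightarrow> x = y"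
  using funpow_bij[of n] by (auto simp: bij_betw_def inj_on_def)

lemma bad_0 [simp]: "bad 0 = {}"
  by (simp add: bad_def)

text \<open>A pair of partners is separated or reunited only when it passes an exceptional point.\<close>

lemma bad_Suc: "x \<in> X \<Longrightarrow> (f ^^ n) x \<notin> exceptional \<Longrightarrow> x \<in> bad (Suc n) \<longleftrightarrow> x \<in> bad n"
proof -
  assume x: "x \<in> X" "(f ^^ n) x \<notin> exceptional"
  then have "t (f ((f ^^ n) x)) = f (t ((f ^^ n) x))"
    using funpow_closed[of x n] by auto
  then have "x \<in> bad (Suc n) \<longleftrightarrow> (f ^^ 1) ((f ^^ n) (t x)) \<noteq> (f ^^ 1) (t ((f ^^ n) x))"
    using x by (simp add: bad_def)
  also have "\<dots> \<longleftrightarrow> x \<in> bad n"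
    using x by (subst funpow_inj) (auto simp: bad_def funpow_closed t_closed)
  finally show ?thesis .
qed

lemma bad_imp_exceptional: "x \<in> X \<Longrightarrow> x \<in> bad n \<Longrightarrow> \<exists>i<n. (f ^^ i) x \<in> exceptional"
proof (induction n)
  case (Suc n)
  then show ?case using bad_Suc[of x n] less_Suc_eq by blast
qed simp

lemma finite_bad: "finite (bad n)"
proof -
  have "bad n \<subseteq> (\<Union>i<n. (f ^^ i) -` exceptional \<inter> X)"
    using bad_imp_exceptional by (auto simp: bad_def)
  moreover have "finite ((f ^^ i) -` exceptional \<inter> X)" for i
    using finite_exceptional funpow_bij[of i] by (intro finite_vimage_IntI) (auto simp: bij_betw_def)
  ultimately show ?thesis by (meson finite_UN_I finite_lessThan finite_subset)
qed

definition periodic :: "'a \<Rightarrow> bool" where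
  "periodic x \<longleftrightarrow> (\<exists>k>0. (f ^^ k) x = x)"

lemma funpow_inj_nonperiodic:
  assumes "x \<in> X" "\<not> periodic x"
  shows "inj (\<lambda>n. (f ^^ n) x)"
proof (rule linorder_injI)
  fix m n :: nat assume "m < n"
  show "(f ^^ m) x \<noteq> (f ^^ n) x"
  proof
    assume "(f ^^ m) x = (f ^^ n) x"
    also have "\<dots> = (f ^^ m) ((f ^^ (n - m)) x)"
      using \<open>m < n\<close> by (simp flip: funpow_add[THEN fun_cong, unfolded o_apply])
    finally have "(f ^^ (n - m)) x = x"
      using funpow_inj assms(1) funpow_closed by metis
    moreover have "n - m > 0" using \<open>m < n\<close> by simp
    ultimately show False using assms(2) unfolding periodic_def by blast
  qed
qed

text \<open>A nonperiodic orbit meets the finite exceptional set only finitely often.\<close>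

lemma eventually_bad_constant:
  assumes "x \<in> X" "\<not> periodic x"
  shows "(\<forall>\<^sub>F n in sequentially. x \<in> bad n) \<or> (\<forall>\<^sub>F n in sequentially. x \<notin> bad n)"
proof -
  have "finite ((\<lambda>n. (f ^^ n) x) -` exceptional)"
    using finite_exceptional funpow_inj_nonperiodic[OF assms] by (rule finite_vimageI)
  then obtain N where "\<forall>n\<in>(\<lambda>n. (f ^^ n) x) -` exceptional. n < N"
    unfolding finite_nat_set_iff_bounded by blast
  then have N: "\<And>n. (f ^^ n) x \<in> exceptional \<Longrightarrow> n < N" by blast
  have "x \<in> bad n \<longleftrightarrow> x \<in> bad N" if "n \<ge> N" for n
    using that
  proof (induction n rule: dec_induct)
    case (step n)
    then show ?case using bad_Suc[OF assms(1), of n] N[of n] by auto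
  qed simp
  then show ?thesis unfolding eventually_sequentially by metis
qed

lemma recurrent_bad_eventually_bad:
  "x \<in> recurrent_bad \<Longrightarrow> \<not> periodic x \<Longrightarrow> \<forall>\<^sub>F n in sequentially. x \<in> bad n"
  using eventually_bad_constant by (auto simp: recurrent_bad_def)

lemma finite_backward_orbit:
  assumes d: "d \<in> X" "periodic d"
  shows "finite {x \<in> X. \<exists>i. (f ^^ i) x = d}"
proof -
  obtain k where k: "k > 0" "(f ^^ k) d = d" using d by (auto simp: periodic_def)
  have "x \<in> (\<lambda>m. (f ^^ m) d) ` {..<k}" if x: "x \<in> X" "(f ^^ i) x = d" for x i
  proof -
    have "(f ^^ (k * i)) d = d"
      using funpow_mod_eq[OF k(2), of "k * i"] by simp
    moreover have "k * i = i + (k * i - i)" using k(1) by (cases k) auto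
    ultimately have "(f ^^ i) ((f ^^ (k * i - i)) d) = (f ^^ i) x"
      using x(2) by (metis comp_apply funpow_add)
    then have "x = (f ^^ (k * i - i)) d"
      using funpow_inj x(1) d(1) funpow_closed by metis
    also have "\<dots> = (f ^^ ((k * i - i) mod k)) d"
      by (rule funpow_mod_eq[OF k(2), symmetric])
    finally show ?thesis using k(1) by auto
  qed
  then have "{x \<in> X. \<exists>i. (f ^^ i) x = d} \<subseteq> (\<lambda>m. (f ^^ m) d) ` {..<k}" by blast
  then show ?thesis by (rule finite_subset) simp
qed

text \<open>Every recurrently bad point eventually meets the exceptional set, so some exceptional point \<open>d\<close>
  has infinitely many of them in its backward orbit \<open>b 0, b 1, \<dots>\<close>, which is then infinite. Far enough in the
  past this orbit avoids the exceptional points. There, the pairs of the \<open>b i\<close> with their partners are all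
  images of each other, so that if one of them is bad from time \<open>n0\<close> on, then at time \<open>n\<close> this holds for about
  \<open>n - n0\<close> of them.\<close>

lemma linear_growth:
  assumes inf: "infinite recurrent_bad"
  shows "\<exists>C. \<forall>n. n \<le> card (bad n) + C"
proof -
  have "recurrent_bad \<subseteq> (\<Union>d\<in>exceptional. {x \<in> recurrent_bad. \<exists>i. (f ^^ i) x = d})"
  proof
    fix x assume x: "x \<in> recurrent_bad"
    then have xX: "x \<in> X" by (simp add: recurrent_bad_def)
    have "\<exists>n. x \<in> bad n"
      using x by (auto simp: recurrent_bad_def eventually_sequentially)
    then show "x \<in> (\<Union>d\<in>exceptional. {x \<in> recurrent_bad. \<exists>i. (f ^^ i) x = d})"
      using bad_imp_exceptional[OF xX] x by blast
  qed
  then obtain d where d: "d \<in> exceptional" and infd: "infinite {x \<in> recurrent_bad. \<exists>i. (f ^^ i) x = d}"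
    using inf finite_exceptional by (meson finite_UN_I finite_subset)
  have dX: "d \<in> X" using d by simp
  have "{x \<in> recurrent_bad. \<exists>i. (f ^^ i) x = d} \<subseteq> {x \<in> X. \<exists>i. (f ^^ i) x = d}"
    by (auto simp: recurrent_bad_def)
  then have np: "\<not> periodic d"
    using finite_backward_orbit[OF dX] infd finite_subset by blast
  define b where "b i = (inv_into X f ^^ i) d" for i
  have bX: "b i \<in> X" for i
    unfolding b_def using bij_betw_funpow[OF bij_betw_inv_into[OF bij]] dX bij_betwE by blast
  have bS: "f (b (Suc i)) = b i" for i
    using bij_betw_inv_into_right[OF bij bX[of i]] by (simp add: b_def)
  have shift: "(f ^^ j) (b (i + j)) = b i" for i j
  proof (induction j arbitrary: i)
    case (Suc j)
    then show ?case using Suc.IH[of "Suc i"] bS[of i] by simp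
  qed simp
  have binj: "inj b"
  proof (rule linorder_injI)
    fix m n :: nat assume "m < n"
    show "b m \<noteq> b n"
    proof
      assume eq: "b m = b n"
      have "(f ^^ n) (b n) = d" using shift[of n 0] by (simp add: b_def)
      moreover have "(f ^^ n) (b m) = (f ^^ (n - m)) ((f ^^ m) (b m))"
        using \<open>m < n\<close> by (simp flip: funpow_add[THEN fun_cong, unfolded o_apply])
      moreover have "(f ^^ m) (b m) = d" using shift[of m 0] by (simp add: b_def)
      ultimately have "(f ^^ (n - m)) d = d" using eq by simp
      moreover have "n - m > 0" using \<open>m < n\<close> by simp
      ultimately show False using np unfolding periodic_def by blast
    qed
  qed
  have "finite (b -` exceptional)" using finite_exceptional binj by (rule finite_vimageI)
  then obtain I where "\<forall>i\<in>b -` exceptional. i < I"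
    unfolding finite_nat_set_iff_bounded by blast
  then have I: "\<And>i. b i \<in> exceptional \<Longrightarrow> i < I" by blast
  have "{x \<in> recurrent_bad. \<exists>i. (f ^^ i) x = d} \<subseteq> b ` (b -` recurrent_bad)"
  proof
    fix x assume "x \<in> {x \<in> recurrent_bad. \<exists>i. (f ^^ i) x = d}"
    then obtain i where x: "x \<in> recurrent_bad" "x \<in> X" "(f ^^ i) x = d" by (auto simp: recurrent_bad_def)
    moreover have "(f ^^ i) (b i) = d" using shift[of i 0] by (simp add: b_def)
    ultimately have "x = b i" using funpow_inj bX by metis
    then show "x \<in> b ` (b -` recurrent_bad)" using x by blast
  qed
  then have "infinite (b -` recurrent_bad)" using infd finite_subset by blast
  then obtain i0 where i0: "i0 \<ge> I" "b i0 \<in> recurrent_bad"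
    by (auto simp: infinite_nat_iff_unbounded_le)
  have "\<not> periodic (b i0)"
  proof
    assume "periodic (b i0)"
    then obtain k where k: "k > 0" "(f ^^ k) (b i0) = b i0" by (auto simp: periodic_def)
    have "(f ^^ k) d = (f ^^ k) ((f ^^ i0) (b i0))" using shift[of i0 0] by (simp add: b_def)
    also have "\<dots> = (f ^^ i0) ((f ^^ k) (b i0))"
      by (simp add: add.commute flip: funpow_add[THEN fun_cong, unfolded o_apply])
    also have "\<dots> = d" using k(2) shift[of i0 0] by (simp add: b_def)
    finally show False using np k(1) unfolding periodic_def by blast
  qed
  then obtain n0 where n0: "\<And>n. n \<ge> n0 \<Longrightarrow> b i0 \<in> bad n"
    using recurrent_bad_eventually_bad[OF i0(2)] unfolding eventually_sequentially by blast
  (* Until it reaches b i0, the orbit of b (i0 + m) avoids the exceptional points. *)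
  have good: "b (i0 + m) \<notin> bad m" for m
  proof -
    have "b (i0 + m) \<notin> bad j" if "j \<le> m" for j
      using that
    proof (induction j)
      case (Suc j)
      have "(f ^^ j) (b (i0 + m)) = b (i0 + (m - j))"
        using shift[of j "i0 + (m - j)"] Suc.prems by simp
      then have "(f ^^ j) (b (i0 + m)) \<notin> exceptional"
        using I[of "i0 + (m - j)"] i0(1) by auto
      then show ?case using bad_Suc[OF bX] Suc by simp
    qed simp
    then show ?thesis by simp
  qed
  have "b (i0 + m) \<in> bad n" if "m + n0 \<le> n" for m n
  proof -
    have n: "n = (n - m) + m" using that by simp
    have "(f ^^ m) (t (b (i0 + m))) = t (b i0)"
      using good[of m] shift[of m i0] bX[of "i0 + m"] by (auto simp: bad_def)
    then have "(f ^^ n) (t (b (i0 + m))) = (f ^^ (n - m)) (t (b i0))"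
      by (subst n) (simp add: funpow_add)
    moreover have "(f ^^ n) (b (i0 + m)) = (f ^^ (n - m)) (b i0)"
      by (subst n) (simp add: funpow_add shift)
    ultimately show ?thesis
      using n0[of "n - m"] that bX by (auto simp: bad_def)
  qed
  then have sub: "(\<lambda>m. b (i0 + m)) ` {..<Suc n - n0} \<subseteq> bad n" for n by auto
  have "n \<le> card (bad n) + n0" for n
  proof -
    have "inj (\<lambda>m. b (i0 + m))" using binj by (auto dest: injD intro!: injI)
    then have "card ((\<lambda>m. b (i0 + m)) ` {..<Suc n - n0}) = Suc n - n0"
      by (simp add: card_image inj_on_subset)
    then have "Suc n - n0 \<le> card (bad n)" using card_mono[OF finite_bad sub[of n]] by simp
    then show ?thesis by simp
  qed
  then show ?thesis by blast
qed

text \<open>The eventual value of the conjugates \<open>f\<^sup>-\<^sup>n t f\<^sup>n\<close>, where there is one. It commutes with \<open>f\<close> because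
  shifting a sequence does not change its eventual value.\<close>

definition linked :: "'a \<Rightarrow> 'a \<Rightarrow> bool" where
  "linked x y \<longleftrightarrow> x \<in> X \<and> y \<in> X \<and> (\<forall>\<^sub>F n in sequentially. (f ^^ n) y = t ((f ^^ n) x))"

lemma linked_closed: "linked x y \<Longrightarrow> x \<in> X" "linked x y \<Longrightarrow> y \<in> X"
  by (auto simp: linked_def)

lemma linked_sym: "linked x y \<Longrightarrow> linked y x"
  unfolding linked_def by (auto elim!: eventually_mono simp: t_invol funpow_closed)

lemma linked_functional: "linked x y \<Longrightarrow> linked x z \<Longrightarrow> y = z"
proof -
  assume *: "linked x y" "linked x z"
  then have "\<forall>\<^sub>F n in sequentially. (f ^^ n) y = (f ^^ n) z"
    unfolding linked_def by (auto elim: eventually_elim2)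
  then obtain n where "(f ^^ n) y = (f ^^ n) z" using eventually_happens by fastforce
  then show "y = z" using * funpow_inj by (auto simp: linked_def)
qed

lemma linked_irrefl: "\<not> linked x x"
proof
  assume *: "linked x x"
  then obtain n where "(f ^^ n) x = t ((f ^^ n) x)"
    using eventually_happens unfolding linked_def by fastforce
  then show False using t_free[OF funpow_closed] * by (auto simp: linked_def dest: sym)
qed

lemma linked_iff_image: "x \<in> X \<Longrightarrow> y \<in> X \<Longrightarrow> linked (f x) (f y) \<longleftrightarrow> linked x y"
proof -
  assume *: "x \<in> X" "y \<in> X"
  have "(\<forall>\<^sub>F n in sequentially. (f ^^ n) y = t ((f ^^ n) x)) \<longleftrightarrow>
     (\<forall>\<^sub>F n in sequentially. (f ^^ Suc n) y = t ((f ^^ Suc n) x))"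
    by (rule eventually_sequentially_Suc[symmetric])
  then show ?thesis
    using * bij_betwE[OF bij] by (simp add: linked_def funpow_swap1)
qed

lemma linked_t: "x \<in> X \<Longrightarrow> x \<notin> recurrent_bad \<Longrightarrow> linked x (t x)"
  by (auto simp: linked_def recurrent_bad_def bad_def t_closed)

end

section \<open>Threading a finite set of strands into chains\<close>

lemma count_le_1_imp_distinct: "(\<And>x. count (mset xs) x \<le> 1) \<Longrightarrow> distinct xs"
proof (induction xs)
  case (Cons a xs)
  have "count (mset xs) x \<le> 1" for x
    using Cons.prems[of x] by (rule order_trans[rotated]) simp
  moreover have "count (mset xs) a = 0" using Cons.prems[of a] by simp
  ultimately show ?case using Cons.IH by (simp add: count_mset_0_iff)
qed simp

text \<open>The set \<open>E\<close> consists of the ends of finitely many pieces, \<open>mate\<close> exchanges the two ends of a piece, and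
  the partial matching \<open>R\<close> tells which ends are glued together.\<close>

locale strands =
  fixes E :: "'a set" and mate :: "'a \<Rightarrow> 'a" and R :: "'a \<Rightarrow> 'a \<Rightarrow> bool"
  assumes finite_E: "finite E"
    and mate_closed: "x \<in> E \<Longrightarrow> mate x \<in> E"
    and mate_mate: "x \<in> E \<Longrightarrow> mate (mate x) = x"
    and R_closed: "x \<in> E \<Longrightarrow> R x y \<Longrightarrow> y \<in> E"
    and R_sym: "R x y \<Longrightarrow> R y x"
    and R_functional: "R x y \<Longrightarrow> R x z \<Longrightarrow> y = z"
    and R_irrefl: "\<not> R x x"
begin

abbreviation follows :: "'a \<Rightarrow> 'a \<Rightarrow> bool" where
  "follows x y \<equiv> R (mate x) y"

abbreviation flip :: "'a list \<Rightarrow> 'a list" where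
  "flip c \<equiv> rev (map mate c)"

text \<open>A chain lists the ends at which its pieces are entered. The equation of multisets says that each
  piece is traversed exactly once, in one of its two directions.\<close>

definition threading :: "'a list multiset \<Rightarrow> bool" where
  "threading M \<longleftrightarrow> (\<forall>c\<in>#M. c \<noteq> [] \<and> successively follows c) \<and>
     \<Sum>\<^sub># (image_mset mset M) + image_mset mate (\<Sum>\<^sub># (image_mset mset M)) = mset_set E"

lemma threading_E:
  assumes "threading M"
  shows "E = (\<Union>c\<in>set_mset M. set c \<union> mate ` set c)"
proof -
  have "set_mset (\<Sum>\<^sub># (image_mset mset M) + image_mset mate (\<Sum>\<^sub># (image_mset mset M))) = E"
    using assms finite_E by (simp add: threading_def)
  then show ?thesis by auto
qed

lemma threading_count:
  assumes "threading M"
  shows "count (\<Sum>\<^sub># (image_mset mset M)) x + count (image_mset mate (\<Sum>\<^sub># (image_mset mset M))) x \<le> 1"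
proof -
  have eq: "\<Sum>\<^sub># (image_mset mset M) + image_mset mate (\<Sum>\<^sub># (image_mset mset M)) = mset_set E"
    using assms unfolding threading_def by (rule conjunct2)
  have "count (mset_set E) x \<le> 1" by (simp add: count_mset_set')
  then show ?thesis by (simp only: eq[symmetric] count_union)
qed

lemma threading_distinct:
  assumes "threading M" "c \<in># M"
  shows "distinct c" "set c \<inter> mate ` set c = {}"
proof -
  obtain M' where M: "M = add_mset c M'" using multi_member_split[OF assms(2)] by blast
  have le: "count (mset c) x + count (image_mset mate (mset c)) x \<le> 1" for x
    using threading_count[OF assms(1), of x] unfolding M by simp
  have "count (mset c) x \<le> 1" for x using le[of x] by simp
  then show "distinct c"
    by (rule count_le_1_imp_distinct)
  show "set c \<inter> mate ` set c = {}"
  proof (rule ccontr)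
    assume "set c \<inter> mate ` set c \<noteq> {}"
    then obtain x where "x \<in> set c" "x \<in> mate ` set c" by blast
    then have "count (mset c) x > 0" "count (image_mset mate (mset c)) x > 0"
      by (simp_all only: count_greater_zero_iff set_mset_mset set_image_mset)
    then show False using le[of x] by linarith
  qed
qed

lemma threading_disjoint:
  assumes "threading (add_mset c (add_mset d M))"
  shows "set c \<inter> set d = {}" "set d \<inter> mate ` set c = {}"
proof -
  have le: "count (mset c) x + count (mset d) x + count (image_mset mate (mset c)) x \<le> 1" for x
    using threading_count[OF assms, of x] by simp
  have *: "x \<in> set c \<Longrightarrow> count (mset c) x > 0" "x \<in> set d \<Longrightarrow> count (mset d) x > 0"
    "x \<in> mate ` set c \<Longrightarrow> count (image_mset mate (mset c)) x > 0" for x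
    by (simp_all only: count_greater_zero_iff set_mset_mset set_image_mset)
  have False if "x \<in> set c" "x \<in> set d" for x
    using le[of x] *(1,2)[of x] that by linarith
  then show "set c \<inter> set d = {}" by blast
  have False if "x \<in> mate ` set c" "x \<in> set d" for x
    using le[of x] *(2,3)[of x] that by linarith
  then show "set d \<inter> mate ` set c = {}" by blast
qed

lemma threading_merge:
  assumes "threading (add_mset c (add_mset d M))" "follows (last c) (hd d)"
  shows "threading (add_mset (c @ d) M)"
  using assms by (auto simp: threading_def successively_append_iff add.assoc)

text \<open>A chain may be traversed backwards because the matching is symmetric.\<close>

lemma threading_flip:
  assumes "threading (add_mset c M)"
  shows "threading (add_mset (flip c) M)"
proof -
  have sub: "set c \<subseteq> E" using threading_E[OF assms] by auto
  have c: "c \<noteq> []" "successively follows c" using assms by (auto simp: threading_def)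
  have "successively (\<lambda>x y. follows (mate y) (mate x)) c"
    using c(2)
  proof (rule successively_mono)
    fix x y assume "x \<in> set c" "y \<in> set c" "follows x y"
    then show "follows (mate y) (mate x)" using sub mate_mate[of y] R_sym by auto
  qed
  then have "successively follows (flip c)"
    by (simp add: successively_rev successively_map)
  moreover have "image_mset mate (image_mset mate (mset c)) = mset c"
    using sub by (auto simp: multiset.map_comp mate_mate intro!: multiset.map_ident_strong)
  ultimately show ?thesis
    using assms c(1) by (auto simp: threading_def add_ac)
qed

text \<open>If the exit of the last piece were glued to an end of another chain, the two chains could be
  joined, after reversing the second one if necessary, against minimality. It cannot be glued to an end
  inside a chain, which has a partner already. Only the entrance of the same chain remains.\<close>

lemma minimal_threading_end:
  assumes M: "threading M" and min: "\<And>M'. threading M' \<Longrightarrow> size M \<le> size M'"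
    and c: "c \<in># M" and R: "follows (last c) y"
  shows "y = hd c"
proof -
  have sub: "set d \<subseteq> E" if "d \<in># M" for d using threading_E[OF M] that by auto
  have ne: "d \<noteq> []" and succ: "successively follows d" if "d \<in># M" for d
    using M that by (auto simp: threading_def)
  have lc: "last c \<in> E" "last c \<in> set c" using sub[OF c] ne[OF c] by auto
  have "y \<in> E" using R_closed[OF mate_closed[OF lc(1)] R] .
  then obtain d where d: "d \<in># M" "y \<in> set d \<union> mate ` set d" using threading_E[OF M] by blast
  have split: "\<exists>M'. M = add_mset c (add_mset d M')" if "d \<noteq> c"
    using that c d(1) by (metis insert_noteq_member mset_add)
  have disj: "set c \<inter> set d = {}" if "d \<noteq> c"
    using split[OF that] M threading_disjoint(1) by blast
  have disj': "set d \<inter> mate ` set c = {}"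
    using split M threading_disjoint(2) threading_distinct(2)[OF M c] by (cases "d = c") blast+
  consider "y \<in> set d" | x where "x \<in> set d" "y = mate x" using d(2) by blast
  then show ?thesis
  proof cases
    case 1
    then obtain us vs where uv: "d = us @ y # vs" by (auto dest: split_list)
    show ?thesis
    proof (cases "us = []")
      case True
      show ?thesis
      proof (cases "d = c")
        case False
        then obtain M' where M': "M = add_mset c (add_mset d M')" using split by blast
        then have "threading (add_mset (c @ d) M')"
          using M R uv True by (intro threading_merge) auto
        then show ?thesis using min[of "add_mset (c @ d) M'"] M' by simp
      qed (use uv True in auto)
    next
      case False
      then have "follows (last us) y" using succ[OF d(1)] uv by (auto simp: successively_append_iff)
      then have "mate (last us) = mate (last c)" using R R_sym R_functional by blast
      moreover have "last us \<in> set us" using False by simp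
      then have "last us \<in> E" using sub[OF d(1)] uv by auto
      ultimately have eq: "last us = last c" using mate_mate lc(1) by metis
      show ?thesis
      proof (cases "d = c")
        case True
        then have "last c \<in> set (y # vs)" using uv by auto
        then show ?thesis using threading_distinct(1)[OF M d(1)] uv \<open>last us \<in> set us\<close> eq by auto
      qed (use disj eq lc(2) \<open>last us \<in> set us\<close> uv in auto)
    qed
  next
    case (2 x)
    then obtain us vs where uv: "d = us @ x # vs" by (auto dest: split_list)
    show ?thesis
    proof (cases "vs = []")
      case True
      show ?thesis
      proof (cases "d = c")
        case True
        then have "last c = x" using uv \<open>vs = []\<close> by auto
        then show ?thesis using R R_irrefl[of "mate x"] 2(2) by simp
      next
        case False
        then obtain M' where M': "M = add_mset c (add_mset d M')" using split by blast
        then have "threading (add_mset (flip d) (add_mset c M'))"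
          using M threading_flip[of d "add_mset c M'"] by (simp add: add_mset_commute)
        moreover have "follows (last c) (hd (flip d))"
          using R 2(2) uv True by simp
        ultimately have "threading (add_mset (c @ flip d) M')"
          by (intro threading_merge) (simp_all add: add_mset_commute)
        then show ?thesis using min[of "add_mset (c @ flip d) M'"] M' by simp
      qed
    next
      case False
      then have "R y (hd vs)" using succ[OF d(1)] uv 2(2) by (cases vs) (auto simp: successively_append_iff)
      then have "hd vs = mate (last c)" using R R_sym R_functional by blast
      moreover have "hd vs \<in> set d" using uv False by simp
      ultimately show ?thesis using disj' lc(2) by blast
    qed
  qed
qed

text \<open>The chains of a shortest threading: each of them is either closed up to a circle by \<open>R\<close>, or an arc
  whose two ends are not glued to anything. The single pieces form a threading to start from.\<close>

lemma chains_exist: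
  assumes E0: "E0 \<union> mate ` E0 = E" "E0 \<inter> mate ` E0 = {}"
  shows "\<exists>css. distinct (concat css) \<and> set (concat css) \<union> mate ` set (concat css) = E \<and>
     set (concat css) \<inter> mate ` set (concat css) = {} \<and>
     (\<forall>c\<in>set css. c \<noteq> [] \<and> successively follows c \<and>
        (\<forall>y. follows (last c) y \<longrightarrow> y = hd c) \<and> (\<forall>y. R (hd c) y \<longrightarrow> y = mate (last c)))"
proof -
  have finE0: "finite E0" using E0(1) finite_E by (metis finite_Un)
  define M0 where "M0 = image_mset (\<lambda>x. [x]) (mset_set E0)"
  have "inj_on mate E0" using E0(1) mate_mate by (metis UnI1 inj_onI)
  then have "threading M0"
    using finE0 E0 unfolding threading_def M0_def
    by (auto simp: multiset.map_comp o_def image_mset_mset_set mset_set_Union[symmetric])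
  then obtain M where M: "threading M" and min: "\<And>M'. threading M' \<Longrightarrow> size M \<le> size M'"
    using ex_has_least_nat[of threading M0 size] by blast
  obtain css where css: "mset css = M" using ex_mset by blast
  have sm: "\<Sum>\<^sub># (image_mset mset M) = mset (concat css)"
    by (simp add: mset_concat css[symmetric] sum_mset_sum_list[symmetric])
  have cnt: "count (mset (concat css)) x + count (image_mset mate (mset (concat css))) x \<le> 1" for x
    using threading_count[OF M, of x] sm by simp
  have "count (mset (concat css)) x \<le> 1" for x using cnt[of x] by linarith
  then have "distinct (concat css)"
    by (rule count_le_1_imp_distinct)
  moreover have "set (concat css) \<inter> mate ` set (concat css) = {}"
  proof (rule ccontr)
    assume "set (concat css) \<inter> mate ` set (concat css) \<noteq> {}"
    then obtain x where "x \<in> set (concat css)" "x \<in> mate ` set (concat css)" by blast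
    then have "count (mset (concat css)) x > 0" "count (image_mset mate (mset (concat css))) x > 0"
      by (simp_all only: count_greater_zero_iff set_mset_mset set_image_mset)
    then show False using cnt[of x] by linarith
  qed
  moreover have "set (concat css) \<union> mate ` set (concat css) = E"
    using threading_E[OF M] css[symmetric] by auto
  moreover have "c \<noteq> [] \<and> successively follows c \<and>
        (\<forall>y. follows (last c) y \<longrightarrow> y = hd c) \<and> (\<forall>y. R (hd c) y \<longrightarrow> y = mate (last c))"
    if "c \<in> set css" for c
  proof (intro conjI allI impI)
    have c: "c \<in># M" using that css by auto
    then show ne: "c \<noteq> []" and "successively follows c" using M by (auto simp: threading_def)
    show "y = hd c" if "follows (last c) y" for y
      using minimal_threading_end[OF M min c that] .
    obtain M' where M': "M = add_mset c M'" using multi_member_split[OF c] by blast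
    have "set c \<subseteq> E" using threading_E[OF M] c by auto
    then have hd: "hd c \<in> E" using ne by auto
    show "y = mate (last c)" if "R (hd c) y" for y
    proof -
      have "y = hd (flip c)"
      proof (rule minimal_threading_end)
        show "threading (add_mset (flip c) M')" using threading_flip M M' by blast
        show "size (add_mset (flip c) M') \<le> size N" if "threading N" for N using min[OF that] M' by simp
        show "follows (last (flip c)) y" using that ne hd by (simp add: last_rev hd_map mate_mate)
      qed simp
      then show ?thesis using ne by (simp add: hd_rev last_map)
    qed
  qed
  ultimately show ?thesis by blast
qed

end

section \<open>Gluing germs into circles\<close>

lemma filtermap_affine_pos:
  fixes c d :: real assumes "c > 0"
  shows "filtermap (\<lambda>x. c * x + d) (at_right a) = at_right (c * a + d)"
    "filtermap (\<lambda>x. c * x + d) (at_left a) = at_left (c * a + d)"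
proof -
  have r: "filtermap (\<lambda>x. c * x + d) (at_right a) = at_right (c * a + d)" for a d
  proof -
    have "filtermap (\<lambda>x. c * x + d) (at_right a) = filtermap (\<lambda>x. x - (- d)) (filtermap ((*) c) (at_right a))"
      by (simp add: filtermap_filtermap)
    also have "\<dots> = at_right (c * a + d)"
      using filtermap_at_right_shift[of "- d" "c * a"] filtermap_times_pos_at_right[OF assms, of a] by simp
    finally show ?thesis .
  qed
  then show "filtermap (\<lambda>x. c * x + d) (at_right a) = at_right (c * a + d)" .
  have "filtermap (\<lambda>x. c * x + d) (at_left a) =
     filtermap (\<lambda>x. 0 - x) (filtermap (\<lambda>x. c * x + (- d)) (filtermap (\<lambda>x. 0 - x) (at_left a)))"
    by (simp add: filtermap_filtermap add.commute)
  also have "\<dots> = at_left (c * a + d)"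
    by (simp only: filtermap_reflect r) (simp add: add.commute)
  finally show "filtermap (\<lambda>x. c * x + d) (at_left a) = at_left (c * a + d)" .
qed

lemma filtermap_affine_neg:
  fixes c d :: real assumes "c < 0"
  shows "filtermap (\<lambda>x. c * x + d) (at_right a) = at_left (c * a + d)"
    "filtermap (\<lambda>x. c * x + d) (at_left a) = at_right (c * a + d)"
proof -
  have *: "filtermap (\<lambda>x. c * x + d) F = filtermap (\<lambda>x. (- c) * x + d) (filtermap (\<lambda>x. 0 - x) F)" for F
    by (simp add: filtermap_filtermap add.commute)
  show "filtermap (\<lambda>x. c * x + d) (at_right a) = at_left (c * a + d)"
    "filtermap (\<lambda>x. c * x + d) (at_left a) = at_right (c * a + d)"
    using assms filtermap_affine_pos[of "- c" d "0 - a"] unfolding * filtermap_reflect by simp_all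
qed

text \<open>The interval is cut at the points of \<open>F\<close>. The ends of the resulting pieces are the germs at these
  points.\<close>

locale cut_points =
  fixes F :: "real set"
  assumes finite_F: "finite F" and F_sub: "F \<subseteq> {0..1}" and F_ends: "0 \<in> F" "1 \<in> F"
begin

definition ends :: "real filter set" where
  "ends = {x \<in> germs. loc x \<in> F}"

definition mate :: "real filter \<Rightarrow> real filter" where
  "mate x = (if x = at_right (loc x) then at_left (Min {b \<in> F. b > loc x})
     else at_right (Max {a \<in> F. a < loc x}))"

lemma next_F:
  assumes "x < 1"
  defines "b \<equiv> Min {b \<in> F. b > x}"
  shows "b \<in> F" "x < b" "\<And>y. y \<in> F \<Longrightarrow> x < y \<Longrightarrow> b \<le> y"
proof -
  have "finite {b \<in> F. b > x}" "{b \<in> F. b > x} \<noteq> {}" using finite_F F_ends assms by auto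
  from Min_in[OF this] show "b \<in> F" "x < b" unfolding b_def by auto
  show "\<And>y. y \<in> F \<Longrightarrow> x < y \<Longrightarrow> b \<le> y" unfolding b_def using finite_F by (intro Min_le) auto
qed

lemma prev_F:
  assumes "0 < x"
  defines "a \<equiv> Max {a \<in> F. a < x}"
  shows "a \<in> F" "a < x" "\<And>y. y \<in> F \<Longrightarrow> y < x \<Longrightarrow> y \<le> a"
proof -
  have "finite {a \<in> F. a < x}" "{a \<in> F. a < x} \<noteq> {}" using finite_F F_ends assms by auto
  from Max_in[OF this] show "a \<in> F" "a < x" unfolding a_def by auto
  show "\<And>y. y \<in> F \<Longrightarrow> y < x \<Longrightarrow> y \<le> a" unfolding a_def using finite_F by (intro Max_ge) auto
qed

definition consecutive :: "real \<Rightarrow> real \<Rightarrow> bool" where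
  "consecutive a b \<longleftrightarrow> a \<in> F \<and> b \<in> F \<and> a < b \<and> (\<forall>y\<in>F. y \<le> a \<or> b \<le> y)"

lemma consecutive_next: "a \<in> F \<Longrightarrow> a < 1 \<Longrightarrow> consecutive a (Min {b \<in> F. b > a})"
  using next_F[of a] unfolding consecutive_def by (meson leI)

lemma consecutive_prev: "b \<in> F \<Longrightarrow> 0 < b \<Longrightarrow> consecutive (Max {a \<in> F. a < b}) b"
  using prev_F[of b] unfolding consecutive_def by (meson leI)

lemma consecutive_unique:
  "consecutive a b \<Longrightarrow> consecutive a' b' \<Longrightarrow> a < x \<Longrightarrow> x < b \<Longrightarrow> a' < x \<Longrightarrow> x < b' \<Longrightarrow> a = a' \<and> b = b'"
proof -
  assume *: "consecutive a b" "consecutive a' b'" "a < x" "x < b" "a' < x" "x < b'"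
  have "a' \<le> a" "b \<le> b'" "a \<le> a'" "b' \<le> b"
    using *(1)[unfolded consecutive_def] *(2)[unfolded consecutive_def] *(3-) by force+
  then show "a = a' \<and> b = b'" by simp
qed

lemma consecutive_bounds: "consecutive a b \<Longrightarrow> 0 \<le> a \<and> a < 1 \<and> 0 < b \<and> b \<le> 1"
proof -
  assume *: "consecutive a b"
  then have "a \<in> {0..1}" "b \<in> {0..1}" "a < b" using F_sub by (auto simp: consecutive_def)
  then show ?thesis by auto
qed

lemma consecutive_inj: "consecutive a b \<Longrightarrow> consecutive a b' \<Longrightarrow> b = b'" "consecutive a b \<Longrightarrow> consecutive a' b \<Longrightarrow> a = a'"
proof -
  show "b = b'" if "consecutive a b" "consecutive a b'"
  proof -
    have "b' \<le> b" "b \<le> b'" using that by (auto simp: consecutive_def dest: bspec)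
    then show ?thesis by simp
  qed
  show "a = a'" if "consecutive a b" "consecutive a' b"
  proof -
    have "a' \<le> a" "a \<le> a'" using that by (auto simp: consecutive_def dest: bspec)
    then show ?thesis by simp
  qed
qed

lemma mate_right:
  assumes "consecutive a b" shows "mate (at_right a) = at_left b"
proof -
  have "consecutive a (Min {b \<in> F. b > a})"
    using consecutive_next consecutive_bounds[OF assms] assms unfolding consecutive_def[of a b] by blast
  then have "Min {b \<in> F. b > a} = b" using consecutive_inj(1) assms by blast
  then show ?thesis by (simp add: mate_def)
qed

lemma mate_left:
  assumes "consecutive a b" shows "mate (at_left b) = at_right a"
proof -
  have "consecutive (Max {a \<in> F. a < b}) b"
    using consecutive_prev consecutive_bounds[OF assms] assms unfolding consecutive_def[of a b] by blast
  then have "Max {a \<in> F. a < b} = a" using consecutive_inj(2) assms by blast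
  then show ?thesis by (simp add: mate_def)
qed

lemma ends_cases:
  assumes "x \<in> ends"
  obtains (right) a b where "consecutive a b" "x = at_right a" "mate x = at_left b"
  | (left) a b where "consecutive a b" "x = at_left b" "mate x = at_right a"
proof -
  have x: "x \<in> germs" "loc x \<in> F" using assms by (auto simp: ends_def)
  show ?thesis
    using x(1)
  proof (cases rule: germs_cases)
    case (right a)
    then show ?thesis using consecutive_next[of a] mate_right x(2) that(1) by simp
  next
    case (left b)
    then show ?thesis using consecutive_prev[of b] mate_left x(2) that(2) by simp
  qed
qed

lemma consecutive_ends: "consecutive a b \<Longrightarrow> at_right a \<in> ends" "consecutive a b \<Longrightarrow> at_left b \<in> ends"
  using consecutive_bounds[of a b] by (auto simp: ends_def consecutive_def)

lemma mate_ends: "x \<in> ends \<Longrightarrow> mate x \<in> ends"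
  by (elim ends_cases) (auto simp: consecutive_ends)

lemma mate_mate: "x \<in> ends \<Longrightarrow> mate (mate x) = x"
  by (elim ends_cases) (auto simp: mate_left mate_right)

text \<open>The affine parametrization of a piece that enters it at the end \<open>x\<close>; it runs backwards if \<open>x\<close> is a
  left germ.\<close>

definition aff :: "real filter \<Rightarrow> real \<Rightarrow> real" where
  "aff x t = (loc (mate x) - loc x) * t + loc x"

lemma aff_0 [simp]: "aff x 0 = loc x"
  by (simp add: aff_def)

lemma aff_germs:
  assumes "x \<in> ends"
  shows "filtermap (aff x) (at_right 0) = x" "filtermap (aff x) (at_left 1) = mate x"
    "{filtermap (aff x) (at_left t), filtermap (aff x) (at_right t)} = {at_left (aff x t), at_right (aff x t)}"
proof -
  have aff: "aff x = (\<lambda>t. (loc (mate x) - loc x) * t + loc x)" by (simp add: aff_def fun_eq_iff)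
  have "filtermap (aff x) (at_right 0) = x \<and> filtermap (aff x) (at_left 1) = mate x \<and>
    {filtermap (aff x) (at_left t), filtermap (aff x) (at_right t)} = {at_left (aff x t), at_right (aff x t)}"
    using assms
  proof (cases rule: ends_cases)
    case (right a b)
    then have "a < b" by (simp add: consecutive_def)
    then show ?thesis using right unfolding aff by (simp add: filtermap_affine_pos)
  next
    case (left a b)
    then have "a < b" by (simp add: consecutive_def)
    then show ?thesis using left unfolding aff by (auto simp: filtermap_affine_neg)
  qed
  then show "filtermap (aff x) (at_right 0) = x" "filtermap (aff x) (at_left 1) = mate x"
    "{filtermap (aff x) (at_left t), filtermap (aff x) (at_right t)} = {at_left (aff x t), at_right (aff x t)}"
    by auto
qed

lemma aff_between:
  assumes "x \<in> ends" "0 < t" "t < 1"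
  obtains a b where "consecutive a b" "a < aff x t" "aff x t < b" "{x, mate x} = {at_right a, at_left b}"
  using assms(1)
proof (cases rule: ends_cases)
  case (right a b)
  then have "a < b" by (simp add: consecutive_def)
  then have "0 < (b - a) * t" "(b - a) * t < b - a" using assms by auto
  then show ?thesis using right that[of a b] by (simp add: aff_def)
next
  case (left a b)
  then have "a < b" by (simp add: consecutive_def)
  then have "0 < (b - a) * t" "(b - a) * t < b - a" using assms by auto
  then show ?thesis using left that[of a b] by (simp add: aff_def left_diff_distrib insert_commute)
qed

lemma aff_notin_F: "x \<in> ends \<Longrightarrow> 0 < t \<Longrightarrow> t < 1 \<Longrightarrow> aff x t \<notin> F \<and> 0 < aff x t \<and> aff x t < 1"
proof (elim aff_between)
  fix a b assume "consecutive a b" "a < aff x t" "aff x t < b"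
  then show ?thesis using consecutive_bounds[of a b] unfolding consecutive_def by force
qed

lemma loc_mate_neq: "x \<in> ends \<Longrightarrow> loc (mate x) \<noteq> loc x"
  by (elim ends_cases) (auto simp: consecutive_def)

lemma aff_surj:
  assumes "0 \<le> y" "y \<le> 1" "y \<notin> F" and P: "P \<subseteq> ends" "P \<union> mate ` P = ends"
  shows "\<exists>x\<in>P. \<exists>t. 0 < t \<and> t < 1 \<and> y = aff x t"
proof -
  have y: "0 < y" "y < 1" using assms F_ends by (metis order_le_less)+
  define a b where "a = Max {a \<in> F. a < y}" and "b = Min {b \<in> F. b > y}"
  have ab: "consecutive a b" "a < y" "y < b"
    unfolding a_def b_def consecutive_def using prev_F[OF y(1)] next_F[OF y(2)] assms(3)
    by (force simp: not_le)+
  have "at_right a \<in> P \<union> mate ` P" using consecutive_ends(1)[OF ab(1)] P by simp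
  then obtain x where x: "x \<in> P" "at_right a \<in> {x, mate x}" by auto
  have "x \<in> ends" using x P by blast
  then have l: "{loc x, loc (mate x)} = {a, b}"
  proof (cases rule: ends_cases)
    case (right a' b')
    then have "a' = a" using x(2) by (auto dest: arg_cong[of _ _ loc])
    then have "mate x = at_left b" "x = at_right a" using right(2) mate_right[OF ab(1)] by simp_all
    then show ?thesis by simp
  next
    case (left a' b')
    then have "mate x = at_right a" using x(2) by auto
    then have "x = at_left b" using mate_mate[OF \<open>x \<in> ends\<close>] mate_right[OF ab(1)] by simp
    then show ?thesis using \<open>mate x = at_right a\<close> by auto
  qed
  define t where "t = (y - loc x) / (loc (mate x) - loc x)"
  have "y = aff x t"
    using loc_mate_neq[OF \<open>x \<in> ends\<close>] by (simp add: aff_def t_def)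
  moreover have "0 < t \<and> t < 1"
    using l ab unfolding t_def doubleton_eq_iff by (auto simp: field_simps)
  ultimately show ?thesis using x(1) by blast
qed

end

text \<open>The pieces are glued along a partial matching \<open>R\<close> of germs that does not change anything away from
  the cut points.\<close>

locale gluing = cut_points +
  fixes R :: "real filter \<Rightarrow> real filter \<Rightarrow> bool"
  assumes R_germs: "R x y \<Longrightarrow> x \<in> germs \<and> y \<in> germs"
    and R_sym: "R x y \<Longrightarrow> R y x"
    and R_functional: "R x y \<Longrightarrow> R x z \<Longrightarrow> y = z"
    and R_irrefl: "\<not> R x x"
    and R_opp: "x \<in> germs \<Longrightarrow> loc x \<notin> F \<Longrightarrow> R x (opp x)"
begin

lemma R_ends: "x \<in> ends \<Longrightarrow> R x y \<Longrightarrow> y \<in> ends"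
proof (rule ccontr)
  assume *: "x \<in> ends" "R x y" "y \<notin> ends"
  then have y: "y \<in> germs" "loc y \<notin> F" using R_germs by (auto simp: ends_def)
  then have "x = opp y" using R_opp * R_sym R_functional by blast
  moreover have "loc (opp y) = loc y" using y F_ends by (intro loc_opp) auto
  ultimately show False using * y by (simp add: ends_def)
qed

sublocale strands ends mate R
proof
  show "finite ends" unfolding ends_def using finite_germs_over(1)[OF finite_F] .
qed (use mate_ends mate_mate R_ends R_sym R_functional R_irrefl in blast)+

definition chains :: "real filter list list" where
  "chains = (SOME css. distinct (concat css) \<and> set (concat css) \<union> mate ` set (concat css) = ends \<and>
     set (concat css) \<inter> mate ` set (concat css) = {} \<and>
     (\<forall>c\<in>set css. c \<noteq> [] \<and> successively follows c \<and>
        (\<forall>y. follows (last c) y \<longrightarrow> y = hd c) \<and> (\<forall>y. R (hd c) y \<longrightarrow> y = mate (last c))))"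

lemma chains_props: "distinct (concat chains) \<and> set (concat chains) \<union> mate ` set (concat chains) = ends \<and>
     set (concat chains) \<inter> mate ` set (concat chains) = {} \<and>
     (\<forall>c\<in>set chains. c \<noteq> [] \<and> successively follows c \<and>
        (\<forall>y. follows (last c) y \<longrightarrow> y = hd c) \<and> (\<forall>y. R (hd c) y \<longrightarrow> y = mate (last c)))"
  unfolding chains_def
proof (rule someI_ex, rule chains_exist)
  let ?E0 = "{x \<in> ends. \<exists>a. x = at_right a}"
  show "?E0 \<union> mate ` ?E0 = ends"
  proof safe
    fix x assume "x \<in> ends" "x \<notin> mate ` ?E0"
    then show "\<exists>a. x = at_right a"
    proof (cases rule: ends_cases)
      case (left a b)
      then have "x = mate (at_right a)" "at_right a \<in> ?E0"
        using mate_right consecutive_ends by auto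
      then show ?thesis using \<open>x \<notin> mate ` ?E0\<close> by blast
    qed auto
  qed (auto intro: mate_ends)
  show "?E0 \<inter> mate ` ?E0 = {}"
    by (auto elim!: ends_cases)
qed

abbreviation ncirc :: nat where "ncirc \<equiv> length chains"
abbreviation len :: "nat \<Rightarrow> nat" where "len i \<equiv> length (chains ! i)"
abbreviation strand :: "nat \<Rightarrow> nat \<Rightarrow> real filter" where "strand i j \<equiv> chains ! i ! j"

lemma len_pos: "i < ncirc \<Longrightarrow> 0 < len i"
  using chains_props by (metis length_greater_0_conv nth_mem)

lemma strand_in: "i < ncirc \<Longrightarrow> j < len i \<Longrightarrow> strand i j \<in> set (concat chains)"
  by (auto intro!: bexI[of _ "chains ! i"])

lemma strand_ends: "i < ncirc \<Longrightarrow> j < len i \<Longrightarrow> strand i j \<in> ends"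
  using strand_in chains_props by blast

lemma strand_obtain:
  assumes "x \<in> set (concat chains)"
  obtains i j where "i < ncirc" "j < len i" "x = strand i j"
proof -
  obtain c where "c \<in> set chains" "x \<in> set c" using assms by auto
  then show ?thesis using that by (metis in_set_conv_nth)
qed

lemma ends_obtain:
  assumes "x \<in> ends"
  obtains i j where "i < ncirc" "j < len i" "x = strand i j \<or> x = mate (strand i j)"
proof -
  have "x \<in> set (concat chains) \<union> mate ` set (concat chains)" using assms chains_props by blast
  then obtain y where y: "y \<in> set (concat chains)" "x = y \<or> x = mate y" by blast
  from y(1) obtain i j where "i < ncirc" "j < len i" "y = strand i j" by (rule strand_obtain)
  then show ?thesis using that y(2) by blast
qed

lemma strand_inj:
  assumes "i < ncirc" "j < len i" "i' < ncirc" "j' < len i'" "strand i j = strand i' j'"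
  shows "i = i' \<and> j = j'"
proof -
  have d: "distinct (concat chains)" using chains_props by blast
  have dj: "distinct (chains ! i)" using d assms(1) by (auto simp: distinct_concat_iff)
  have "i = i'"
  proof (rule ccontr)
    assume "i \<noteq> i'"
    have "filter (\<lambda>c. c \<noteq> []) chains = chains"
      using chains_props by (intro filter_True) auto
    then have "distinct chains" using d by (simp add: distinct_concat_iff removeAll_filter_not_eq eq_commute)
    then have "chains ! i \<noteq> chains ! i'" using \<open>i \<noteq> i'\<close> assms by (simp add: nth_eq_iff_index_eq)
    then have "set (chains ! i) \<inter> set (chains ! i') = {}"
      using d assms by (auto simp: distinct_concat_iff)
    then show False using assms by (metis disjoint_iff nth_mem)
  qed
  then show ?thesis using dj assms by (auto simp: nth_eq_iff_index_eq)
qed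

lemma strand_inj':
  assumes "i < ncirc" "j < len i" "i' < ncirc" "j' < len i'"
    "{strand i j, mate (strand i j)} = {strand i' j', mate (strand i' j')}"
  shows "i = i' \<and> j = j'"
proof -
  have "strand i j \<noteq> mate (strand i' j')"
    using strand_in[OF assms(1,2)] strand_in[OF assms(3,4)] chains_props by blast
  then show ?thesis using strand_inj assms by (metis insert_iff singletonD insertI1)
qed

lemma strand_link: "i < ncirc \<Longrightarrow> Suc j < len i \<Longrightarrow> R (mate (strand i j)) (strand i (Suc j))"
  using chains_props by (metis nth_mem successively_conv_nth)

lemma strand_close:
  assumes "i < ncirc"
  shows "R (mate (strand i (len i - 1))) y \<Longrightarrow> y = strand i 0" "R (strand i 0) y \<Longrightarrow> y = mate (strand i (len i - 1))"
  using chains_props assms by (metis hd_conv_nth last_conv_nth nth_mem)+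

text \<open>The \<open>i\<close>-th chain is parametrized by \<open>[0, len i]\<close>: during the unit of time that starts at \<open>j\<close> its
  \<open>j\<close>-th piece is traversed. The images of the two germs at a parameter are the two sides, in the interval, of one
  point of the glued space.\<close>

definition path :: "nat \<Rightarrow> real \<Rightarrow> real" where
  "path i s = aff (strand i (nat \<lfloor>s\<rfloor>)) (frac s)"

definition germ_fwd :: "nat \<Rightarrow> real \<Rightarrow> real filter" where
  "germ_fwd i s = filtermap (path i) (at_right s)"

definition germ_bwd :: "nat \<Rightarrow> real \<Rightarrow> real filter" where
  "germ_bwd i s = filtermap (path i) (at_left s)"

lemma path_aff:
  assumes "0 \<le> t" "t < 1"
  shows "path i (real j + t) = aff (strand i j) t"
proof -
  have "\<lfloor>real j + t\<rfloor> = int j" using assms by (simp add: floor_eq_iff)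
  then show ?thesis by (simp add: path_def frac_def)
qed

lemma filtermap_shift:
  "filtermap (\<lambda>x. x + c) (at_right (a::real)) = at_right (c + a)"
  "filtermap (\<lambda>x. x + c) (at_left (a::real)) = at_left (c + a)"
  using filtermap_affine_pos[of 1 c a] by (simp_all add: add.commute)

lemma germ_fwd_aff:
  assumes "0 \<le> t" "t < 1"
  shows "germ_fwd i (real j + t) = filtermap (aff (strand i j)) (at_right t)"
proof -
  have "germ_fwd i (real j + t) = filtermap (\<lambda>x. path i (x + real j)) (at_right t)"
    unfolding germ_fwd_def filtermap_shift(1)[symmetric] by (simp add: filtermap_filtermap)
  also have "\<dots> = filtermap (aff (strand i j)) (at_right t)"
  proof (rule filtermap_eventually_eq)
    show "\<forall>\<^sub>F x in at_right t. path i (x + real j) = aff (strand i j) x"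
      using eventually_at_right_real[OF assms(2)]
      by (rule eventually_mono) (use assms(1) path_aff[of _ i j] in \<open>auto simp: add.commute\<close>)
  qed
  finally show ?thesis .
qed

lemma germ_bwd_aff:
  assumes "0 < t" "t \<le> 1"
  shows "germ_bwd i (real j + t) = filtermap (aff (strand i j)) (at_left t)"
proof -
  have "germ_bwd i (real j + t) = filtermap (\<lambda>x. path i (x + real j)) (at_left t)"
    unfolding germ_bwd_def filtermap_shift(2)[symmetric] by (simp add: filtermap_filtermap)
  also have "\<dots> = filtermap (aff (strand i j)) (at_left t)"
  proof (rule filtermap_eventually_eq)
    show "\<forall>\<^sub>F x in at_left t. path i (x + real j) = aff (strand i j) x"
      using eventually_at_left_real[OF assms(1)]
      by (rule eventually_mono) (use assms(2) path_aff[of _ i j] in \<open>auto simp: add.commute\<close>)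
  qed
  finally show ?thesis .
qed

lemma germ_fwd_int: "i < ncirc \<Longrightarrow> j < len i \<Longrightarrow> germ_fwd i (real j) = strand i j"
  using germ_fwd_aff[of 0 i j] aff_germs(1) strand_ends by simp

lemma germ_bwd_int: "i < ncirc \<Longrightarrow> j < len i \<Longrightarrow> germ_bwd i (real j + 1) = mate (strand i j)"
  using germ_bwd_aff[of 1 i j] aff_germs(2) strand_ends by simp

lemma split_fwd:
  assumes "0 \<le> s" "s < real n"
  obtains j t where "j < n" "s = real j + t" "0 \<le> t" "t < 1"
proof (rule that[of "nat \<lfloor>s\<rfloor>" "frac s"])
  show "s = real (nat \<lfloor>s\<rfloor>) + frac s" using assms by (simp add: frac_def of_nat_nat)
  show "nat \<lfloor>s\<rfloor> < n" using assms by (simp add: nat_less_iff floor_less_iff)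
qed (auto simp: frac_lt_1)

lemma split_bwd:
  assumes "0 < s" "s \<le> real n"
  obtains j t where "j < n" "s = real j + t" "0 < t" "t \<le> 1"
proof -
  obtain j t where jt: "j < Suc n" "s = real j + t" "0 \<le> t" "t < 1"
    by (rule split_fwd[of s "Suc n"]) (use assms in auto)
  show ?thesis
  proof (cases "t = 0")
    case True
    then show ?thesis using jt assms that[of "j - 1" 1] by (cases j) auto
  next
    case False
    then show ?thesis using jt assms that[of j t] by (cases "j = n") auto
  qed
qed

lemma nonint_germs:
  assumes "i < ncirc" "j < len i" "0 < t" "t < 1"
  defines "s \<equiv> real j + t"
  shows "path i s \<notin> F" "0 < path i s" "path i s < 1"
    "germ_fwd i s \<in> germs" "germ_bwd i s \<in> germs" "germ_bwd i s = opp (germ_fwd i s)"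
    "{germ_fwd i s, germ_bwd i s} = {at_left (path i s), at_right (path i s)}"
proof -
  have p: "path i s = aff (strand i j) t" using assms path_aff by simp
  have e: "strand i j \<in> ends" using strand_ends assms by blast
  show x: "path i s \<notin> F" "0 < path i s" "path i s < 1"
    using aff_notin_F[OF e assms(3,4)] p by auto
  show eq: "{germ_fwd i s, germ_bwd i s} = {at_left (path i s), at_right (path i s)}"
    using aff_germs(3)[OF e, of t] germ_fwd_aff[of t i j] germ_bwd_aff[of t i j] assms p
    by (simp add: insert_commute)
  have lr: "germ_fwd i s = at_left (path i s) \<and> germ_bwd i s = at_right (path i s) \<or>
      germ_fwd i s = at_right (path i s) \<and> germ_bwd i s = at_left (path i s)"
    using eq unfolding doubleton_eq_iff .
  have "at_left (path i s) \<in> germs" "at_right (path i s) \<in> germs"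
    using x germsI[of "path i s"] by simp_all
  then show "germ_fwd i s \<in> germs" "germ_bwd i s \<in> germs" using lr by metis+
  show "germ_bwd i s = opp (germ_fwd i s)"
    using lr
  proof (elim disjE conjE)
    assume "germ_fwd i s = at_left (path i s)" "germ_bwd i s = at_right (path i s)"
    then show ?thesis using opp_left[OF x(3)] by (simp only:)
  next
    assume "germ_fwd i s = at_right (path i s)" "germ_bwd i s = at_left (path i s)"
    then show ?thesis using opp_right[OF x(2)] by (simp only:)
  qed
qed

lemma germ_fwd_germs: "i < ncirc \<Longrightarrow> 0 \<le> s \<Longrightarrow> s < real (len i) \<Longrightarrow> germ_fwd i s \<in> germs"
proof -
  assume i: "i < ncirc" and s: "0 \<le> s" "s < real (len i)"
  obtain j t where *: "j < len i" "s = real j + t" "0 \<le> t" "t < 1" by (rule split_fwd[OF s])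
  note * = i *
  then show ?thesis
    using nonint_germs(4)[of i j t] germ_fwd_int[of i j] strand_ends[of i j]
    by (cases "t = 0") (auto simp: ends_def)
qed

lemma germ_bwd_germs: "i < ncirc \<Longrightarrow> 0 < s \<Longrightarrow> s \<le> real (len i) \<Longrightarrow> germ_bwd i s \<in> germs"
proof -
  assume i: "i < ncirc" and s: "0 < s" "s \<le> real (len i)"
  obtain j t where *: "j < len i" "s = real j + t" "0 < t" "t \<le> 1" by (rule split_bwd[OF s])
  note * = i *
  then show ?thesis
    using nonint_germs(5)[of i j t] germ_bwd_int[of i j] mate_ends[OF strand_ends[of i j]]
    by (cases "t = 1") (auto simp: ends_def)
qed

lemma germ_link: "i < ncirc \<Longrightarrow> 0 < s \<Longrightarrow> s < real (len i) \<Longrightarrow> R (germ_bwd i s) (germ_fwd i s)"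
proof -
  assume a: "i < ncirc" "0 < s" "s < real (len i)"
  obtain j t where *: "j < len i" "s = real j + t" "0 \<le> t" "t < 1"
    by (rule split_fwd[OF less_imp_le[OF a(2)] a(3)])
  show ?thesis
  proof (cases "t = 0")
    case True
    then obtain k where k: "j = Suc k" using * a by (cases j) auto
    have "germ_bwd i s = mate (strand i k)" "germ_fwd i s = strand i (Suc k)"
      using germ_bwd_int[of i k] germ_fwd_int[of i "Suc k"] * a k True by (simp_all add: add.commute)
    then show ?thesis using strand_link[of i k] a * k by simp
  next
    case False
    have "loc (germ_fwd i s) = path i s"
      using nonint_germs(7)[of i j t] a * False unfolding doubleton_eq_iff by auto
    then show ?thesis
      using nonint_germs[of i j t] R_opp[of "germ_fwd i s"] R_sym a * False by simp
  qed
qed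

text \<open>This allows both that the chain is closed up by \<open>R\<close> and that it is an arc with two unlinked ends.\<close>

lemma germ_close:
  assumes "i < ncirc"
  shows "R (germ_bwd i (len i)) y \<Longrightarrow> y = germ_fwd i 0" "R (germ_fwd i 0) y \<Longrightarrow> y = germ_bwd i (len i)"
proof -
  have l: "real (len i) = real (len i - 1) + 1" using len_pos[OF assms] by linarith
  have "germ_bwd i (len i) = mate (strand i (len i - 1))" "germ_fwd i 0 = strand i 0"
    using germ_bwd_int[of i "len i - 1"] germ_fwd_int[of i 0] len_pos[OF assms] assms
    by (simp_all only: l) simp_all
  then show "R (germ_bwd i (len i)) y \<Longrightarrow> y = germ_fwd i 0" "R (germ_fwd i 0) y \<Longrightarrow> y = germ_bwd i (len i)"
    using strand_close[OF assms] by simp_all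
qed

lemma path_surj:
  assumes "0 \<le> y" "y \<le> 1" "y \<notin> F"
  obtains i j t where "i < ncirc" "j < len i" "0 < t" "t < 1" "y = path i (real j + t)"
proof -
  obtain x t where x: "x \<in> set (concat chains)" "0 < t" "t < 1" "y = aff x t"
    using aff_surj[OF assms, of "set (concat chains)"] chains_props by blast
  then obtain i j where "i < ncirc" "j < len i" "x = strand i j" using strand_obtain by blast
  then show ?thesis using x that[of i j t] path_aff[of t i j] by simp
qed

lemma germ_obtain:
  assumes "w \<in> germs"
  obtains (fwd) i s where "i < ncirc" "0 \<le> s" "s < real (len i)" "w = germ_fwd i s"
  | (bwd) i s where "i < ncirc" "0 < s" "s \<le> real (len i)" "w = germ_bwd i s"
proof (cases "loc w \<in> F")
  case True
  then have "w \<in> ends" using assms by (simp add: ends_def)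
  then obtain i j where ij: "i < ncirc" "j < len i" "w = strand i j \<or> w = mate (strand i j)"
    by (rule ends_obtain)
  then show ?thesis using fwd[of i "real j"] bwd[of i "real j + 1"] germ_fwd_int[of i j] germ_bwd_int[of i j]
    by auto
next
  case False
  then obtain i j t where *: "i < ncirc" "j < len i" "0 < t" "t < 1" "loc w = path i (real j + t)"
    using path_surj[of "loc w"] loc_bounds[OF assms] by blast
  then have "w = germ_fwd i (real j + t) \<or> w = germ_bwd i (real j + t)"
    using nonint_germs(7)[of i j t] germs_at[OF assms *(5)] unfolding doubleton_eq_iff by auto
  then show ?thesis using fwd[of i "real j + t"] bwd[of i "real j + t"] * by auto
qed

lemma path_inj:
  assumes "i < ncirc" "j < len i" "0 < t" "t < 1" "i' < ncirc" "j' < len i'" "0 < t'" "t' < 1"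
    "path i (real j + t) = path i' (real j' + t')"
  shows "i = i' \<and> j = j' \<and> t = t'"
proof -
  let ?e = "strand i j" and ?e' = "strand i' j'"
  have e: "?e \<in> ends" "?e' \<in> ends" using assms strand_ends by auto
  have eq: "aff ?e t = aff ?e' t'" using assms path_aff[of t i j] path_aff[of t' i' j'] by simp
  obtain a b where ab: "consecutive a b" "a < aff ?e t" "aff ?e t < b" "{?e, mate ?e} = {at_right a, at_left b}"
    using aff_between[OF e(1) assms(3,4)] .
  obtain a' b' where ab': "consecutive a' b'" "a' < aff ?e' t'" "aff ?e' t' < b'" "{?e', mate ?e'} = {at_right a', at_left b'}"
    using aff_between[OF e(2) assms(7,8)] .
  have "a = a' \<and> b = b'" using consecutive_unique[OF ab(1) ab'(1) ab(2,3)] ab' eq by simp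
  then have "{?e, mate ?e} = {?e', mate ?e'}" using ab ab' by simp
  then have ij: "i = i'" "j = j'" using strand_inj' assms by blast+
  then have "t = t'" using eq loc_mate_neq[OF e(1)] by (simp add: aff_def)
  then show ?thesis using ij by blast
qed

end

section \<open>Charts from the interval to the circles\<close>

lemma cis_inj:
  assumes "0 \<le> a" "a < 2 * pi" "0 \<le> b" "b < 2 * pi" "cis a = cis b"
  shows "a = b"
  using Arg2pi_unique[of 1 a "cis a"] Arg2pi_unique[of 1 b "cis a"] assms by (simp add: cis_conv_exp)

lemma unit_circle_cis:
  assumes "norm z = 1"
  obtains a where "0 \<le> a" "a < 2 * pi" "z = cis a"
  using that[of "Arg2pi z"] Arg2pi[of z] assms by (simp add: cis_conv_exp is_Arg_def)

text \<open>The preimage of a closed set is a union of finitely many compact sets.\<close>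

lemma continuous_on_finite_pieces:
  fixes e :: "'i \<Rightarrow> 'a::topological_space \<Rightarrow> 'b::t2_space" and g :: "'b \<Rightarrow> 'c::topological_space"
  assumes "finite I" and K: "\<And>i. i \<in> I \<Longrightarrow> compact (K i)"
    and e: "\<And>i. i \<in> I \<Longrightarrow> continuous_on (K i) (e i)"
    and ge: "\<And>i. i \<in> I \<Longrightarrow> continuous_on (K i) (\<lambda>x. g (e i x))"
    and S: "S = (\<Union>i\<in>I. e i ` K i)"
  shows "continuous_on S g"
  unfolding continuous_on_closed_invariant
proof (intro allI impI)
  fix C :: "'c set" assume C: "closed C"
  have "compact (e i ` (K i \<inter> (\<lambda>x. g (e i x)) -` C))" if "i \<in> I" for i
  proof (rule compact_continuous_image)
    have "closedin (top_of_set (K i)) (K i \<inter> (\<lambda>x. g (e i x)) -` C)"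
      using ge[OF that] C by (rule continuous_closedin_preimage)
    then show "compact (K i \<inter> (\<lambda>x. g (e i x)) -` C)" using K[OF that] closedin_compact by blast
    show "continuous_on (K i \<inter> (\<lambda>x. g (e i x)) -` C) (e i)"
      using e[OF that] continuous_on_subset by blast
  qed
  then have "closed (\<Union>i\<in>I. e i ` (K i \<inter> (\<lambda>x. g (e i x)) -` C))"
    using assms(1) by (intro closed_UN) (auto intro: compact_imp_closed)
  moreover have "(\<Union>i\<in>I. e i ` (K i \<inter> (\<lambda>x. g (e i x)) -` C)) \<inter> S = g -` C \<inter> S"
    unfolding S by auto
  ultimately show "\<exists>A. closed A \<and> A \<inter> S = g -` C \<inter> S" by blast
qed

context gluing
begin

text \<open>The parameter interval of a chain is wrapped once around a circle. The two ends of the chain meet at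
  the angle 0, whether they are linked or not.\<close>

definition circ :: "nat \<Rightarrow> real \<Rightarrow> nat \<times> complex" where
  "circ i s = (i, cis (2 * pi * (s / len i)))"

definition chart :: "real \<Rightarrow> nat \<times> complex" where
  "chart x = (THE z. \<exists>i j t. i < ncirc \<and> j < len i \<and> 0 < t \<and> t < 1 \<and> x = path i (real j + t) \<and>
     z = circ i (real j + t))"

text \<open>The chart has a limit along each germ, also at the cut points.\<close>

definition place :: "real filter \<Rightarrow> nat \<times> complex" where
  "place w = Lim w chart"

lemma chart_path:
  assumes "i < ncirc" "j < len i" "0 < t" "t < 1"
  shows "chart (path i (real j + t)) = circ i (real j + t)"
  unfolding chart_def
proof (rule the_equality)
  show "\<exists>i' j' t'. i' < ncirc \<and> j' < len i' \<and> 0 < t' \<and> t' < 1 \<and> path i (real j + t) = path i' (real j' + t') \<and>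
      circ i (real j + t) = circ i' (real j' + t')"
    using assms by blast
qed (use path_inj[OF assms] in blast)

lemma continuous_on_circ: "continuous_on S (circ i)"
  unfolding circ_def by (cases "len i = 0") (auto intro!: continuous_intros)

lemma circ_in: "i < ncirc \<Longrightarrow> circ i s \<in> circles ncirc"
  by (simp add: circ_def circles_def)

lemma circ_inj:
  assumes "i < ncirc" "0 \<le> s" "s < real (len i)" "i' < ncirc" "0 \<le> s'" "s' < real (len i')" "circ i s = circ i' s'"
  shows "i = i' \<and> s = s'"
proof -
  have i: "i = i'" using assms by (simp add: circ_def)
  have l: "0 < real (len i)" using len_pos[OF assms(1)] by simp
  have "0 \<le> 2 * pi * (s / len i)" "2 * pi * (s / len i) < 2 * pi" 
    "0 \<le> 2 * pi * (s' / len i)" "2 * pi * (s' / len i) < 2 * pi"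
    using assms i l by (simp_all add: field_simps)
  then have "2 * pi * (s / len i) = 2 * pi * (s' / len i)"
    using assms(7) i by (intro cis_inj) (simp_all add: circ_def)
  then show ?thesis using i l by simp
qed

lemma circ_close: "i < ncirc \<Longrightarrow> circ i (len i) = circ i 0"
  using len_pos[of i] by (simp add: circ_def)

lemma circ_surj:
  assumes "z \<in> circles ncirc"
  obtains i s where "i < ncirc" "0 \<le> s" "s < real (len i)" "z = circ i s"
proof -
  obtain i u where z: "z = (i, u)" "i < ncirc" "norm u = 1" using assms by (auto simp: circles_def)
  obtain a where a: "0 \<le> a" "a < 2 * pi" "u = cis a" using unit_circle_cis[OF z(3)] .
  have l: "0 < real (len i)" using len_pos[OF z(2)] by simp
  define s where "s = a / (2 * pi) * len i"
  have "2 * pi * (s / len i) = a" using l by (simp add: s_def)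
  then have "z = circ i s" using z a by (simp add: circ_def)
  moreover have "0 \<le> s" "s < real (len i)" using a l by (simp_all add: s_def field_simps)
  ultimately show ?thesis using that z by blast
qed

lemma chart_tendsto_fwd:
  assumes "i < ncirc" "0 \<le> s" "s < real (len i)"
  shows "(chart \<longlongrightarrow> circ i s) (germ_fwd i s)"
proof -
  obtain j t where *: "j < len i" "s = real j + t" "0 \<le> t" "t < 1" by (rule split_fwd[OF assms(2,3)])
  have "s < real j + 1" using * by simp
  from eventually_at_right_real[OF this]
  have "\<forall>\<^sub>F s' in at_right s. circ i s' = chart (path i s')"
  proof (rule eventually_mono)
    fix s' assume "s' \<in> {s<..<real j + 1}"
    then show "circ i s' = chart (path i s')" using chart_path[of i j "s' - real j"] * assms by simp
  qed
  moreover have "(circ i \<longlongrightarrow> circ i s) (at_right s)"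
    using continuous_on_circ[of UNIV i] by (auto simp: continuous_on_eq_continuous_at isCont_def intro: tendsto_mono[OF at_le])
  ultimately have "((\<lambda>s'. chart (path i s')) \<longlongrightarrow> circ i s) (at_right s)"
    by (rule Lim_transform_eventually[rotated])
  then show ?thesis by (simp add: germ_fwd_def filterlim_filtermap)
qed

lemma chart_tendsto_bwd:
  assumes "i < ncirc" "0 < s" "s \<le> real (len i)"
  shows "(chart \<longlongrightarrow> circ i s) (germ_bwd i s)"
proof -
  obtain j t where *: "j < len i" "s = real j + t" "0 < t" "t \<le> 1" by (rule split_bwd[OF assms(2,3)])
  have "real j < s" using * by simp
  from eventually_at_left_real[OF this]
  have "\<forall>\<^sub>F s' in at_left s. circ i s' = chart (path i s')"
  proof (rule eventually_mono)
    fix s' assume "s' \<in> {real j<..<s}"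
    then show "circ i s' = chart (path i s')" using chart_path[of i j "s' - real j"] * assms by simp
  qed
  moreover have "(circ i \<longlongrightarrow> circ i s) (at_left s)"
    using continuous_on_circ[of UNIV i] by (auto simp: continuous_on_eq_continuous_at isCont_def intro: tendsto_mono[OF at_le])
  ultimately have "((\<lambda>s'. chart (path i s')) \<longlongrightarrow> circ i s) (at_left s)"
    by (rule Lim_transform_eventually[rotated])
  then show ?thesis by (simp add: germ_bwd_def filterlim_filtermap)
qed

lemma place_fwd: "i < ncirc \<Longrightarrow> 0 \<le> s \<Longrightarrow> s < real (len i) \<Longrightarrow> place (germ_fwd i s) = circ i s"
  unfolding place_def using chart_tendsto_fwd germ_fwd_germs germ_neq_bot by (intro tendsto_Lim) auto

lemma place_bwd: "i < ncirc \<Longrightarrow> 0 < s \<Longrightarrow> s \<le> real (len i) \<Longrightarrow> place (germ_bwd i s) = circ i s"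
  unfolding place_def using chart_tendsto_bwd germ_bwd_germs germ_neq_bot by (intro tendsto_Lim) auto

lemma chart_tendsto_place: "w \<in> germs \<Longrightarrow> (chart \<longlongrightarrow> place w) w"
  using chart_tendsto_fwd chart_tendsto_bwd place_fwd place_bwd by (elim germ_obtain) metis+

lemma place_in: "w \<in> germs \<Longrightarrow> place w \<in> circles ncirc"
  by (elim germ_obtain) (simp_all add: place_fwd place_bwd circ_in)

lemma place_surj: "z \<in> circles ncirc \<Longrightarrow> \<exists>w\<in>germs. place w = z"
  using place_fwd germ_fwd_germs by (elim circ_surj) blast

lemma loc_germ_fwd:
  assumes "i < ncirc" "0 \<le> s" "s < real (len i)"
  shows "loc (germ_fwd i s) = path i s"
proof -
  obtain j t where *: "j < len i" "s = real j + t" "0 \<le> t" "t < 1" by (rule split_fwd[OF assms(2,3)])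
  show ?thesis
  proof (cases "t = 0")
    case True
    then show ?thesis using germ_fwd_int[OF assms(1) *(1)] path_aff[of 0 i j] * by simp
  next
    case False
    then have "germ_fwd i s \<in> {at_left (path i s), at_right (path i s)}"
      using nonint_germs(7)[OF assms(1) *(1), of t] * by auto
    then show ?thesis by auto
  qed
qed

lemma place_off_F:
  assumes "w \<in> germs" "loc w \<notin> F"
  shows "place w = chart (loc w)"
proof -
  obtain i j t where *: "i < ncirc" "j < len i" "0 < t" "t < 1" "loc w = path i (real j + t)"
    using path_surj[OF loc_bounds[OF assms(1)] assms(2)] .
  have "w = germ_fwd i (real j + t) \<or> w = germ_bwd i (real j + t)"
    using nonint_germs(7)[OF *(1-4)] germs_at[OF assms(1) *(5)] unfolding doubleton_eq_iff by metis
  then show ?thesis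
    using place_fwd[of i "real j + t"] place_bwd[of i "real j + t"] chart_path[OF *(1-4)] * by auto
qed

lemma place_linked: "R x y \<Longrightarrow> place x = place y"
proof -
  assume R: "R x y"
  then have x: "x \<in> germs" using R_germs by blast
  show ?thesis
    using x
  proof (cases rule: germ_obtain)
    case (fwd i s)
    show ?thesis
    proof (cases "s = 0")
      case True
      then have "y = germ_bwd i (len i)" using germ_close(2) R fwd by simp
      then show ?thesis using place_fwd[of i 0] place_bwd[of i "len i"] fwd True len_pos[of i] by (simp add: circ_close)
    next
      case False
      then have "y = germ_bwd i s" using germ_link[of i s] fwd R R_sym R_functional by (metis order_le_less)
      then show ?thesis using place_fwd[of i s] place_bwd[of i s] fwd False by simp
    qed
  next
    case (bwd i s)
    show ?thesis
    proof (cases "s = len i")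
      case True
      then have "y = germ_fwd i 0" using germ_close(1) R bwd by simp
      then show ?thesis using place_fwd[of i 0] place_bwd[of i "len i"] bwd True len_pos[of i] by (simp add: circ_close)
    next
      case False
      then have "y = germ_fwd i s" using germ_link[of i s] bwd R R_functional by (metis order_le_less)
      then show ?thesis using place_fwd[of i s] place_bwd[of i s] bwd False by simp
    qed
  qed
qed

text \<open>Unlinked germs are ends of arcs, and each circle contains only one point that closes an arc.\<close>

lemma place_unlinked:
  assumes "w \<in> germs" "\<And>z. \<not> R w z"
  shows "\<exists>i<ncirc. place w = circ i 0"
  using assms(1)
proof (cases rule: germ_obtain)
  case (fwd i s)
  have "s = 0" using germ_link[of i s] fwd R_sym assms(2) by (metis order_le_less)
  then show ?thesis using fwd place_fwd by auto
next
  case (bwd i s)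
  have "s = len i" using germ_link[of i s] bwd assms(2) by (metis order_le_less)
  then show ?thesis using bwd place_bwd[of i s] circ_close by auto
qed

lemma chart_inj: "inj_on chart ({0..1} - F)"
proof (rule inj_onI)
  fix x y assume xy: "x \<in> {0..1} - F" "y \<in> {0..1} - F" "chart x = chart y"
  obtain i j t where x: "i < ncirc" "j < len i" "0 < t" "t < 1" "x = path i (real j + t)"
    using path_surj[of x] xy by auto
  obtain i' j' t' where y: "i' < ncirc" "j' < len i'" "0 < t'" "t' < 1" "y = path i' (real j' + t')"
    using path_surj[of y] xy by auto
  have "real j + t < len i" "real j' + t' < len i'" using x y by linarith+
  then have "i = i' \<and> real j + t = real j' + t'"
    using circ_inj[of i "real j + t" i' "real j' + t'"] chart_path[OF x(1-4)] chart_path[OF y(1-4)] x y xy(3) by simp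
  then show "x = y" using x y by metis
qed

definition junctions :: "(nat \<times> complex) set" where
  "junctions = (\<lambda>(i, j). circ i (real j)) ` (SIGMA i:{..<ncirc}. {..<len i})"

lemma finite_junctions: "finite junctions"
  unfolding junctions_def by (intro finite_imageI finite_SigmaI) auto

lemma chart_image: "chart ` ({0..1} - F) = circles ncirc - junctions"
proof (intro equalityI subsetI)
  fix z assume "z \<in> chart ` ({0..1} - F)"
  then obtain x where x: "x \<in> {0..1} - F" "z = chart x" by blast
  obtain i j t where *: "i < ncirc" "j < len i" "0 < t" "t < 1" "x = path i (real j + t)"
    using path_surj[of x] x by auto
  have z: "z = circ i (real j + t)" using chart_path[OF *(1-4)] x * by simp
  have "z \<notin> junctions"
  proof
    assume "z \<in> junctions"
    then obtain i' j' where "i' < ncirc" "j' < len i'" "z = circ i' (real j')" by (auto simp: junctions_def)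
    then have "real j + t = real j'"
      using circ_inj[of i "real j + t" i' "real j'"] z * by simp
    moreover have "j < j'" "j' < j + 1"
      using calculation *(3,4) by linarith+
    ultimately show False by simp
  qed
  then show "z \<in> circles ncirc - junctions" using z circ_in * by simp
next
  fix z assume z: "z \<in> circles ncirc - junctions"
  then obtain i s where ws: "i < ncirc" "0 \<le> s" "s < real (len i)" "z = circ i s"
    by (auto elim: circ_surj)
  obtain j t where *: "j < len i" "s = real j + t" "0 \<le> t" "t < 1" by (rule split_fwd[OF ws(2,3)])
  have "t \<noteq> 0"
  proof
    assume "t = 0"
    then have "z \<in> junctions" using ws * unfolding junctions_def by force
    then show False using z by simp
  qed
  then have "z = chart (path i s)" "path i s \<in> {0..1} - F"
    using chart_path[of i j t] nonint_germs(1-3)[of i j t] ws * by simp_all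
  then show "z \<in> chart ` ({0..1} - F)" by blast
qed

lemma chart_continuous: "continuous_on ({0..1} - F) chart"
  unfolding continuous_on_def
proof
  fix x assume x: "x \<in> {0..1} - F"
  then have "x \<noteq> 0" "x \<noteq> 1" using F_ends by auto
  then have x01: "0 < x" "x < 1" using x by auto
  have "(chart \<longlongrightarrow> chart x) (at_left x)" "(chart \<longlongrightarrow> chart x) (at_right x)"
    using chart_tendsto_place[of "at_left x"] chart_tendsto_place[of "at_right x"]
      place_off_F[of "at_left x"] place_off_F[of "at_right x"] germsI[of x] x x01 by auto
  then have "(chart \<longlongrightarrow> chart x) (at x)" using filterlim_split_at by blast
  then show "(chart \<longlongrightarrow> chart x) (at x within {0..1} - F)"
    by (rule tendsto_mono[OF at_le, rotated]) simp
qed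

text \<open>The map \<open>g\<close> is well defined if \<open>f\<close> sends germs with the same place to germs with the same place. This
  is clear for linked germs. Otherwise they are the two ends of an arc, and the curve \<open>G i\<close>, the image of this
  arc under the map to be constructed, is continuous. Being connected, it stays on one circle. Its two
  end points are places of unlinked germs, and they coincide because a circle contains only one such place.\<close>

lemma gluing_respects:
  assumes f_germs: "\<And>w. w \<in> germs \<Longrightarrow> f w \<in> germs"
    and f_R: "\<And>x y. R x y \<Longrightarrow> R (f x) (f y)"
    and f_unlinked: "\<And>w z. w \<in> germs \<Longrightarrow> R (f w) z \<Longrightarrow> \<exists>y. R w y"
    and f_map: "\<And>w. w \<in> germs \<Longrightarrow> f w = filtermap \<phi> w"
    and P: "finite P" "\<And>w. w \<in> germs \<Longrightarrow> loc w \<notin> P \<Longrightarrow> loc (f w) = \<phi> (loc w) \<and> \<phi> (loc w) \<notin> F"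
  shows "\<exists>g. continuous_on (circles ncirc) g \<and> (\<forall>w\<in>germs. g (place w) = place (f w))"
proof -
  define G where "G i s = place (f (if s < real (len i) then germ_fwd i s else germ_bwd i s))" for i s
  have G_off: "G i s = chart (\<phi> (path i s))" if "i < ncirc" "0 \<le> s" "s < real (len i)" "path i s \<notin> P" for i s
  proof -
    have w: "germ_fwd i s \<in> germs" "loc (germ_fwd i s) = path i s"
      using that germ_fwd_germs loc_germ_fwd by auto
    then show ?thesis
      using that P(2)[OF w(1)] place_off_F[OF f_germs[OF w(1)]] by (simp add: G_def)
  qed
  (* G i is continuous: along each side of s it agrees, up to finitely many parameters, with the
     chart composed with \<phi>, which converges along the image germ. *)
  have lim_right: "(G i \<longlongrightarrow> G i s) (at_right s)" if s: "i < ncirc" "0 \<le> s" "s < real (len i)" for i s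
  proof -
    have w: "germ_fwd i s \<in> germs" using s germ_fwd_germs by blast
    have "\<forall>\<^sub>F s' in at_right s. path i s' \<notin> P"
      using eventually_germ_notin[OF w P(1)] by (simp add: germ_fwd_def eventually_filtermap)
    moreover have "\<forall>\<^sub>F s' in at_right s. s' \<in> {s<..<real (len i)}"
      using s(3) by (rule eventually_at_right_real)
    ultimately have "\<forall>\<^sub>F s' in at_right s. chart (\<phi> (path i s')) = G i s'"
      by eventually_elim (use s G_off in auto)
    moreover have "((\<lambda>s'. chart (\<phi> (path i s'))) \<longlongrightarrow> place (f (germ_fwd i s))) (at_right s)"
      using chart_tendsto_place[OF f_germs[OF w]] unfolding f_map[OF w]
      by (simp add: germ_fwd_def filterlim_filtermap)
    ultimately show ?thesis using s by (auto simp: G_def[of i s] elim: Lim_transform_eventually[rotated])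
  qed
  have lim_left: "(G i \<longlongrightarrow> place (f (germ_bwd i s))) (at_left s)" if s: "i < ncirc" "0 < s" "s \<le> real (len i)" for i s
  proof -
    have w: "germ_bwd i s \<in> germs" using s germ_bwd_germs by blast
    have "\<forall>\<^sub>F s' in at_left s. path i s' \<notin> P"
      using eventually_germ_notin[OF w P(1)] by (simp add: germ_bwd_def eventually_filtermap)
    moreover have "\<forall>\<^sub>F s' in at_left s. s' \<in> {0<..<s}"
      using s(2) by (rule eventually_at_left_real)
    ultimately have "\<forall>\<^sub>F s' in at_left s. chart (\<phi> (path i s')) = G i s'"
      by eventually_elim (use s G_off in auto)
    moreover have "((\<lambda>s'. chart (\<phi> (path i s'))) \<longlongrightarrow> place (f (germ_bwd i s))) (at_left s)"
      using chart_tendsto_place[OF f_germs[OF w]] unfolding f_map[OF w]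
      by (simp add: germ_bwd_def filterlim_filtermap)
    ultimately show ?thesis by (rule Lim_transform_eventually[rotated])
  qed
  have G_bwd: "place (f (germ_bwd i s)) = G i s" if "i < ncirc" "0 < s" "s \<le> real (len i)" for i s
    using place_linked[OF f_R[OF germ_link[of i s]]] that by (cases "s = len i") (auto simp: G_def)
  have G_cont: "continuous_on {0..real (len i)} (G i)" if i: "i < ncirc" for i
    unfolding continuous_on_def
  proof
    fix s assume s: "s \<in> {0..real (len i)}"
    have l: "0 < real (len i)" using len_pos[OF i] by simp
    consider "s = 0" | "s = len i" "s > 0" | "0 < s" "s < len i" using s l by fastforce
    then show "(G i \<longlongrightarrow> G i s) (at s within {0..real (len i)})"
    proof cases
      case 1
      then show ?thesis using lim_right[OF i, of 0] l by (simp add: at_within_Icc_at_right)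
    next
      case 2
      then show ?thesis using lim_left[OF i, of s] G_bwd[OF i, of s] l by (simp add: at_within_Icc_at_left)
    next
      case 3
      then have "(G i \<longlongrightarrow> G i s) (at s)"
        using lim_left[OF i, of s] G_bwd[OF i, of s] lim_right[OF i, of s] by (simp add: filterlim_split_at)
      then show ?thesis by (rule tendsto_mono[OF at_le, rotated]) simp
    qed
  qed
  (* The number of the circle is a continuous function with discrete values. *)
  have fst_const: "fst (G i 0) = fst (G i (len i))" if i: "i < ncirc" for i
  proof -
    have "(fst \<circ> G i) constant_on {0..real (len i)}"
    proof (rule locally_constant_imp_constant)
      fix a assume a: "a \<in> {0..real (len i)}"
      have c: "continuous_on {0..real (len i)} (fst \<circ> G i)"
        using G_cont[OF i] by (auto intro: continuous_on_fst simp: o_def)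
      have "openin (top_of_set {0..real (len i)}) ({0..real (len i)} \<inter> (fst \<circ> G i) -` {(fst \<circ> G i) a})"
        using c open_discrete by (rule continuous_openin_preimage_gen)
      then show "\<exists>T. openin (top_of_set {0..real (len i)}) T \<and> a \<in> T \<and> (\<forall>x\<in>T. (fst \<circ> G i) x = (fst \<circ> G i) a)"
        using a by (intro exI conjI) auto
    qed simp
    then obtain c where "\<And>x. x \<in> {0..real (len i)} \<Longrightarrow> (fst \<circ> G i) x = c" by (auto simp: constant_on_def)
    then show ?thesis by simp
  qed
  have G_close: "G i (len i) = G i 0" if i: "i < ncirc" for i
  proof -
    have l: "0 < real (len i)" using len_pos[OF i] by simp
    have w: "germ_fwd i 0 \<in> germs" "germ_bwd i (len i) \<in> germs"
      using germ_fwd_germs[OF i, of 0] germ_bwd_germs[OF i, of "len i"] l by auto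
    have G: "G i 0 = place (f (germ_fwd i 0))" "G i (len i) = place (f (germ_bwd i (len i)))"
      using l by (simp_all add: G_def)
    show ?thesis
    proof (cases "R (germ_bwd i (len i)) (germ_fwd i 0)")
      case True
      then show ?thesis using place_linked[OF f_R] G by simp
    next
      case False
      then have "\<not> R (germ_bwd i (len i)) y" "\<not> R (germ_fwd i 0) y" for y
        using germ_close[OF i] R_sym by metis+
      then have "\<not> R (f (germ_bwd i (len i))) z" "\<not> R (f (germ_fwd i 0)) z" for z
        using f_unlinked[OF w(2)] f_unlinked[OF w(1)] by blast+
      then obtain i1 i2 where "G i 0 = circ i1 0" "G i (len i) = circ i2 0"
        using place_unlinked f_germs w G by metis
      then show ?thesis using fst_const[OF i] by (simp add: circ_def)
    qed
  qed
  have rep: "\<exists>i s. i < ncirc \<and> 0 \<le> s \<and> s < real (len i) \<and> place w = circ i s \<and> place (f w) = G i s"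
    if w: "w \<in> germs" for w
    using w
  proof (cases rule: germ_obtain)
    case (fwd i s)
    then show ?thesis using place_fwd by (intro exI[of _ i] exI[of _ s]) (simp add: G_def)
  next
    case (bwd i s)
    have l: "0 < real (len i)" using len_pos[OF bwd(1)] by simp
    show ?thesis
    proof (cases "s = len i")
      case True
      then show ?thesis using bwd place_bwd[of i s] G_bwd[of i s] circ_close[of i] G_close[of i] l
        by (intro exI[of _ i] exI[of _ 0]) simp
    next
      case False
      then show ?thesis using bwd place_bwd[of i s] G_bwd[of i s] by (intro exI[of _ i] exI[of _ s]) simp
    qed
  qed
  have resp: "place (f w) = place (f w')" if "w \<in> germs" "w' \<in> germs" "place w = place w'" for w w'
    using rep[OF that(1)] rep[OF that(2)] that(3) circ_inj by metis
  define g where "g z = place (f (SOME w. w \<in> germs \<and> place w = z))" for z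
  have g: "g (place w) = place (f w)" if "w \<in> germs" for w
  proof -
    have "(SOME w'. w' \<in> germs \<and> place w' = place w) \<in> germs \<and>
        place (SOME w'. w' \<in> germs \<and> place w' = place w) = place w"
      using that by (intro someI[of "\<lambda>w'. w' \<in> germs \<and> place w' = place w"]) auto
    then show ?thesis unfolding g_def using resp that by blast
  qed
  have g_circ: "g (circ i s) = G i s" if "i < ncirc" "s \<in> {0..real (len i)}" for i s
  proof (cases "s < len i")
    case True
    then show ?thesis
      using that g[OF germ_fwd_germs[of i s]] place_fwd[of i s] by (simp add: G_def)
  next
    case False
    then have "s = len i" "0 < s" using that len_pos[of i] by auto
    then show ?thesis
      using that g[OF germ_bwd_germs[of i s]] place_bwd[of i s] by (simp add: G_def)
  qed
  have "continuous_on (circles ncirc) g"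
  proof (rule continuous_on_finite_pieces)
    show "circles ncirc = (\<Union>i\<in>{..<ncirc}. circ i ` {0..real (len i)})"
    proof (intro equalityI subsetI)
      fix z assume "z \<in> circles ncirc"
      then obtain i s where "i < ncirc" "0 \<le> s" "s < real (len i)" "z = circ i s" by (rule circ_surj)
      then show "z \<in> (\<Union>i\<in>{..<ncirc}. circ i ` {0..real (len i)})"
        by (intro UN_I[of i]) auto
    qed (auto intro: circ_in)
    show "continuous_on {0..real (len i)} (\<lambda>s. g (circ i s))" if "i \<in> {..<ncirc}" for i
      using that g_circ by (intro continuous_on_eq[OF G_cont]) auto
  qed (auto intro: continuous_on_circ)
  then show ?thesis using g by blast
qed

end

section \<open>From sublinear defects to a multihomeomorphism\<close>

lemma almost_commuting_gact:
  assumes "A \<in> carrier GIET"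
  shows "almost_commuting germs (gact A) opp"
proof
  show "finite {x \<in> germs. gact A (opp x) \<noteq> opp (gact A x)}"
    using finite_defect[OF assms] by (simp add: defect_def)
qed (use assms bij_betw_gact opp_germs opp_opp opp_neq in auto)

lemma bad_gact:
  assumes "A \<in> carrier GIET"
  shows "almost_commuting.bad germs (gact A) opp n = defect (A [^]\<^bsub>GIET\<^esub> n)"
proof -
  have "(gact A ^^ n) (opp x) \<noteq> opp ((gact A ^^ n) x) \<longleftrightarrow>
      gact (A [^]\<^bsub>GIET\<^esub> n) (opp x) \<noteq> opp (gact (A [^]\<^bsub>GIET\<^esub> n) x)" if "x \<in> germs" for x
    using that by (simp add: gact_pow[OF assms] opp_germs)
  then show ?thesis
    unfolding almost_commuting.bad_def[OF almost_commuting_gact[OF assms]] defect_def by blast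
qed

lemma defect_word:
  assumes S: "S \<subseteq> carrier GIET" and K: "\<And>s. s \<in> S \<Longrightarrow> card (defect s) \<le> K"
    and w: "GIET.word_in S k x"
  shows "card (defect x) \<le> K * k"
proof -
  have letter: "card (defect s) \<le> K" if "s \<in> S \<union> m_inv GIET ` S" for s
  proof -
    from that consider "s \<in> S" | r where "r \<in> S" "s = inv\<^bsub>GIET\<^esub> r" by blast
    then show ?thesis
    proof cases
      case (2 r)
      then show ?thesis using K[of r] defect_inv[of r] S by auto
    qed (rule K)
  qed
  have "card (defect (foldr (mult GIET) ws \<one>\<^bsub>GIET\<^esub>)) \<le> K * length ws"
    if "set ws \<subseteq> S \<union> m_inv GIET ` S" for ws
    using that
  proof (induction ws)
    case Nil
    have "defect \<one>\<^bsub>GIET\<^esub> = {}" unfolding defect_def using gact_one opp_germs by auto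
    then show ?case by simp
  next
    case (Cons a ws)
    have "a \<in> carrier GIET" "foldr (mult GIET) ws \<one>\<^bsub>GIET\<^esub> \<in> carrier GIET"
      using subset_trans[OF Cons.prems GIET.letters_subset[OF S]] by (auto intro!: GIET.foldr_mult_closed)
    then have "card (defect (foldr (mult GIET) (a # ws) \<one>\<^bsub>GIET\<^esub>))
        \<le> card (defect a) + card (defect (foldr (mult GIET) ws \<one>\<^bsub>GIET\<^esub>))"
      using defect_mult by simp
    also have "\<dots> \<le> K + K * length ws"
      using Cons letter[of a] by (intro add_mono) auto
    finally show ?case by simp
  qed
  then show ?thesis
    using w unfolding GIET.word_in_def by (elim exE conjE) (meson le_trans mult_le_mono2)
qed

text \<open>The defect of a product of \<open>k\<close> generators is at most a constant times \<open>k\<close>, so that for a distorted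
  element the defects of the powers grow sublinearly.\<close>

lemma distorted_imp_finite_recurrent:
  assumes A: "A \<in> carrier GIET" and dist: "distorted GIET A"
  shows "finite (almost_commuting.recurrent_bad germs (gact A) opp)"
proof (rule ccontr)
  assume inf: "infinite (almost_commuting.recurrent_bad germs (gact A) opp)"
  obtain H S where H: "subgroup H GIET" "A \<in> H" and S: "finite S" "S \<subseteq> H"
      "generate (GIET\<lparr>carrier := H\<rparr>) S = H"
    and lim: "(\<lambda>n. real (word_length (GIET\<lparr>carrier := H\<rparr>) S (A [^]\<^bsub>GIET\<lparr>carrier := H\<rparr>\<^esub> (n::nat))) / real n) \<longlonglongrightarrow> 0"
    using dist unfolding distorted_def fg_distorted_def by auto
  have sub: "S \<subseteq> carrier GIET" using S(2) H(1) subgroup.subset by blast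
  have gen: "generate GIET S = H" using GIET.generate_consistent[OF S(2) H(1)] S(3) by simp
  define wl where "wl n = word_length (GIET\<lparr>carrier := H\<rparr>) S (A [^]\<^bsub>GIET\<^esub> (n::nat))" for n
  have pow: "A [^]\<^bsub>GIET\<lparr>carrier := H\<rparr>\<^esub> n = A [^]\<^bsub>GIET\<^esub> n" for n :: nat
    by (simp add: nat_pow_def)
  have powH: "A [^]\<^bsub>GIET\<^esub> n \<in> H" for n :: nat
    using H by (induction n) (auto simp: subgroup.one_closed subgroup.m_closed)
  have word: "GIET.word_in S (wl n) (A [^]\<^bsub>GIET\<^esub> n)" for n
    unfolding wl_def by (rule GIET.word_in_word_length[OF H(1) S(2) gen powH])
  define K where "K = (\<Sum>s\<in>S. card (defect s))"
  have K: "card (defect s) \<le> K" if "s \<in> S" for s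
    unfolding K_def using S(1) that by (intro member_le_sum) auto
  obtain C where "\<And>n. n \<le> card (almost_commuting.bad germs (gact A) opp n) + C"
    using almost_commuting.linear_growth[OF almost_commuting_gact[OF A] inf] by blast
  then have le: "n \<le> K * wl n + C" for n
    using defect_word[OF sub K word[of n]] unfolding bad_gact[OF A] by (meson add_le_mono1 le_trans)
  have "(\<lambda>n. real K * (real (wl n) / real n) + real C * inverse (real n)) \<longlonglongrightarrow> real K * 0 + real C * 0"
    using lim unfolding pow wl_def[symmetric] by (intro tendsto_add tendsto_mult tendsto_const lim_inverse_n)
  moreover have "\<forall>\<^sub>F n in sequentially. 1 \<le> real K * (real (wl n) / real n) + real C * inverse (real n)"
    using eventually_gt_at_top[of 0]
  proof eventually_elim
    case (elim n)
    have "real n \<le> real K * real (wl n) + real C" using le[of n] by (metis of_nat_add of_nat_le_iff of_nat_mult)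
    then have "real n / real n \<le> (real K * real (wl n) + real C) / real n" by (rule divide_right_mono) simp
    then show ?case using elim by (simp add: add_divide_distrib divide_inverse mult.assoc distrib_right)
  qed
  ultimately have "1 \<le> real K * 0 + real C * 0"
    by (rule tendsto_lowerbound) simp
  then show False by simp
qed

text \<open>The exceptional set consists of the points where the representative is not defined or has a value
  in \<open>F\<close>.\<close>

lemma (in gluing) glued_map:
  assumes A: "A \<in> carrier GIET"
    and R: "\<And>x y. x \<in> germs \<Longrightarrow> y \<in> germs \<Longrightarrow> R (gact A x) (gact A y) \<longleftrightarrow> R x y"
  shows "\<exists>g. continuous_on (circles ncirc) g \<and> (\<forall>w\<in>germs. g (place w) = place (gact A w))"
proof -
  obtain \<phi> where \<phi>: "\<phi> \<in> A" using GIET_rep_exists[OF A] by blast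
  have g: "is_giet \<phi>" using GIET_rep_class[OF A \<phi>] by blast
  show ?thesis
  proof (rule gluing_respects[where \<phi> = "pval \<phi>" and P = "({0..1} - dom \<phi>) \<union> {x \<in> dom \<phi>. pval \<phi> x \<in> F}"])
    show "\<exists>y. R w y" if "w \<in> germs" "R (gact A w) z" for w z
    proof -
      have "z \<in> germs" using that R_germs by blast
      then have "R (gact A w) (gact A (gact (inv\<^bsub>GIET\<^esub> A) z))" using that gact_inv(2)[OF A] by simp
      then show ?thesis using R that(1) gact_germs[OF GIET.inv_closed[OF A] \<open>z \<in> germs\<close>] by blast
    qed
    show "finite (({0..1} - dom \<phi>) \<union> {x \<in> dom \<phi>. pval \<phi> x \<in> F})"
      using g finite_giet_vimage[OF g finite_F] by (simp add: is_giet_iff)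
    show "loc (gact A w) = pval \<phi> (loc w) \<and> pval \<phi> (loc w) \<notin> F"
      if "w \<in> germs" "loc w \<notin> ({0..1} - dom \<phi>) \<union> {x \<in> dom \<phi>. pval \<phi> x \<in> F}" for w
    proof -
      have "loc w \<in> dom \<phi>" using that loc_bounds[OF that(1)] by simp
      then show ?thesis using loc_gact_dom[OF A \<phi> that(1)] that(2) by simp
    qed
    show "R (gact A x) (gact A y)" if "R x y" for x y using R R_germs[OF that] that by blast
  qed (rule gact_germs[OF A], assumption, rule gact_rep[OF A \<phi>])
qed

text \<open>The interval is cut at its ends and at the recurrently bad germs, and glued along linked germs. An
  exchange preserves links, and so does its inverse; hence both descend to the circles.\<close>

lemma finite_recurrent_imp_multihomeomorphism:
  assumes A: "A \<in> carrier GIET" and fin: "finite (almost_commuting.recurrent_bad germs (gact A) opp)"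
  shows "multihomeomorphism A"
proof -
  interpret ac: almost_commuting germs "gact A" opp by (rule almost_commuting_gact[OF A])
  define F where "F = {0, 1} \<union> loc ` ac.recurrent_bad"
  have recurrent_germs: "ac.recurrent_bad \<subseteq> germs" by (auto simp: ac.recurrent_bad_def)
  interpret gluing F ac.linked
  proof
    show "F \<subseteq> {0..1}" using recurrent_germs loc_bounds by (auto simp: F_def)
    show "ac.linked x (opp x)" if "x \<in> germs" "loc x \<notin> F" for x
      using that by (intro ac.linked_t) (auto simp: F_def)
  qed (use fin ac.linked_closed ac.linked_sym ac.linked_functional ac.linked_irrefl in \<open>auto simp: F_def\<close>)
  let ?B = "inv\<^bsub>GIET\<^esub> A"
  have B: "?B \<in> carrier GIET" using A by simp
  have R: "ac.linked (gact A x) (gact A y) \<longleftrightarrow> ac.linked x y" if "x \<in> germs" "y \<in> germs" for x y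
    using ac.linked_iff_image[OF that] .
  have R': "ac.linked (gact ?B x) (gact ?B y) \<longleftrightarrow> ac.linked x y" if "x \<in> germs" "y \<in> germs" for x y
    using R[of "gact ?B x" "gact ?B y"] that gact_germs[OF B] gact_inv(2)[OF A] by simp
  obtain g where g: "continuous_on (circles ncirc) g" "\<And>w. w \<in> germs \<Longrightarrow> g (place w) = place (gact A w)"
    using glued_map[OF A R] by blast
  obtain g' where g': "continuous_on (circles ncirc) g'" "\<And>w. w \<in> germs \<Longrightarrow> g' (place w) = place (gact ?B w)"
    using glued_map[OF B R'] by blast
  have "homeomorphism (circles ncirc) (circles ncirc) g g'"
  proof (rule homeomorphismI[OF g(1) g'(1)])
    have *: "g z \<in> circles ncirc \<and> g' z \<in> circles ncirc \<and> g' (g z) = z \<and> g (g' z) = z"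
      if z: "z \<in> circles ncirc" for z
    proof -
      obtain w where w: "w \<in> germs" "z = place w" using place_surj[OF z] by blast
      then show ?thesis
        using g(2) g'(2) gact_germs[OF A] gact_germs[OF B] gact_inv[OF A w(1)] place_in by simp
    qed
    then show "g ` circles ncirc \<subseteq> circles ncirc" "g' ` circles ncirc \<subseteq> circles ncirc"
      by (simp_all add: image_subset_iff)
    show "g' (g z) = z" "g (g' z) = z" if "z \<in> circles ncirc" for z
      using *[OF that] by simp_all
  qed
  define h where "h x = (if x \<in> {0..1} - F then Some (chart x) else None)" for x
  have dom_h: "dom h = {0..1} - F" by (auto simp: h_def dom_def)
  have h: "pval h x = chart x" "h x = Some (chart x)" if "x \<in> {0..1} - F" for x
    using that by (auto simp: h_def)
  obtain \<phi> where \<phi>: "\<phi> \<in> A" using GIET_rep_exists[OF A] by blast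
  have gi: "is_giet \<phi>" using GIET_rep_class[OF A \<phi>] by blast
  define P where "P = ({0..1} - dom \<phi>) \<union> {x \<in> dom \<phi>. pval \<phi> x \<in> F}"
  have P: "finite P" using gi finite_giet_vimage[OF gi finite_F] by (simp add: P_def is_giet_iff)
  have "{y \<in> circles ncirc. (h \<circ>\<^sub>m \<phi> \<circ>\<^sub>m pinv h) y \<noteq> Some (g y)} \<subseteq> junctions \<union> chart ` P"
  proof (rule subsetI, rule ccontr)
    fix y assume y: "y \<in> {y \<in> circles ncirc. (h \<circ>\<^sub>m \<phi> \<circ>\<^sub>m pinv h) y \<noteq> Some (g y)}"
      "y \<notin> junctions \<union> chart ` P"
    then obtain x where x: "x \<in> {0..1} - F" "y = chart x" using chart_image by blast
    then have "x \<notin> P" using y by blast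
    then have d: "x \<in> dom \<phi>" "pval \<phi> x \<notin> F" using x by (auto simp: P_def)
    have "0 < x \<and> x < 1" using x F_ends by (metis DiffE atLeastAtMost_iff order_le_less)
    then have w: "at_right x \<in> germs" "loc (at_right x) = x" by auto
    have "pinv h y = Some x"
    proof -
      have "y \<in> ran h" using h(2)[OF x(1)] x(2) by (auto simp: ran_def)
      moreover have "(THE x. h x = Some y) = x"
      proof (rule the_equality)
        show "h x = Some y" using h(2)[OF x(1)] x(2) by simp
        fix x' assume "h x' = Some y"
        then have "x' \<in> {0..1} - F" "chart x' = chart x" using x(2) by (auto simp: h_def split: if_splits)
        then show "x' = x" using chart_inj x(1) by (meson inj_onD)
      qed
      ultimately show ?thesis by (simp add: pinv_def)
    qed
    moreover have "pval \<phi> x \<in> {0..1} - F"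
      using d gi by (auto simp: is_giet_iff ran_def)
    then have "h (pval \<phi> x) = Some (chart (pval \<phi> x))" by (rule h(2))
    moreover have "chart (pval \<phi> x) = g y"
    proof -
      have l: "loc (gact A (at_right x)) = pval \<phi> x" using loc_gact_dom[OF A \<phi> w(1)] w(2) d by simp
      have "g y = g (place (at_right x))" using place_off_F[OF w(1)] x w(2) by simp
      also have "\<dots> = place (gact A (at_right x))" using g(2) w by simp
      also have "\<dots> = chart (pval \<phi> x)" using place_off_F[OF gact_germs[OF A w(1)]] l d by simp
      finally show ?thesis by simp
    qed
    moreover obtain x' where "\<phi> x = Some x'" using d by auto
    ultimately have "(h \<circ>\<^sub>m \<phi> \<circ>\<^sub>m pinv h) y = Some (g y)"
      by (simp add: map_comp_def)
    then show False using y by simp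
  qed
  then have "finite {y \<in> circles ncirc. (h \<circ>\<^sub>m \<phi> \<circ>\<^sub>m pinv h) y \<noteq> Some (g y)}"
    using finite_junctions P by (auto intro: finite_subset)
  moreover have "continuous_on ({0..1} - F) (pval h)"
    by (rule continuous_on_eq[OF chart_continuous]) (simp only: h(1))
  moreover have "bij_betw (pval h) ({0..1} - F) (circles ncirc - junctions)"
    using chart_inj chart_image h(1) by (auto simp: bij_betw_def inj_on_def)
  moreover have "junctions \<subseteq> circles ncirc" by (auto simp: junctions_def circ_in)
  moreover have "1 \<le> ncirc"
  proof -
    obtain i where "i < ncirc" using germ_obtain[of "at_right 0"] by force
    then show ?thesis by simp
  qed
  ultimately show ?thesis
    unfolding multihomeomorphism_def
    using \<open>homeomorphism _ _ g g'\<close> finite_F F_sub finite_junctions dom_h \<phi> by blast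
qed

section \<open>Powers of a multihomeomorphism have few discontinuities\<close>

text \<open>At most two germs sit at each point of \<open>S\<close>, and an exchange is injective on germs.\<close>

lemma card_disc_le:
  assumes B: "B \<in> carrier GIET" and S: "finite S"
    and sub: "\<And>a. a \<in> discontinuities B \<Longrightarrow> a \<in> S \<or> loc (gact B (at_left a)) \<in> S \<or> loc (gact B (at_right a)) \<in> S"
  shows "disc_count B \<le> 5 * card S"
proof -
  let ?T = "{F \<in> germs. loc F \<in> S}"
  let ?L = "{a \<in> {0<..<1}. gact B (at_left a) \<in> ?T}" and ?R = "{a \<in> {0<..<1}. gact B (at_right a) \<in> ?T}"
  have T: "finite ?T" "card ?T \<le> 2 * card S" using finite_germs_over[OF S] by auto
  have injL: "inj_on (\<lambda>a. gact B (at_left a)) ?L"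
  proof (rule inj_onI)
    fix a b assume "a \<in> ?L" "b \<in> ?L" "gact B (at_left a) = gact B (at_left b)"
    then have "at_left a = at_left b" using gact_inj[OF B, of "at_left a" "at_left b"] germsI(2) by auto
    then show "a = b" by (metis loc_at_left)
  qed
  have injR: "inj_on (\<lambda>a. gact B (at_right a)) ?R"
  proof (rule inj_onI)
    fix a b assume "a \<in> ?R" "b \<in> ?R" "gact B (at_right a) = gact B (at_right b)"
    then have "at_right a = at_right b" using gact_inj[OF B, of "at_right a" "at_right b"] germsI(1) by auto
    then show "a = b" by (metis loc_at_right)
  qed
  have L: "finite ?L" "card ?L \<le> card ?T"
    using inj_on_finite[OF injL _ T(1)] card_inj_on_le[OF injL _ T(1)] by (simp_all add: image_subset_iff)
  have R: "finite ?R" "card ?R \<le> card ?T"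
    using inj_on_finite[OF injR _ T(1)] card_inj_on_le[OF injR _ T(1)] by (simp_all add: image_subset_iff)
  have "discontinuities B \<subseteq> S \<union> ?L \<union> ?R"
  proof
    fix a assume a: "a \<in> discontinuities B"
    then have a01: "a \<in> {0<..<1}" by (simp add: discontinuities_def)
    then have "gact B (at_left a) \<in> germs" "gact B (at_right a) \<in> germs"
      by (auto intro!: gact_germs[OF B])
    then show "a \<in> S \<union> ?L \<union> ?R" using sub[OF a] a01 by auto
  qed
  then have "disc_count B \<le> card (S \<union> ?L \<union> ?R)"
    unfolding disc_count_def using S L R by (intro card_mono) auto
  also have "\<dots> \<le> card S + card ?L + card ?R"
    by (metis (no_types, lifting) add_le_mono1 card_Un_le le_trans)
  finally show ?thesis using L R T by linarith
qed

text \<open>At a point off the singular set \<open>S\<close> of \<open>h\<close>, the conjugate homeomorphism \<open>g\<close> and its powers are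
  continuous, so \<open>h\<close> has the same limit along the images of both germs. If these images are off \<open>S\<close> too,
  injectivity of \<open>h\<close> shows that they sit at the same point.\<close>

lemma multihomeomorphism_imp_bounded:
  assumes A: "A \<in> carrier GIET" and m: "multihomeomorphism A"
  shows "bdd_above (range (\<lambda>n::nat. disc_count (A [^]\<^bsub>GIET\<^esub> n)))"
proof -
  obtain n and h :: "real \<rightharpoonup> nat \<times> complex" and S B g g' \<phi> where
    S: "finite S" "S \<subseteq> {0..1}" and dom: "dom h = {0..1} - S"
    and cont: "continuous_on ({0..1} - S) (pval h)" and bij: "bij_betw (pval h) ({0..1} - S) (circles n - B)"
    and g: "homeomorphism (circles n) (circles n) g g'" and \<phi>: "\<phi> \<in> A"
    and fin: "finite {y \<in> circles n. (h \<circ>\<^sub>m \<phi> \<circ>\<^sub>m pinv h) y \<noteq> Some (g y)}"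
    using m unfolding multihomeomorphism_def by (elim exE bexE conjE) (rule that, assumption+)
  let ?h = "pval h"
  have inj: "inj_on ?h ({0..1} - S)" and hc: "x \<in> {0..1} - S \<Longrightarrow> ?h x \<in> circles n" for x
    using bij by (auto simp: bij_betw_def)
  have gcont: "continuous_on (circles n) g" and gim: "z \<in> circles n \<Longrightarrow> g z \<in> circles n" for z
    using g by (auto simp: homeomorphism_def)
  define Y where "Y = {y \<in> circles n. (h \<circ>\<^sub>m \<phi> \<circ>\<^sub>m pinv h) y \<noteq> Some (g y)}"
  define E where "E = S \<union> (?h -` Y \<inter> ({0..1} - S))"
  have Y: "finite Y" unfolding Y_def by (rule fin)
  have E: "finite E" unfolding E_def by (intro finite_UnI S(1) finite_vimage_IntI[OF Y inj])
  have conj: "?h (pval \<phi> x) = g (?h x)" if x: "x \<in> {0..1}" "x \<notin> E" for x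
  proof -
    have xS: "x \<in> {0..1} - S" using x by (auto simp: E_def)
    have hx: "h x = Some (?h x)" using xS dom by (metis domD option.sel)
    have "?h x \<notin> Y" using x xS by (auto simp: E_def)
    then have eq: "(h \<circ>\<^sub>m \<phi> \<circ>\<^sub>m pinv h) (?h x) = Some (g (?h x))" using hc[OF xS] by (simp add: Y_def)
    have "pinv h (?h x) = Some x"
    proof -
      have "?h x \<in> ran h" using hx by (rule ranI)
      moreover have "(THE x'. h x' = Some (?h x)) = x"
      proof (rule the_equality)
        show "h x = Some (?h x)" by (rule hx)
        fix x' assume x': "h x' = Some (?h x)"
        then have "x' \<in> {0..1} - S" using dom by blast
        then show "x' = x" using inj xS x' by (metis inj_onD option.sel)
      qed
      ultimately show ?thesis by (simp add: pinv_def)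
    qed
    then have "(h \<circ>\<^sub>m \<phi>) x = Some (g (?h x))" using eq by (simp add: map_comp_def)
    then show ?thesis by (auto simp: map_comp_Some_iff)
  qed
  (* One application of A acts on the limit of h along a germ by g. *)
  have step: "(?h \<longlongrightarrow> g c) (gact A w)" if w: "w \<in> germs" and c: "c \<in> circles n" "(?h \<longlongrightarrow> c) w" for w c
  proof -
    have ev: "\<forall>\<^sub>F x in w. x \<in> {0..1} \<and> x \<notin> E"
      using eventually_germ_interior[OF w] eventually_germ_notin[OF w E] by eventually_elim auto
    then have "\<forall>\<^sub>F x in w. ?h x \<in> circles n"
      by (rule eventually_mono) (use hc in \<open>auto simp: E_def\<close>)
    then have "((\<lambda>x. g (?h x)) \<longlongrightarrow> g c) w"
      using continuous_on_tendsto_compose[OF gcont c(2) c(1)] by simp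
    moreover have "\<forall>\<^sub>F x in w. g (?h x) = ?h (pval \<phi> x)"
      using ev by (rule eventually_mono) (use conj in auto)
    ultimately have "((\<lambda>x. ?h (pval \<phi> x)) \<longlongrightarrow> g c) w" by (rule Lim_transform_eventually)
    then show ?thesis by (simp add: gact_rep[OF A \<phi> w] filterlim_filtermap)
  qed
  have steps: "(g ^^ k) c \<in> circles n \<and> (?h \<longlongrightarrow> (g ^^ k) c) (gact (A [^]\<^bsub>GIET\<^esub> k) w)"
    if w: "w \<in> germs" and c: "c \<in> circles n" "(?h \<longlongrightarrow> c) w" for w c and k :: nat
  proof (induction k)
    case 0
    then show ?case using that by (simp add: gact_one)
  next
    case (Suc k)
    have "gact (A [^]\<^bsub>GIET\<^esub> Suc k) w = gact A (gact (A [^]\<^bsub>GIET\<^esub> k) w)"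
      by (simp only: gact_pow[OF A w] funpow.simps o_apply)
    then show ?case using step[OF gact_germs[OF GIET.nat_pow_closed[OF A] w]] Suc gim by simp
  qed
  have at: "(?h \<longlongrightarrow> ?h (loc w)) w" if w: "w \<in> germs" "loc w \<notin> S" for w
  proof -
    have "loc w \<in> {0..1} - S" using that loc_bounds by simp
    then have "(?h \<longlongrightarrow> ?h (loc w)) (at (loc w) within {0..1} - S)"
      using cont by (simp add: continuous_on_def)
    moreover have "w \<le> at (loc w) within {0..1} - S"
      using S by (intro germ_le_at w(1)) (simp add: Diff_Diff_Int)
    ultimately show ?thesis by (rule tendsto_mono[rotated])
  qed
  have "disc_count (A [^]\<^bsub>GIET\<^esub> k) \<le> 5 * card S" for k :: nat
  proof (rule card_disc_le)
    show Ak: "A [^]\<^bsub>GIET\<^esub> k \<in> carrier GIET" using A by simp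
    fix a assume a: "a \<in> discontinuities (A [^]\<^bsub>GIET\<^esub> k)"
    let ?l = "gact (A [^]\<^bsub>GIET\<^esub> k) (at_left a)" and ?r = "gact (A [^]\<^bsub>GIET\<^esub> k) (at_right a)"
    have a01: "0 < a" "a < 1" and neq: "loc ?l \<noteq> loc ?r" using a discontinuities_germs[OF Ak] by auto
    have ge: "at_left a \<in> germs" "at_right a \<in> germs" using a01 by auto
    show "a \<in> S \<or> loc ?l \<in> S \<or> loc ?r \<in> S"
    proof (rule ccontr)
      assume *: "\<not> (a \<in> S \<or> loc ?l \<in> S \<or> loc ?r \<in> S)"
      then have c: "?h a \<in> circles n" using hc a01 by simp
      have lr: "?l \<in> germs" "?r \<in> germs" using gact_germs[OF Ak] ge by auto
      have "(?h \<longlongrightarrow> (g ^^ k) (?h a)) ?l" "(?h \<longlongrightarrow> (g ^^ k) (?h a)) ?r"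
        using steps[OF ge(1) c] steps[OF ge(2) c] at[OF ge(1)] at[OF ge(2)] * by auto
      then have "?h (loc ?l) = (g ^^ k) (?h a)" "?h (loc ?r) = (g ^^ k) (?h a)"
        using at[OF lr(1)] at[OF lr(2)] * tendsto_unique germ_neq_bot[OF lr(1)] germ_neq_bot[OF lr(2)] by blast+
      moreover have "loc ?l \<in> {0..1} - S" "loc ?r \<in> {0..1} - S"
        using * loc_bounds[OF lr(1)] loc_bounds[OF lr(2)] by auto
      ultimately show False using inj neq by (metis inj_onD)
    qed
  qed (use S in auto)
  then show ?thesis by (intro bdd_aboveI[of _ "5 * card S"]) auto
qed

section \<open>Homeomorphisms of the line as interval exchanges\<close>

text \<open>An increasing homeomorphism from the line onto \<open>(0, 1)\<close>, with inverse \<open>stretch\<close>. In this coordinate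
  translations of the line are available as interval exchanges.\<close>

definition squash :: "real \<Rightarrow> real" where
  "squash x = (1 + x / (1 + \<bar>x\<bar>)) / 2"

definition stretch :: "real \<Rightarrow> real" where
  "stretch y = (2 * y - 1) / (1 - \<bar>2 * y - 1\<bar>)"

lemma stretch_squash [simp]: "stretch (squash x) = x"
proof -
  have "1 - \<bar>x / (1 + \<bar>x\<bar>)\<bar> = 1 / (1 + \<bar>x\<bar>)"
    by (simp add: abs_divide field_simps)
  moreover have "2 * squash x - 1 = x / (1 + \<bar>x\<bar>)"
    unfolding squash_def by (simp only: times_divide_eq_right nonzero_mult_div_cancel_left)
  ultimately show ?thesis by (simp add: stretch_def)
qed

lemma squash_bounds: "0 < squash x" "squash x < 1"
  by (auto simp: squash_def field_simps abs_if)

lemma squash_stretch [simp]: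
  assumes "0 < y" "y < 1"
  shows "squash (stretch y) = y"
proof -
  have p: "0 < 1 - \<bar>2 * y - 1\<bar>" using assms by (simp add: abs_if)
  then have "1 + \<bar>stretch y\<bar> = 1 / (1 - \<bar>2 * y - 1\<bar>)"
    by (simp add: stretch_def abs_divide field_simps)
  then show ?thesis using p by (simp add: squash_def stretch_def)
qed

lemma strict_mono_squash: "strict_mono squash"
proof (rule strict_monoI)
  fix x y :: real assume "x < y"
  have "x / (1 + \<bar>x\<bar>) < y / (1 + \<bar>y\<bar>)"
  proof -
    consider "0 \<le> x" | "x < 0" "0 \<le> y" | "y < 0" by linarith
    then show ?thesis
    proof cases
      case 1
      then show ?thesis using \<open>x < y\<close> by (simp add: field_simps)
    next
      case 2
      then have "x / (1 + \<bar>x\<bar>) < 0" "0 \<le> y / (1 + \<bar>y\<bar>)" by (simp_all add: divide_neg_pos)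
      then show ?thesis by linarith
    next
      case 3
      then show ?thesis using \<open>x < y\<close> by (simp add: field_simps)
    qed
  qed
  then show "squash x < squash y"
    unfolding squash_def by (intro divide_strict_right_mono add_strict_left_mono) simp_all
qed

lemma squash_less [simp]: "squash x < squash y \<longleftrightarrow> x < y"
  and squash_eq [simp]: "squash x = squash y \<longleftrightarrow> x = y"
  using strict_mono_squash by (auto simp: strict_mono_less strict_mono_eq)

lemma continuous_squash: "continuous_on S squash"
  unfolding squash_def by (intro continuous_intros) auto

lemma continuous_stretch: "continuous_on {0<..<1} stretch"
  unfolding stretch_def by (intro continuous_intros) (auto simp: abs_if)

lemma squash_values: "squash 0 = 1 / 2" "squash 1 = 3 / 4"
  by (simp_all add: squash_def)

definition line_map :: "real set \<Rightarrow> (real \<Rightarrow> real) \<Rightarrow> real \<rightharpoonup> real" where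
  "line_map N c y = (if 0 < y \<and> y < 1 \<and> stretch y \<notin> N then Some (squash (c (stretch y))) else None)"

definition line_exchange :: "real set \<Rightarrow> (real \<Rightarrow> real) \<Rightarrow> bool" where
  "line_exchange N c \<longleftrightarrow> finite N \<and> continuous_on (- N) c \<and> inj_on c (- N) \<and> finite (- (c ` (- N)))"

definition line_class :: "real set \<Rightarrow> (real \<Rightarrow> real) \<Rightarrow> (real \<rightharpoonup> real) set" where
  "line_class N c = giet_rel `` {line_map N c}"

lemma line_map_giet:
  assumes "line_exchange N c"
  shows "is_giet (line_map N c)"
proof -
  have N: "finite N" "continuous_on (- N) c" "inj_on c (- N)" "finite (- (c ` (- N)))"
    using assms by (auto simp: line_exchange_def)
  have dom: "dom (line_map N c) = {y. 0 < y \<and> y < 1 \<and> stretch y \<notin> N}"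
    by (auto simp: line_map_def split: if_splits)
  have pv: "pval (line_map N c) y = squash (c (stretch y))" if "y \<in> dom (line_map N c)" for y
    using that by (auto simp: line_map_def split: if_splits)
  have ran: "ran (line_map N c) = squash ` c ` (- N)"
    unfolding ran_pval
  proof (intro equalityI subsetI)
    fix z assume "z \<in> squash ` c ` (- N)"
    then obtain x where "x \<notin> N" "z = squash (c x)" by auto
    moreover from this have "squash x \<in> dom (line_map N c)" by (simp add: dom squash_bounds)
    ultimately show "z \<in> pval (line_map N c) ` dom (line_map N c)"
      using pv[of "squash x"] by (metis image_eqI stretch_squash)
  qed (use pv dom in auto)
  have "{0..1} - dom (line_map N c) \<subseteq> {0, 1} \<union> squash ` N"
    unfolding dom by (force simp: image_iff) 
  then have 1: "finite ({0..1} - dom (line_map N c))" using N(1) by (auto intro: finite_subset)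
  have "{0..1} - ran (line_map N c) \<subseteq> {0, 1} \<union> squash ` (- (c ` (- N)))"
  proof
    fix y assume y: "y \<in> {0..1} - ran (line_map N c)"
    show "y \<in> {0, 1} \<union> squash ` (- (c ` (- N)))"
    proof (cases "y = 0 \<or> y = 1")
      case False
      then have "y = squash (stretch y)" using y by simp
      then show ?thesis using y unfolding ran by blast
    qed auto
  qed
  then have 2: "finite ({0..1} - ran (line_map N c))" using N(4) by (auto intro: finite_subset)
  have "continuous_on (dom (line_map N c)) (\<lambda>y. squash (c (stretch y)))"
    by (rule continuous_on_compose2[OF continuous_squash[of UNIV]],
        rule continuous_on_compose2[OF N(2) continuous_on_subset[OF continuous_stretch]])
      (auto simp: dom)
  then have 3: "continuous_on (dom (line_map N c)) (pval (line_map N c))"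
    by (rule continuous_on_eq) (simp add: pv)
  have 4: "inj_on (pval (line_map N c)) (dom (line_map N c))"
  proof (rule inj_onI)
    fix x y assume xy: "x \<in> dom (line_map N c)" "y \<in> dom (line_map N c)"
      "pval (line_map N c) x = pval (line_map N c) y"
    then have "stretch x = stretch y" using N(3) by (auto simp: pv dom dest: inj_onD)
    then show "x = y" using xy(1,2) unfolding dom by (metis mem_Collect_eq squash_stretch)
  qed
  have 5: "dom (line_map N c) \<subseteq> {0..1}" "ran (line_map N c) \<subseteq> {0..1}"
    unfolding dom ran by (auto simp: squash_bounds less_imp_le)
  show ?thesis unfolding is_giet_iff using 1 2 3 4 5 by blast
qed

lemma line_class_carrier: "line_exchange N c \<Longrightarrow> line_class N c \<in> carrier GIET"
  unfolding line_class_def using line_map_giet GIET_class by blast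

lemma class_eqI:
  assumes "is_giet \<phi>" "is_giet \<psi>" "finite A" "\<And>x. 0 < x \<Longrightarrow> x < 1 \<Longrightarrow> x \<notin> A \<Longrightarrow> \<phi> x = \<psi> x"
  shows "giet_rel `` {\<phi>} = giet_rel `` {\<psi>}"
proof (rule equiv_class_eq[OF equiv_giet_rel])
  have "{x \<in> {0..1}. \<phi> x \<noteq> \<psi> x} \<subseteq> {0, 1} \<union> A"
    using assms(4) by (auto simp: order_le_less)
  then show "(\<phi>, \<psi>) \<in> giet_rel"
    using assms(1-3) by (auto simp: giet_rel_def intro: finite_subset)
qed

text \<open>Relations between exchanges may be verified on the line, off a finite set of points.\<close>

lemma line_class_mult_eq:
  assumes "line_exchange N c" "line_exchange M d" "line_exchange N' c'" "line_exchange M' d'"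
    and "finite A" "\<And>x. x \<notin> A \<Longrightarrow> c (d x) = c' (d' x)"
  shows "line_class N c \<otimes>\<^bsub>GIET\<^esub> line_class M d = line_class N' c' \<otimes>\<^bsub>GIET\<^esub> line_class M' d'"
proof -
  have fin: "finite (M \<union> {x. x \<notin> M \<and> d x \<in> N})" if "line_exchange N c" "line_exchange M d" for N c M d
  proof -
    have "finite (d -` N \<inter> (- M))" using that by (intro finite_vimage_IntI) (auto simp: line_exchange_def)
    moreover have "{x. x \<notin> M \<and> d x \<in> N} = d -` N \<inter> (- M)" by auto
    ultimately show ?thesis using that by (simp add: line_exchange_def)
  qed
  let ?B = "A \<union> (M \<union> {x. x \<notin> M \<and> d x \<in> N}) \<union> (M' \<union> {x. x \<notin> M' \<and> d' x \<in> N'})"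
  have "giet_rel `` {line_map N c \<circ>\<^sub>m line_map M d} = giet_rel `` {line_map N' c' \<circ>\<^sub>m line_map M' d'}"
  proof (rule class_eqI)
    show "finite (squash ` ?B)"
      by (intro finite_imageI finite_UnI[OF finite_UnI] assms(5) fin[OF assms(1,2)] fin[OF assms(3,4)])
    fix x :: real assume x: "0 < x" "x < 1" "x \<notin> squash ` ?B"
    have nB: "stretch x \<notin> ?B"
    proof
      assume "stretch x \<in> ?B"
      then have "squash (stretch x) \<in> squash ` ?B" by (rule imageI)
      then show False using x squash_stretch[OF x(1,2)] by simp
    qed
    then show "(line_map N c \<circ>\<^sub>m line_map M d) x = (line_map N' c' \<circ>\<^sub>m line_map M' d') x"
      using x assms(6)[of "stretch x"] by (auto simp: map_comp_def line_map_def squash_bounds)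
  qed (use assms line_map_giet giet_comp in blast)+
  then show ?thesis
    unfolding line_class_def using assms line_map_giet by (simp add: GIET_mult_class)
qed

definition line_homeo :: "(real \<Rightarrow> real) \<Rightarrow> bool" where
  "line_homeo q \<longleftrightarrow> strict_mono q \<and> surj q"

abbreviation lin :: "(real \<Rightarrow> real) \<Rightarrow> (real \<rightharpoonup> real) set" where
  "lin \<equiv> line_class {}"

lemma line_homeo_exchange:
  assumes "line_homeo q"
  shows "line_exchange {} q"
proof -
  have "continuous_on UNIV q"
    using assms by (intro continuous_onI_mono) (auto simp: line_homeo_def strict_mono_less_eq)
  then show ?thesis using assms by (auto simp: line_exchange_def line_homeo_def strict_mono_imp_inj_on)
qed

lemma line_homeo_bij: "line_homeo q \<Longrightarrow> bij q"
  by (simp add: line_homeo_def bij_def strict_mono_imp_inj_on)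

lemma line_homeo_id [simp]: "line_homeo id" "line_homeo (\<lambda>x. x)"
  by (auto simp: line_homeo_def strict_mono_def surj_def)

lemma line_homeo_comp: "line_homeo q \<Longrightarrow> line_homeo r \<Longrightarrow> line_homeo (q \<circ> r)"
  unfolding line_homeo_def by (simp add: strict_mono_def comp_surj del: comp_apply) simp

lemma line_homeo_inv:
  assumes "line_homeo q"
  shows "line_homeo (inv_into UNIV q)"
proof -
  have b: "bij q" using assms by (rule line_homeo_bij)
  have "strict_mono (inv_into UNIV q)"
  proof (rule strict_monoI)
    fix x y :: real assume "x < y"
    then have "q (inv_into UNIV q x) < q (inv_into UNIV q y)" using b by (simp add: bij_is_surj surj_f_inv_f)
    then show "inv_into UNIV q x < inv_into UNIV q y" using assms by (simp add: line_homeo_def strict_mono_less)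
  qed
  then show ?thesis using b by (simp add: line_homeo_def bij_imp_bij_inv bij_is_surj)
qed

lemma line_homeo_affine: "0 < c \<Longrightarrow> line_homeo (\<lambda>x. c * x + d)"
  unfolding line_homeo_def strict_mono_def surj_def
  by (auto intro!: exI[of _ "(_ - d) / c"])

lemma line_homeo_shift: "line_homeo (\<lambda>x. x + d)"
  using line_homeo_affine[of 1 d] by simp

lemma line_homeo_glue:
  assumes "line_homeo f" "line_homeo g" "f m = g m"
  shows "line_homeo (\<lambda>x. if x \<le> m then f x else g x)"
proof -
  have f: "f x < f y \<longleftrightarrow> x < y" and g: "g x < g y \<longleftrightarrow> x < y" for x y
    using assms by (auto simp: line_homeo_def strict_mono_less)
  have "surj (\<lambda>x. if x \<le> m then f x else g x)"
    unfolding surj_def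
  proof
    fix y
    obtain a b where ab: "y = f a" "y = g b" using assms by (meson line_homeo_def surj_def)
    show "\<exists>x. y = (if x \<le> m then f x else g x)"
    proof (cases "a \<le> m")
      case False
      then have "f m < y" using f ab by simp
      then have "g m < g b" using assms(3) ab by simp
      then have "m < b" using g by blast
      then show ?thesis using ab by (intro exI[of _ b]) simp
    qed (use ab in auto)
  qed
  moreover have "strict_mono (\<lambda>x. if x \<le> m then f x else g x)"
  proof (rule strict_monoI)
    fix x y :: real assume "x < y"
    consider "y \<le> m" | "x \<le> m" "m < y" | "m < x" by linarith
    then show "(if x \<le> m then f x else g x) < (if y \<le> m then f y else g y)"
    proof cases
      case 2
      then have "f x \<le> f m" "g m < g y" using f[of m x] g by (auto simp: not_less[symmetric])
      then show ?thesis using 2 assms(3) by simp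
    qed (use \<open>x < y\<close> f g in auto)
  qed
  ultimately show ?thesis by (simp add: line_homeo_def)
qed

lemma lin_carrier: "line_homeo q \<Longrightarrow> lin q \<in> carrier GIET"
  using line_homeo_exchange line_class_carrier by blast

lemma lin_one: "lin id = \<one>\<^bsub>GIET\<^esub>"
  unfolding line_class_def GIET_one
  by (rule class_eqI[of _ _ "{}"])
     (auto simp: line_map_giet line_homeo_exchange is_giet_id line_map_def giet_id_def)

lemma lin_mult_eq:
  assumes "line_homeo q" "line_homeo r" "line_homeo q'" "line_homeo r'" "\<And>x. q (r x) = q' (r' x)"
  shows "lin q \<otimes>\<^bsub>GIET\<^esub> lin r = lin q' \<otimes>\<^bsub>GIET\<^esub> lin r'"
  using assms line_homeo_exchange by (intro line_class_mult_eq[of _ _ _ _ _ _ _ _ "{}"]) auto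

lemma lin_comp:
  assumes "line_homeo q" "line_homeo r"
  shows "lin (q \<circ> r) = lin q \<otimes>\<^bsub>GIET\<^esub> lin r"
  using lin_mult_eq[of "q \<circ> r" id q r] assms lin_carrier[OF line_homeo_comp[OF assms]]
  by (simp add: lin_one line_homeo_comp)

lemma lin_inv:
  assumes "line_homeo q"
  shows "lin (inv_into UNIV q) = inv\<^bsub>GIET\<^esub> (lin q)"
proof -
  have "lin (inv_into UNIV q) \<otimes>\<^bsub>GIET\<^esub> lin q = \<one>\<^bsub>GIET\<^esub>"
    using lin_comp[OF line_homeo_inv[OF assms] assms] line_homeo_bij[OF assms]
    by (simp add: inv_o_cancel bij_is_inj lin_one)
  then show ?thesis
    using GIET.inv_equality lin_carrier assms line_homeo_inv by metis
qed

lemma lin_pow_shift: "lin (\<lambda>x. x + 1) [^]\<^bsub>GIET\<^esub> (n::nat) = lin (\<lambda>x. x + real n)"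
proof (induction n)
  case 0
  then show ?case using lin_one by (simp add: id_def)
next
  case (Suc n)
  have "(\<lambda>x. x + real n) \<circ> (\<lambda>x. x + 1) = (\<lambda>x. x + real (Suc n))" by (auto simp: fun_eq_iff)
  then show ?case using lin_comp[OF line_homeo_shift line_homeo_shift, of "real n" 1] Suc by simp
qed

section \<open>Independent homeomorphisms in consecutive cells\<close>

definition cell_homeo :: "(real \<Rightarrow> real) \<Rightarrow> bool" where
  "cell_homeo u \<longleftrightarrow> strict_mono_on {0..<1} u \<and> u ` {0..<1} = {0..<1}"

definition cells :: "(int \<Rightarrow> real \<Rightarrow> real) \<Rightarrow> real \<Rightarrow> real" where
  "cells U x = of_int \<lfloor>x\<rfloor> + U \<lfloor>x\<rfloor> (frac x)"

lemma cell_homeo_in: "cell_homeo u \<Longrightarrow> 0 \<le> x \<Longrightarrow> x < 1 \<Longrightarrow> 0 \<le> u x \<and> u x < 1"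
  unfolding cell_homeo_def by (metis atLeastLessThan_iff imageI)

lemma cell_homeo_id [simp]: "cell_homeo id"
  by (auto simp: cell_homeo_def strict_mono_on_def)

lemma cells_at:
  assumes "0 \<le> y" "y < 1"
  shows "cells U (of_int k + y) = of_int k + U k y"
proof -
  have "\<lfloor>of_int k + y\<rfloor> = k" using assms by (simp add: floor_eq_iff)
  then show ?thesis by (simp add: cells_def frac_def)
qed

lemma cell_split: obtains k y where "x = of_int k + y" "0 \<le> y" "y < (1::real)"
proof (rule that)
  show "x = of_int \<lfloor>x\<rfloor> + frac x" by (simp add: frac_def)
qed (auto simp: frac_lt_1)

lemma line_homeo_cells:
  assumes U: "\<And>k. cell_homeo (U k)"
  shows "line_homeo (cells U)"
proof -
  have "strict_mono (cells U)"
  proof (rule strict_monoI)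
    fix x x' :: real assume less: "x < x'"
    obtain k y where x: "x = of_int k + y" "0 \<le> y" "y < 1" by (rule cell_split)
    obtain k' y' where x': "x' = of_int k' + y'" "0 \<le> y'" "y' < 1" by (rule cell_split)
    have b: "0 \<le> U k y" "U k y < 1" "0 \<le> U k' y'" using cell_homeo_in[OF U] x x' by auto
    show "cells U x < cells U x'"
    proof (cases "k = k'")
      case True
      then have "U k y < U k y'" using less x x' U[of k] by (auto simp: cell_homeo_def strict_mono_on_def)
      then show ?thesis using True x x' by (simp add: cells_at)
    next
      case False
      have "of_int k < real_of_int k' + 1" using less x x' by linarith
      then have "k < k'" using False by linarith
      then have "real_of_int k + 1 \<le> of_int k'" by linarith
      then show ?thesis using x x' b by (simp add: cells_at)
    qed
  qed
  moreover have "surj (cells U)"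
    unfolding surj_def
  proof
    fix z :: real
    obtain k y where z: "z = of_int k + y" "0 \<le> y" "y < 1" by (rule cell_split)
    then have "y \<in> U k ` {0..<1}" using U[of k] by (simp add: cell_homeo_def)
    then obtain y' where "0 \<le> y'" "y' < 1" "y = U k y'" by auto
    then show "\<exists>x. z = cells U x" using z cells_at by metis
  qed
  ultimately show ?thesis by (simp add: line_homeo_def)
qed

lemma cells_cells:
  assumes "\<And>k. cell_homeo (V k)"
  shows "cells U (cells V x) = cells (\<lambda>k. U k \<circ> V k) x"
proof -
  obtain k y where x: "x = of_int k + y" "0 \<le> y" "y < 1" by (rule cell_split)
  then show ?thesis using cell_homeo_in[OF assms, of y k] by (simp add: cells_at)
qed

lemma cells_shift: "cells U (x + of_int n) = cells (\<lambda>k. U (k + n)) x + of_int n"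
proof -
  obtain k y where x: "x = of_int k + y" "0 \<le> y" "y < 1" by (rule cell_split)
  then have xn: "x + of_int n = of_int (k + n) + y" by simp
  show ?thesis unfolding xn unfolding x(1) cells_at[OF x(2,3)] by simp
qed

lemma cells_cong:
  assumes "\<And>k y. 0 \<le> y \<Longrightarrow> y < 1 \<Longrightarrow> U k y = V k y"
  shows "cells U = cells V"
proof
  fix x :: real
  obtain k y where x: "x = of_int k + y" "0 \<le> y" "y < 1" by (rule cell_split)
  then show "cells U x = cells V x" using assms by (simp add: cells_at)
qed

text \<open>A homeomorphism of the line, compressed into the unit cell.\<close>

definition row :: "(real \<Rightarrow> real) \<Rightarrow> real \<Rightarrow> real" where
  "row q y = (if 0 < y \<and> y < 1 then squash (q (stretch y)) else y)"

lemma cell_homeo_row: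
  assumes "line_homeo q"
  shows "cell_homeo (row q)"
proof -
  have q: "q x < q y \<longleftrightarrow> x < y" for x y using assms by (auto simp: line_homeo_def strict_mono_less)
  have st: "stretch x < stretch y" if "0 < x" "x < y" "y < 1" for x y
    using that squash_less[of "stretch x" "stretch y"] by simp
  have "strict_mono_on {0..<1} (row q)"
    by (rule strict_mono_onI) (auto simp: row_def squash_bounds q st)
  moreover have "row q ` {0..<1} = {0..<1}"
  proof (intro equalityI subsetI)
    fix z :: real assume z: "z \<in> {0..<1}"
    show "z \<in> row q ` {0..<1}"
    proof (cases "z = 0")
      case False
      obtain x where x: "stretch z = q x" using assms by (meson line_homeo_def surj_def)
      then have "squash (q x) = z" using z False by (simp flip: x)
      then have "z = row q (squash x)" using squash_bounds by (simp add: row_def)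
      then show ?thesis using squash_bounds[of x] by (intro image_eqI[of _ _ "squash x"]) auto
    qed (auto simp: row_def image_iff intro!: bexI[of _ 0])
  qed (auto simp: row_def squash_bounds less_imp_le)
  ultimately show ?thesis by (simp add: cell_homeo_def)
qed

lemma row_row: "row q (row r y) = row (q \<circ> r) y"
  by (simp add: row_def squash_bounds)

lemma row_id [simp]: "row id = id"
  by (auto simp: row_def fun_eq_iff)

text \<open>Each cell of the line contains a compressed copy of the line, called a row, which has cells of its
  own. In \<open>nested u\<close> the homeomorphism \<open>u\<close> acts in the zeroth cell of the zeroth row only.\<close>

definition in_cell_0 :: "(real \<Rightarrow> real) \<Rightarrow> int \<Rightarrow> real \<Rightarrow> real" where
  "in_cell_0 u k = (if k = 0 then u else id)"

definition nested :: "(real \<Rightarrow> real) \<Rightarrow> real \<Rightarrow> real" where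
  "nested u = cells (in_cell_0 (row (cells (in_cell_0 u))))"

lemma cell_homeo_in_cell_0: "cell_homeo u \<Longrightarrow> cell_homeo (in_cell_0 u k)"
  by (simp add: in_cell_0_def)

lemma line_homeo_nested: "cell_homeo u \<Longrightarrow> line_homeo (nested u)"
  unfolding nested_def
  by (intro line_homeo_cells cell_homeo_in_cell_0 cell_homeo_row)

text \<open>All terms of the sequence are stored in one homeomorphism \<open>Q 0\<close>: in the row with number \<open>n \<ge> 0\<close> it
  acts by \<open>u n\<close> in every cell with nonnegative number. The conjugate \<open>Q n\<close> of \<open>Q 0\<close> by the translation by \<open>n\<close>
  has the data of \<open>u n\<close> in the zeroth row. Let \<open>a\<close> shift the cells of the zeroth row by one and fix everything
  else. The commutator of \<open>Q n\<close> and \<open>a\<close> is trivial outside the zeroth row, and there the copies of \<open>u n\<close>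
  cancel except for the first one. So \<open>nested (u n)\<close> is a word of length \<open>O(n)\<close> in three letters.\<close>

lemma cheap_nested:
  assumes u: "\<And>n. cell_homeo (u n)"
  shows "GIET.cheap (\<lambda>n. lin (nested (u n)))"
proof -
  define W where "W n = cells (\<lambda>m. if 0 \<le> m then u n else id)" for n :: nat
  define Q where "Q n = cells (\<lambda>k. if 0 \<le> k + int n then row (W (nat (k + int n))) else id)" for n :: nat
  define a where "a = cells (in_cell_0 (row (\<lambda>x. x + 1)))"
  have W: "line_homeo (W n)" for n
    unfolding W_def using u by (intro line_homeo_cells) simp
  have Q: "line_homeo (Q n)" for n
    unfolding Q_def using W by (intro line_homeo_cells) (simp add: cell_homeo_row)
  have a: "line_homeo a"
    unfolding a_def using line_homeo_shift by (intro line_homeo_cells cell_homeo_in_cell_0 cell_homeo_row)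
  have shift: "Q 0 (x + real n) = Q n x + real n" for n x
    using cells_shift[of "\<lambda>k. if 0 \<le> k then row (W (nat k)) else id" x "int n"]
    by (simp add: Q_def cong: if_cong)
  (* Shifting the half-infinite row of copies of u n by one cell loses exactly the copy in cell 0. *)
  have core: "W n \<circ> (\<lambda>x. x + 1) = cells (in_cell_0 (u n)) \<circ> (\<lambda>x. x + 1) \<circ> W n" for n
  proof
    fix x :: real
    have "W n (x + 1) = cells (\<lambda>m. if 0 \<le> m + 1 then u n else id) x + 1"
      using cells_shift[of "\<lambda>m. if 0 \<le> m then u n else id" x 1] by (simp add: W_def)
    also have "cells (\<lambda>m. if 0 \<le> m + 1 then u n else id) =
        cells (\<lambda>m. in_cell_0 (u n) (m + 1) \<circ> (if 0 \<le> m then u n else id))"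
      by (rule arg_cong[of _ _ cells]) (auto simp: fun_eq_iff in_cell_0_def)
    also have "\<dots> x + 1 = cells (\<lambda>m. in_cell_0 (u n) (m + 1)) (W n x) + 1"
      unfolding W_def using u by (subst cells_cells) auto
    also have "\<dots> = cells (in_cell_0 (u n)) (W n x + 1)"
      using cells_shift[of "in_cell_0 (u n)" "W n x" 1] by simp
    finally show "(W n \<circ> (\<lambda>x. x + 1)) x = (cells (in_cell_0 (u n)) \<circ> (\<lambda>x. x + 1) \<circ> W n) x"
      by simp
  qed
  have comm: "Q n (a x) = nested (u n) (a (Q n x))" for n x
  proof -
    let ?q = "\<lambda>k. if 0 \<le> k + int n then row (W (nat (k + int n))) else id"
    have c: "cell_homeo (?q k)" "cell_homeo (in_cell_0 (row (\<lambda>x. x + 1)) k)" for k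
      using W cell_homeo_row line_homeo_shift cell_homeo_in_cell_0 by auto
    have "Q n (a x) = cells (\<lambda>k. ?q k \<circ> in_cell_0 (row (\<lambda>x. x + 1)) k) x"
      unfolding Q_def a_def by (rule cells_cells[OF c(2)])
    also have "\<dots> = cells (\<lambda>k. in_cell_0 (row (cells (in_cell_0 (u n)))) k \<circ>
        (in_cell_0 (row (\<lambda>x. x + 1)) k \<circ> ?q k)) x"
    proof (rule fun_cong[of _ _ x], rule cells_cong)
      fix k :: int and y :: real
      show "(?q k \<circ> in_cell_0 (row (\<lambda>x. x + 1)) k) y =
        (in_cell_0 (row (cells (in_cell_0 (u n)))) k \<circ> (in_cell_0 (row (\<lambda>x. x + 1)) k \<circ> ?q k)) y"
      proof (cases "k = 0")
        case True
        then show ?thesis using core[of n] by (simp add: in_cell_0_def row_row comp_assoc)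
      qed (simp add: in_cell_0_def)
    qed
    also have "\<dots> = nested (u n) (a (Q n x))"
      unfolding nested_def a_def Q_def using c
      by (subst cells_cells, simp add: cell_homeo_in_cell_0, subst cells_cells) 
         (auto simp: cell_homeo_in_cell_0 comp_assoc)
    finally show ?thesis .
  qed
  let ?b = "lin (\<lambda>x. x + 1)"
  let ?S = "{lin (Q 0), lin a, ?b}"
  have S: "?S \<subseteq> carrier GIET" using lin_carrier Q a line_homeo_shift by auto
  have Qn: "lin (Q n) = inv\<^bsub>GIET\<^esub> (?b [^]\<^bsub>GIET\<^esub> n) \<otimes>\<^bsub>GIET\<^esub> (lin (Q 0) \<otimes>\<^bsub>GIET\<^esub> ?b [^]\<^bsub>GIET\<^esub> n)" for n
  proof -
    have "lin (Q 0) \<otimes>\<^bsub>GIET\<^esub> lin (\<lambda>x. x + real n) = lin (\<lambda>x. x + real n) \<otimes>\<^bsub>GIET\<^esub> lin (Q n)"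
      using Q line_homeo_shift shift by (intro lin_mult_eq) auto
    then show ?thesis
      using lin_carrier[OF Q] lin_carrier[OF line_homeo_shift, of "real n"]
      by (simp add: lin_pow_shift GIET.m_assoc[symmetric])
  qed
  have nest: "lin (nested (u n)) = (lin (Q n) \<otimes>\<^bsub>GIET\<^esub> lin a) \<otimes>\<^bsub>GIET\<^esub> inv\<^bsub>GIET\<^esub> (lin a \<otimes>\<^bsub>GIET\<^esub> lin (Q n))" for n
  proof -
    have "lin (Q n) \<otimes>\<^bsub>GIET\<^esub> lin a = lin (nested (u n)) \<otimes>\<^bsub>GIET\<^esub> lin (a \<circ> Q n)"
      using Q a line_homeo_nested u comm by (intro lin_mult_eq line_homeo_comp) auto
    also have "\<dots> = lin (nested (u n)) \<otimes>\<^bsub>GIET\<^esub> (lin a \<otimes>\<^bsub>GIET\<^esub> lin (Q n))"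
      by (simp only: lin_comp[OF a Q])
    finally show ?thesis
      using lin_carrier[OF Q] lin_carrier[OF a] lin_carrier[OF line_homeo_nested[OF u]]
      by (simp add: GIET.m_assoc)
  qed
  show ?thesis
  proof (rule GIET.cheapI[of ?S 6])
    fix n
    have b: "GIET.word_in ?S n (?b [^]\<^bsub>GIET\<^esub> n)"
      using GIET.word_in_pow[OF S GIET.word_in_letter[OF S], of ?b n] by simp
    have "GIET.word_in ?S (n + (1 + n)) (lin (Q n))"
      by (subst Qn, intro GIET.word_in_mult[OF S] GIET.word_in_inv[OF S] GIET.word_in_letter[OF S] b) simp
    then have "GIET.word_in ?S ((n + (1 + n) + 1) + (1 + (n + (1 + n)))) (lin (nested (u n)))"
      unfolding nest
      by (intro GIET.word_in_mult[OF S] GIET.word_in_inv[OF S] GIET.word_in_letter[OF S]) simp_all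
    then show "GIET.word_in ?S (6 * Suc n) (lin (nested (u n)))"
      by (rule GIET.word_in_mono) auto
  qed (use S in auto)
qed

section \<open>Every sequence of homeomorphisms of the line is cheap\<close>

text \<open>What matters is that the negative half-line is moved increasingly onto the bounded interval
  \<open>(1 / 2, 3 / 4)\<close>, in which the maps \<open>nested u\<close> are supported. The two other pieces fill the rest of the line.\<close>

definition trap :: "real \<Rightarrow> real" where
  "trap x = (if x < 0 then 1 / 2 + 1 / (4 * (1 - x)) else if x < 1 then 3 / 2 - 1 / x else x - 1 / 4)"

lemma trap_neg: "x < 0 \<Longrightarrow> 1 / 2 < trap x \<and> trap x < 3 / 4"
  by (simp add: trap_def field_simps)

lemma trap_mid: "0 < x \<Longrightarrow> x < 1 \<Longrightarrow> trap x < 1 / 2"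
  by (simp add: trap_def field_simps)

lemma trap_exchange: "line_exchange {0, 1} trap"
proof -
  have opens: "continuous_on ({..<0} \<union> {0<..<1} \<union> {1<..}) trap"
  proof (intro continuous_on_open_Un)
    show "continuous_on {..<0} trap"
      by (rule continuous_on_eq[of _ "\<lambda>x. 1 / 2 + 1 / (4 * (1 - x))"])
         (auto simp: trap_def intro!: continuous_intros)
    show "continuous_on {0<..<1} trap"
      by (rule continuous_on_eq[of _ "\<lambda>x. 3 / 2 - 1 / x"])
         (auto simp: trap_def intro!: continuous_intros)
    show "continuous_on {1<..} trap"
      by (rule continuous_on_eq[of _ "\<lambda>x. x - 1 / 4"])
         (auto simp: trap_def intro!: continuous_intros)
  qed auto
  have eq: "- {0, 1} = {..<0} \<union> {0<..<1} \<union> {1::real<..}" by auto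
  have inj: "inj_on trap (- {0, 1})"
  proof (rule linorder_inj_onI)
    fix x y :: real assume *: "x < y" "x \<in> - {0, 1}" "y \<in> - {0, 1}"
    consider "x < 0" "y < 0" | "x < 0" "0 < y" "y < 1" | "x < 0" "1 < y" | "0 < x" "y < 1"
      | "0 < x" "x < 1" "1 < y" | "1 < x"
      using * by fastforce
    then show "trap x \<noteq> trap y"
    proof cases
      case 1
      then show ?thesis using *(1) by (simp add: trap_def field_simps)
    next
      case 2
      then show ?thesis using trap_neg[of x] trap_mid[of y] by simp
    next
      case 3
      then have "3 / 4 < trap y" by (simp add: trap_def)
      then show ?thesis using trap_neg[OF 3(1)] by simp
    next
      case 4
      then show ?thesis using *(1) by (simp add: trap_def field_simps)
    next
      case 5
      then show ?thesis using trap_mid[of x] by (simp add: trap_def)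
    next
      case 6
      then show ?thesis using *(1) by (simp add: trap_def)
    qed
  qed auto
  have "- (trap ` (- {0, 1})) \<subseteq> {1 / 2, 3 / 4}"
  proof (rule subsetI, rule ccontr)
    fix y :: real assume y: "y \<in> - (trap ` (- {0, 1}))" "y \<notin> {1 / 2, 3 / 4}"
    consider "y < 1 / 2" | "1 / 2 < y" "y < 3 / 4" | "3 / 4 < y" using y(2) by fastforce
    then have "\<exists>x. x \<in> - {0, 1} \<and> trap x = y"
    proof cases
      case 1
      then show ?thesis
        by (intro exI[of _ "1 / (3 / 2 - y)"]) (auto simp: trap_def field_simps)
    next
      case 2
      then show ?thesis
        by (intro exI[of _ "1 - 1 / (4 * (y - 1 / 2))"]) (auto simp: trap_def field_simps)
    next
      case 3
      then show ?thesis
        by (intro exI[of _ "y + 1 / 4"]) (auto simp: trap_def)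
    qed
    then show False using y(1) by blast
  qed
  then have "finite (- (trap ` (- {0, 1})))" by (rule finite_subset) simp
  then show ?thesis using opens inj unfolding line_exchange_def eq[symmetric] by simp
qed

text \<open>Conjugation by \<open>trap\<close> turns a homeomorphism of the negative half-line into one that is supported in a
  single cell of a single row. Here \<open>K\<close> identifies the half-line with the unit cell, with inverse \<open>L\<close>.\<close>

lemma cheap_half_line:
  assumes v: "\<And>n. line_homeo (v n)" and fixed: "\<And>n x. 0 \<le> x \<Longrightarrow> v n x = x"
  shows "GIET.cheap (\<lambda>n. lin (v n))"
proof -
  define K where "K x = 1 / (1 - 2 * x)" for x :: real
  define L where "L z = (1 - 1 / z) / 2" for z :: real
  define u where "u n z = (if 0 < z \<and> z < 1 then K (v n (L z)) else z)" for n z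
  have LK: "L (K x) = x" and K01: "0 < K x" "K x < 1" if "x < 0" for x
    using that by (simp_all add: K_def L_def field_simps)
  have KL: "K (L z) = z" and Lneg: "L z < 0" if "0 < z" "z < 1" for z
    using that by (simp_all add: K_def L_def field_simps)
  have Kmono: "K x < K y" if "x < y" "y < 0" for x y
    using that by (simp add: K_def field_simps)
  have Lmono: "L x < L y" if "0 < x" "x < y" for x y
    using that by (simp add: L_def field_simps)
  have vneg: "v n x < 0" if "x < 0" for n x
    using v[of n] fixed[of 0 n] that by (metis line_homeo_def order_refl strict_mono_less)
  have vmono: "v n x < v n y" if "x < y" for n x y
    using v[of n] that by (simp add: line_homeo_def strict_mono_less)
  have u01: "0 < u n z \<and> u n z < 1" if "0 < z" "z < 1" for n z
    using that K01[OF vneg[OF Lneg]] by (simp add: u_def)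
  have u: "cell_homeo (u n)" for n
  proof -
    have "strict_mono_on {0..<1} (u n)"
    proof (rule strict_mono_onI)
      fix x y :: real assume *: "x \<in> {0..<1}" "y \<in> {0..<1}" "x < y"
      show "u n x < u n y"
      proof (cases "x = 0")
        case True
        then show ?thesis using u01[of y n] * by (simp add: u_def)
      next
        case False
        then show ?thesis using * Kmono[OF vmono[OF Lmono] vneg[OF Lneg]] by (simp add: u_def)
      qed
    qed
    moreover have "u n ` {0..<1} = {0..<1}"
    proof (intro equalityI subsetI)
      fix z :: real assume "z \<in> u n ` {0..<1}"
      then obtain x where "0 \<le> x" "x < 1" "z = u n x" by auto
      then show "z \<in> {0..<1}" using u01[of x n] by (cases "x = 0") (auto simp: u_def)
    next
      fix z :: real assume z: "z \<in> {0..<1}"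
      show "z \<in> u n ` {0..<1}"
      proof (cases "z = 0")
        case True
        then show ?thesis by (intro image_eqI[of _ _ 0]) (auto simp: u_def)
      next
        case False
        then have z01: "0 < z" "z < 1" using z by auto
        obtain x where x: "L z = v n x" using v[of n] unfolding line_homeo_def surj_def by blast
        have "x < 0"
        proof (rule ccontr)
          assume "\<not> x < 0"
          then show False using fixed[of x n] Lneg[OF z01] x by simp
        qed
        have "u n (K x) = K (v n x)" using K01[OF \<open>x < 0\<close>] LK[OF \<open>x < 0\<close>] by (simp add: u_def)
        also have "\<dots> = z" using KL[OF z01] x by simp
        finally have "u n (K x) = z" .
        then show ?thesis using K01[OF \<open>x < 0\<close>] by (intro image_eqI[of _ _ "K x"]) auto
      qed
    qed
    ultimately show ?thesis by (simp add: cell_homeo_def)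
  qed
  have trap_squash: "trap x = squash (K x)" if "x < 0" for x
    using that by (simp add: trap_def squash_def K_def field_simps)
  have nested_at: "nested (u n) (squash z) = squash (u n z)" if "0 < z" "z < 1" for n z
  proof -
    have "nested (u n) (of_int 0 + squash z) = row (cells (in_cell_0 (u n))) (squash z)"
      unfolding nested_def using squash_bounds[of z] by (subst cells_at) (auto simp: in_cell_0_def)
    also have "\<dots> = squash (cells (in_cell_0 (u n)) (of_int 0 + z))"
      by (simp add: row_def squash_bounds)
    also have "\<dots> = squash (u n z)" using that by (subst cells_at) (auto simp: in_cell_0_def)
    finally show ?thesis by simp
  qed
  have in_cell_off: "cells (in_cell_0 w) y = y" if "y < 0 \<or> 1 \<le> y" for w y
  proof -
    obtain k r where y: "y = of_int k + r" "0 \<le> r" "r < (1::real)" by (rule cell_split)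
    then have "k \<noteq> 0" using that by auto
    then show ?thesis using y by (simp add: cells_at in_cell_0_def)
  qed
  have nested_off: "nested (u n) y = y" if "y < 1 / 2 \<or> 3 / 4 < y" for n y
  proof (cases "0 < y \<and> y < 1")
    case True
    have "stretch y < 0 \<or> 1 \<le> stretch y"
      using True that squash_less[of "stretch y" 0] squash_less[of 1 "stretch y"] by (auto simp: squash_values)
    then have "cells (in_cell_0 (u n)) (stretch y) = stretch y" by (rule in_cell_off)
    moreover have "nested (u n) (of_int 0 + y) = row (cells (in_cell_0 (u n))) y"
      unfolding nested_def using True by (subst cells_at) (auto simp: in_cell_0_def)
    ultimately show ?thesis using True by (simp add: row_def)
  next
    case False
    then consider "y = 0" | "y < 0 \<or> 1 \<le> y" by linarith
    then show ?thesis
    proof cases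
      case 1
      then show ?thesis using cells_at[of 0 "in_cell_0 (row (cells (in_cell_0 (u n))))" 0]
        by (simp add: nested_def in_cell_0_def row_def)
    next
      case 2
      then show ?thesis unfolding nested_def by (rule in_cell_off)
    qed
  qed
  let ?c = "line_class {0, 1} trap"
  have c: "?c \<in> carrier GIET" using line_class_carrier[OF trap_exchange] .
  have eq: "lin (nested (u n)) \<otimes>\<^bsub>GIET\<^esub> ?c = ?c \<otimes>\<^bsub>GIET\<^esub> lin (v n)" for n
  proof (rule line_class_mult_eq[where A = "{0, 1}"])
    fix x :: real assume x: "x \<notin> {0, 1}"
    show "nested (u n) (trap x) = trap (v n x)"
    proof (cases "x < 0")
      case True
      then have "nested (u n) (trap x) = squash (u n (K x))" by (simp add: trap_squash nested_at K01)
      also have "\<dots> = trap (v n x)" using True by (simp add: u_def K01 LK trap_squash vneg)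
      finally show ?thesis .
    next
      case False
      then have "trap x < 1 / 2 \<or> 3 / 4 < trap x" using x trap_mid[of x] by (auto simp: trap_def)
      then show ?thesis using nested_off fixed[of x n] False by simp
    qed
  qed (use line_homeo_exchange line_homeo_nested u v trap_exchange in auto)
  have "lin (v n) = inv\<^bsub>GIET\<^esub> ?c \<otimes>\<^bsub>GIET\<^esub> lin (nested (u n)) \<otimes>\<^bsub>GIET\<^esub> inv\<^bsub>GIET\<^esub> (inv\<^bsub>GIET\<^esub> ?c)" for n
  proof -
    have "inv\<^bsub>GIET\<^esub> ?c \<otimes>\<^bsub>GIET\<^esub> (lin (nested (u n)) \<otimes>\<^bsub>GIET\<^esub> ?c) = lin (v n)"
      using eq[of n] c lin_carrier[OF v] by (simp add: GIET.m_assoc[symmetric])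
    then show ?thesis using c lin_carrier[OF line_homeo_nested[OF u]] by (simp add: GIET.m_assoc)
  qed
  then show ?thesis
    using GIET.cheap_conj[OF cheap_nested[of u, OF u] GIET.inv_closed[OF c]] by simp
qed

text \<open>Write \<open>v = a b\<close>, where \<open>a\<close> agrees with \<open>v\<close> on the negative half-line, is linear on \<open>[0, 1]\<close>, and is the
  identity to the right of 1; such an increasing \<open>a\<close> exists because \<open>v 0 < 1\<close>. A translation and the
  reflection at 0 conjugate \<open>a\<close> and \<open>b\<close>, respectively, to homeomorphisms that fix the positive half-line.\<close>

lemma cheap_line_homeos_at_most_0:
  assumes v: "\<And>n. line_homeo (v n)" and v0: "\<And>n. v n 0 \<le> 0"
  shows "GIET.cheap (\<lambda>n. lin (v n))"
proof -
  define a where "a n x = (if x \<le> 0 then v n x else if x \<le> 1 then (1 - v n 0) * x + v n 0 else x)" for n x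
  have a: "line_homeo (a n)" for n
  proof -
    have "line_homeo (\<lambda>x. if x \<le> 1 then (1 - v n 0) * x + v n 0 else x)"
      using line_homeo_affine[of "1 - v n 0" "v n 0"] v0[of n] by (intro line_homeo_glue) auto
    from line_homeo_glue[OF v this] show ?thesis unfolding a_def by simp
  qed
  define b where "b n = inv_into UNIV (a n) \<circ> v n" for n
  have b: "line_homeo (b n)" for n
    unfolding b_def using a v line_homeo_comp line_homeo_inv by blast
  have ab: "lin (v n) = lin (a n) \<otimes>\<^bsub>GIET\<^esub> lin (b n)" for n
  proof -
    have "a n \<circ> b n = v n"
      using line_homeo_bij[OF a[of n]] by (auto simp: b_def fun_eq_iff bij_is_surj surj_f_inv_f)
    then show ?thesis using lin_comp[OF a[of n] b[of n]] by simp
  qed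
  have b_fix: "b n x = x" if "x \<le> 0" for n x
  proof -
    have "v n x = a n x" using that by (simp add: a_def)
    then show ?thesis using line_homeo_bij[OF a[of n]] by (simp add: b_def bij_is_inj)
  qed
  let ?s = "\<lambda>x. x + (1::real)"
  define a' where "a' n x = a n (x + 1) - 1" for n x
  have a': "line_homeo (a' n)" for n
    using line_homeo_comp[OF line_homeo_comp[OF line_homeo_shift[of "-1"] a[of n]] line_homeo_shift[of 1]]
    by (simp add: a'_def[abs_def] o_def)
  have "GIET.cheap (\<lambda>n. lin (a' n))"
    using a' by (rule cheap_half_line) (simp add: a'_def a_def)
  moreover have "lin (a n) = lin ?s \<otimes>\<^bsub>GIET\<^esub> lin (a' n) \<otimes>\<^bsub>GIET\<^esub> inv\<^bsub>GIET\<^esub> (lin ?s)" for n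
  proof -
    have "lin (a n) \<otimes>\<^bsub>GIET\<^esub> lin ?s = lin ?s \<otimes>\<^bsub>GIET\<^esub> lin (a' n)"
      using a a' line_homeo_shift by (intro lin_mult_eq) (auto simp: a'_def)
    then show ?thesis using lin_carrier[OF a] lin_carrier[OF a'] lin_carrier[OF line_homeo_shift]
      by (metis GIET.inv_solve_right' GIET.m_closed)
  qed
  ultimately have cheap_a: "GIET.cheap (\<lambda>n. lin (a n))"
    using GIET.cheap_conj lin_carrier line_homeo_shift by simp
  define b' where "b' n x = - b n (- x)" for n x
  have b': "line_homeo (b' n)" for n
  proof -
    have "surj (b' n)"
      unfolding surj_def
    proof
      fix y
      obtain x where "- y = b n x" using b[of n] by (meson line_homeo_def surj_def)
      then show "\<exists>x. y = b' n x" by (intro exI[of _ "- x"]) (simp add: b'_def)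
    qed
    then show ?thesis using b[of n] by (auto simp: line_homeo_def b'_def strict_mono_def)
  qed
  have neg: "line_exchange {} (uminus :: real \<Rightarrow> real)"
    by (auto simp: line_exchange_def surj_def intro!: continuous_intros)
  have "GIET.cheap (\<lambda>n. lin (b' n))"
    using b' by (rule cheap_half_line) (simp add: b'_def b_fix)
  moreover have "lin (b n) = lin uminus \<otimes>\<^bsub>GIET\<^esub> lin (b' n) \<otimes>\<^bsub>GIET\<^esub> inv\<^bsub>GIET\<^esub> (lin uminus)" for n
  proof -
    have "lin (b n) \<otimes>\<^bsub>GIET\<^esub> lin uminus = lin uminus \<otimes>\<^bsub>GIET\<^esub> lin (b' n)"
      using b b' neg line_homeo_exchange by (intro line_class_mult_eq[where A = "{}"]) (auto simp: b'_def)
    then show ?thesis using lin_carrier[OF b] lin_carrier[OF b'] line_class_carrier[OF neg]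
      by (metis GIET.inv_solve_right' GIET.m_closed)
  qed
  ultimately have "GIET.cheap (\<lambda>n. lin (b n))"
    using GIET.cheap_conj line_class_carrier[OF neg] by simp
  then show ?thesis using GIET.cheap_mult[OF cheap_a] by (simp add: ab)
qed

lemma cheap_line_homeos:
  assumes v: "\<And>n. line_homeo (v n)"
  shows "GIET.cheap (\<lambda>n. lin (v n))"
proof -
  define w where "w n = (if v n 0 \<le> 0 then v n else inv_into UNIV (v n))" for n
  have w: "line_homeo (w n)" for n
    using v line_homeo_inv by (simp add: w_def)
  have "w n 0 \<le> 0" for n
  proof (cases "v n 0 \<le> 0")
    case False
    have "v n (inv_into UNIV (v n) 0) < v n 0"
      using False line_homeo_bij[OF v[of n]] by (simp add: bij_is_surj surj_f_inv_f)
    then show ?thesis using False v[of n] by (simp add: w_def line_homeo_def strict_mono_less)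
  qed (simp add: w_def)
  then have "GIET.cheap (\<lambda>n. lin (w n))" using w cheap_line_homeos_at_most_0 by blast
  then have "GIET.cheap (\<lambda>n. if v n 0 \<le> 0 then lin (w n) else inv\<^bsub>GIET\<^esub> (lin (w n)))"
    by (intro GIET.cheap_if GIET.cheap_inv)
  moreover have "(if v n 0 \<le> 0 then lin (w n) else inv\<^bsub>GIET\<^esub> (lin (w n))) = lin (v n)" for n
    using lin_inv[OF v[of n]] lin_carrier[OF v[of n]] by (simp add: w_def)
  ultimately show ?thesis by simp
qed

section \<open>Exchanges with few discontinuities\<close>

text \<open>Filling the finitely many gaps with the limits gives a continuous map \<open>v\<close> of \<open>[0, 1]\<close>. It is
  injective since only two germs sit at a point. So it is strictly monotone, it is increasing because it
  fixes 0, and it is onto because it only misses finitely many values.\<close>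

lemma no_discontinuity_imp_lin:
  assumes V: "V \<in> carrier GIET" and disc: "discontinuities V = {}"
    and V0: "gact V (at_right 0) = at_right 0"
  shows "\<exists>q. line_homeo q \<and> V = lin q"
proof -
  obtain \<phi> where \<phi>: "\<phi> \<in> V" using GIET_rep_exists[OF V] by blast
  have g: "is_giet \<phi>" and V_eq: "V = giet_rel `` {\<phi>}" using GIET_rep_class[OF V \<phi>] by auto
  define v where "v a = loc (gact V (if a < 1 then at_right a else at_left 1))" for a
  have vl: "loc (gact V w) = v (loc w)" if w: "w \<in> germs" for w
    using w
  proof (cases rule: germs_cases)
    case (left a)
    show ?thesis
    proof (cases "a = 1")
      case False
      then have "a \<in> {0<..<1}" using left by simp
      moreover have "a \<notin> discontinuities V" using disc by simp
      ultimately show ?thesis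
        using left by (simp add: v_def discontinuities_germs[OF V])
    qed (simp add: left v_def)
  qed (simp add: v_def)
  have dom: "dom \<phi> \<subseteq> {0..1}" using g by (simp add: is_giet_iff)
  have germ_at: "\<exists>w\<in>germs. loc w = a" if "a \<in> {0..1}" for a
  proof (cases "a = 1")
    case True
    then show ?thesis by (intro bexI[of _ "at_left 1"]) auto
  next
    case False
    then show ?thesis using that by (intro bexI[of _ "at_right a"]) auto
  qed
  have v_dom: "pval \<phi> a = v a" if "a \<in> dom \<phi>" for a
  proof -
    obtain w where w: "w \<in> germs" "loc w = a" using germ_at dom \<open>a \<in> dom \<phi>\<close> by blast
    then show ?thesis using loc_gact_dom[OF V \<phi> w(1)] vl[OF w(1)] that by simp
  qed
  have v01: "0 \<le> v a" "v a \<le> 1" if "a \<in> {0..1}" for a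
  proof -
    obtain w where w: "w \<in> germs" "loc w = a" using germ_at[OF \<open>a \<in> {0..1}\<close>] by blast
    then show "0 \<le> v a" "v a \<le> 1" using vl[OF w(1)] loc_bounds[OF gact_germs[OF V w(1)]] by auto
  qed
  have v_tendsto: "(v \<longlongrightarrow> v (loc w)) w" if w: "w \<in> germs" for w
  proof -
    have "\<forall>\<^sub>F x in w. x \<in> dom \<phi>" using eventually_germ_in[OF w] g by (simp add: is_giet_iff del: domIff)
    then have "\<forall>\<^sub>F x in w. pval \<phi> x = v x" by (rule eventually_mono) (rule v_dom)
    from Lim_transform_eventually[OF tendsto_loc_gact[OF V \<phi> w] this] show ?thesis by (simp add: vl w)
  qed
  have v_cont: "continuous_on {0..1} v"
    unfolding continuous_on_def
  proof
    fix a :: real assume a: "a \<in> {0..1}"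
    consider "a = 0" | "a = 1" | "0 < a" "a < 1" using a by fastforce
    then show "(v \<longlongrightarrow> v a) (at a within {0..1})"
    proof cases
      case 1
      then show ?thesis using v_tendsto[OF germsI(1)[of 0]] by (simp add: at_within_Icc_at_right)
    next
      case 2
      then show ?thesis using v_tendsto[OF germsI(2)[of 1]] by (simp add: at_within_Icc_at_left)
    next
      case 3
      then have "(v \<longlongrightarrow> v a) (at a)"
        using v_tendsto[of "at_left a"] v_tendsto[of "at_right a"] germsI[of a] by (simp add: filterlim_split_at)
      then show ?thesis by (rule tendsto_mono[OF at_le, rotated]) simp
    qed
  qed
  (* At most two germs share a location, and an interior point already has two. *)
  have two: "x = y \<or> y = z \<or> x = z"
    if "x \<in> germs" "y \<in> germs" "z \<in> germs" "v (loc x) = c" "v (loc y) = c" "v (loc z) = c" for x y z c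
  proof -
    have "gact V x = at_left c \<or> gact V x = at_right c" "gact V y = at_left c \<or> gact V y = at_right c"
      "gact V z = at_left c \<or> gact V z = at_right c"
      using germs_at gact_germs[OF V] vl that by auto
    then show ?thesis using gact_inj[OF V] that(1-3) by metis
  qed
  have v0: "v 0 = 0" using V0 by (simp add: v_def)
  have v_neq: "v a \<noteq> v b" if order: "a < b" "a \<in> {0..1}" "b \<in> {0..1}" for a b
  proof
    assume eq: "v a = v b"
    have ab: "at_right a \<in> germs" "at_left b \<in> germs" using order by auto
    consider "0 < a" | "b < 1" | "a = 0" "b = 1" using order by force
    then show False
    proof cases
      case 1
      then have "at_left a \<in> germs" using order by auto
      moreover have "at_left a \<noteq> at_left b" using order by (metis loc_at_left less_irrefl)
      ultimately show False using two[of "at_right a" "at_left b" "at_left a" "v a"] ab eq by simp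
    next
      case 2
      then have "at_right b \<in> germs" using order by auto
      moreover have "at_right a \<noteq> at_right b" using order by (metis loc_at_right less_irrefl)
      ultimately show False using two[of "at_right a" "at_left b" "at_right b" "v a"] ab eq by simp
    next
      case 3
      then have "loc (gact V (at_left 1)) = 0" using vl[OF germsI(2)[of 1]] eq v0 by simp
      then have "gact V (at_left 1) = gact V (at_right 0)"
        using germs_at_0[OF gact_germs[OF V germsI(2)[of 1]]] V0 by simp
      then show False using gact_inj[OF V germsI(2)[of 1] germsI(1)[of 0]] by simp
    qed
  qed
  then have inj: "inj_on v {0..1}" by (rule linorder_inj_onI) auto
  have "strict_mono_on {0..1} v \<or> strict_antimono_on {0..1} v"
    using injective_eq_monotone_map[of "{0..1}" v] inj v_cont by (simp add: is_interval_convex_1)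
  moreover have "\<not> strict_antimono_on {0..1} v"
  proof
    assume "strict_antimono_on {0..1} v"
    then have "v 1 < v 0" by (auto simp: monotone_on_def)
    then show False using v01[of 1] v0 by simp
  qed
  ultimately have mono: "v x < v y" if "0 \<le> x" "x < y" "y \<le> 1" for x y
    using that by (auto simp: strict_mono_on_def)
  have v1: "v 1 = 1"
  proof (rule ccontr)
    assume "v 1 \<noteq> 1"
    then have "v 1 < 1" using v01[of 1] by simp
    have "{v 1<..1} \<subseteq> {0..1} - ran \<phi>"
    proof
      fix y assume y: "y \<in> {v 1<..1}"
      have "y \<notin> ran \<phi>"
      proof
        assume "y \<in> ran \<phi>"
        then obtain x where "x \<in> dom \<phi>" "y = v x" unfolding ran_pval using v_dom by blast
        then show False using mono[of x 1] dom y by (cases "x = 1") auto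
      qed
      then show "y \<in> {0..1} - ran \<phi>" using y v01[of 1] by auto
    qed
    then have "finite {v 1<..1}" using g finite_subset by (auto simp: is_giet_iff)
    then show False using \<open>v 1 < 1\<close> infinite_Ioc by blast
  qed
  define q where "q = (\<lambda>x. stretch (v (squash x)))"
  have in01: "0 < v y" "v y < 1" if "0 < y" "y < 1" for y
    using mono[of 0 y] mono[of y 1] that v0 v1 by auto
  have "strict_mono q"
  proof (rule strict_monoI)
    fix x y :: real assume "x < y"
    then have "v (squash x) < v (squash y)" using squash_bounds by (intro mono) (auto intro: less_imp_le)
    then have "squash (q x) < squash (q y)" unfolding q_def using in01 squash_bounds by simp
    then show "q x < q y" by simp
  qed
  moreover have "surj q"
    unfolding surj_def
  proof
    fix y
    have "\<exists>x\<ge>0. x \<le> 1 \<and> v x = squash y"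
      using v0 v1 squash_bounds[of y] v_cont by (intro IVT') (auto intro: less_imp_le)
    then obtain x where x: "0 \<le> x" "x \<le> 1" "v x = squash y" by blast
    then have "0 < x" "x < 1" using v0 v1 squash_bounds[of y] by (auto simp: order_le_less)
    then have "q (stretch x) = y" using x by (simp add: q_def)
    then show "\<exists>x. y = q x" by metis
  qed
  ultimately have q: "line_homeo q" by (simp add: line_homeo_def)
  have "giet_rel `` {\<phi>} = giet_rel `` {line_map {} q}"
  proof (rule class_eqI[OF g])
    show "is_giet (line_map {} q)" using q line_homeo_exchange line_map_giet by blast
    show "finite ({0..1} - dom \<phi>)" using g by (simp add: is_giet_iff)
    fix x :: real assume x: "0 < x" "x < 1" "x \<notin> {0..1} - dom \<phi>"
    then have "x \<in> dom \<phi>" by simp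
    then have "\<phi> x = Some (v x)" using v_dom by (metis domD option.sel)
    then show "\<phi> x = line_map {} q x" using x in01[OF x(1,2)] by (simp add: line_map_def q_def)
  qed
  then show ?thesis using q V_eq by (auto simp: line_class_def)
qed

lemma loc_gact_lin:
  assumes "line_homeo q" "w \<in> germs" "0 < loc w" "loc w < 1"
  shows "loc (gact (lin q) w) = squash (q (stretch (loc w)))"
proof -
  have "line_map {} q \<in> lin q"
    unfolding line_class_def using assms(1) line_homeo_exchange line_map_giet class_self by blast
  moreover have "loc w \<in> dom (line_map {} q)" using assms by (auto simp: line_map_def dom_def)
  ultimately show ?thesis
    using loc_gact_dom[OF lin_carrier[OF assms(1)] _ assms(2)] assms by (simp add: line_map_def)
qed

lemma line_homeo_to_integers:
  fixes Q :: "real set"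
  assumes "finite Q"
  shows "\<exists>q. line_homeo q \<and> q ` Q \<subseteq> real ` {1..card Q}"
  using assms
proof (induction Q rule: finite_linorder_max_induct)
  case empty
  show ?case by (intro exI[of _ id]) simp
next
  case (insert b A)
  then obtain q where q: "line_homeo q" "q ` A \<subseteq> real ` {1..card A}" by blast
  have card: "card (insert b A) = Suc (card A)" using insert by auto
  show ?case
  proof (cases "A = {}")
    case True
    then show ?thesis using line_homeo_shift[of "1 - b"] by (intro exI[of _ "\<lambda>x. x + (1 - b)"]) auto
  next
    case False
    define m where "m = Max A"
    have m: "m \<in> A" "m < b" "\<And>x. x \<in> A \<Longrightarrow> x \<le> m" using False insert by (auto simp: m_def)
    obtain k where k: "q m = real k" "1 \<le> k" "k \<le> card A" using q(2) m(1) by auto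
    define r where "r x = 1 / (b - m) * x + (q m - 1 / (b - m) * m)" for x
    have r: "line_homeo r" unfolding r_def using m(2) by (intro line_homeo_affine) simp
    have rm: "r m = q m" by (simp add: r_def)
    have "r b - q m = 1 / (b - m) * (b - m)" by (simp only: r_def algebra_simps)
    then have rb: "r b = real (Suc k)" using m(2) k(1) by simp
    let ?p = "\<lambda>x. if x \<le> m then q x else r x"
    have "?p x \<in> real ` {1..Suc (card A)}" if "x \<in> insert b A" for x
    proof (cases "x = b")
      case True
      then show ?thesis using m(2) rb k by (intro image_eqI[of _ _ "Suc k"]) auto
    next
      case False
      then show ?thesis using that q(2) m(3) by force
    qed
    then have "?p ` insert b A \<subseteq> real ` {1..card (insert b A)}" unfolding card by (rule image_subsetI)
    then show ?thesis
      using line_homeo_glue[OF q(1) r rm[symmetric]] by (intro exI[of _ ?p] conjI)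
  qed
qed

definition grid :: "nat \<Rightarrow> real set" where
  "grid M = {0, 1} \<union> squash ` real ` {1..M}"

definition normal :: "nat \<Rightarrow> (real \<rightharpoonup> real) set \<Rightarrow> bool" where
  "normal M B \<longleftrightarrow> B \<in> carrier GIET \<and> discontinuities B \<subseteq> grid M"

definition grid_germs :: "nat \<Rightarrow> real filter set" where
  "grid_germs M = {w \<in> germs. loc w \<in> grid M}"

text \<open>The combinatorial type of an exchange that is continuous off the grid: which ends of its pieces
  become neighbours, and which one becomes the left end of the interval.\<close>

definition pattern :: "nat \<Rightarrow> (real \<rightharpoonup> real) set \<Rightarrow> (real filter \<times> real filter) set \<times> real filter set" where
  "pattern M B = ({(x, y). x \<in> grid_germs M \<and> y \<in> grid_germs M \<and> loc (gact B x) = loc (gact B y)},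
     {x \<in> grid_germs M. gact B x = at_right 0})"

lemma finite_patterns: "finite (range (pattern M))"
proof -
  have "finite (grid_germs M)"
    unfolding grid_germs_def by (rule finite_germs_over) (simp add: grid_def)
  then have "finite (Pow (grid_germs M \<times> grid_germs M) \<times> Pow (grid_germs M))" by simp
  moreover have "range (pattern M) \<subseteq> Pow (grid_germs M \<times> grid_germs M) \<times> Pow (grid_germs M)"
    by (auto simp: pattern_def)
  ultimately show ?thesis by (rule rev_finite_subset)
qed

text \<open>The two sides of a point off the grid stay together.\<close>

lemma normal_off_grid:
  assumes "normal M B" "w \<in> germs" "w \<notin> grid_germs M"
  shows "opp w \<in> germs" "opp w \<notin> grid_germs M" "loc (gact B (opp w)) = loc (gact B w)"
proof -
  have B: "B \<in> carrier GIET" using assms by (simp add: normal_def)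
  have l: "loc w \<notin> grid M" using assms by (simp add: grid_germs_def)
  then have l01: "loc w \<noteq> 0" "loc w \<noteq> 1" by (auto simp: grid_def)
  then have l01': "0 < loc w" "loc w < 1" using loc_bounds[OF assms(2)] by auto
  show o: "opp w \<in> germs" using opp_germs[OF assms(2)] .
  show "opp w \<notin> grid_germs M" using l loc_opp[OF assms(2) l01] by (simp add: grid_germs_def)
  have "loc w \<notin> discontinuities B" using l assms by (auto simp: normal_def)
  then have "loc (gact B (at_left (loc w))) = loc (gact B (at_right (loc w)))"
    using l01' by (simp add: discontinuities_germs[OF B])
  then show "loc (gact B (opp w)) = loc (gact B w)"
    using germs_at[OF assms(2) refl] opp_left[OF l01'(2)] opp_right[OF l01'(1)] by metis
qed

text \<open>The quotient of \<open>B\<close> by \<open>T\<close> has no discontinuity. Indeed, two germs that \<open>T\<close> puts at the same point are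
  put at the same point by \<open>B\<close> as well: on the grid because the patterns agree, and off the grid because
  they are the two sides of a point where both exchanges are continuous. By the second component of the
  pattern the quotient fixes the left end of the interval, so it is increasing.\<close>

lemma same_pattern:
  assumes B: "normal M B" and T: "normal M T" and eq: "pattern M B = pattern M T"
  shows "\<exists>q. line_homeo q \<and> B = lin q \<otimes>\<^bsub>GIET\<^esub> T"
proof -
  have c: "B \<in> carrier GIET" "T \<in> carrier GIET" using B T by (auto simp: normal_def)
  have same: "loc (gact B x) = loc (gact B y) \<longleftrightarrow> loc (gact T x) = loc (gact T y)"
    if "x \<in> grid_germs M" "y \<in> grid_germs M" for x y
    using eq that by (auto simp: pattern_def set_eq_iff)
  have zero: "gact B x = at_right 0 \<longleftrightarrow> gact T x = at_right 0" if "x \<in> grid_germs M" for x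
    using eq that by (auto simp: pattern_def set_eq_iff)
  (* Off the grid a germ and its opposite stay together under T, which leaves no room for a third
     germ at the same point. *)
  have partner: "y = opp x"
    if "x \<in> germs" "y \<in> germs" "x \<noteq> y" "x \<notin> grid_germs M" "loc (gact T x) = loc (gact T y)" for x y
  proof -
    note off = normal_off_grid[OF T that(1,4)]
    have "gact T (opp x) = opp (gact T x)"
      using same_loc_imp_opp[OF gact_germs[OF c(2) that(1)] gact_germs[OF c(2) off(1)]] off(3)
        gact_inj[OF c(2) that(1) off(1)] opp_neq[OF that(1)] by metis
    moreover have "gact T y = opp (gact T x)"
      using same_loc_imp_opp[OF gact_germs[OF c(2) that(1)] gact_germs[OF c(2) that(2)]] that(3,5)
        gact_inj[OF c(2) that(1,2)] by metis
    ultimately show ?thesis using gact_inj[OF c(2) that(2) off(1)] by simp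
  qed
  have together: "loc (gact B x) = loc (gact B y)"
    if "x \<in> germs" "y \<in> germs" "x \<noteq> y" "loc (gact T x) = loc (gact T y)" for x y
  proof (cases "x \<in> grid_germs M \<and> y \<in> grid_germs M")
    case True
    then show ?thesis using same that(4) by blast
  next
    case False
    then consider "x \<notin> grid_germs M" | "y \<notin> grid_germs M" by blast
    then show ?thesis
    proof cases
      case 1
      then have "y = opp x" using partner[OF that(1,2,3)] that by blast
      then show ?thesis using normal_off_grid(3)[OF B that(1) 1] by simp
    next
      case 2
      then have "x = opp y" using partner[OF that(2,1)] that by metis
      then show ?thesis using normal_off_grid(3)[OF B that(2) 2] by simp
    qed
  qed
  let ?T' = "inv\<^bsub>GIET\<^esub> T"
  have T': "?T' \<in> carrier GIET" using c by simp
  let ?V = "B \<otimes>\<^bsub>GIET\<^esub> ?T'"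
  have V: "?V \<in> carrier GIET" using c by simp
  have "discontinuities ?V = {}"
  proof -
    have "loc (gact ?V (at_left b)) = loc (gact ?V (at_right b))" if "b \<in> {0<..<1}" for b
    proof -
      have ge: "at_left b \<in> germs" "at_right b \<in> germs" using that by auto
      have "loc (gact B (gact ?T' (at_left b))) = loc (gact B (gact ?T' (at_right b)))"
        using gact_germs[OF T'] gact_inj[OF T'] ge gact_inv(2)[OF c(2)] by (intro together) auto
      then show ?thesis using c T' ge by (simp add: gact_mult)
    qed
    then show ?thesis by (simp add: discontinuities_germs[OF V])
  qed
  moreover have "gact ?V (at_right 0) = at_right 0"
  proof -
    have ge: "at_right (0::real) \<in> germs" by auto
    define x where "x = gact ?T' (at_right 0)"
    have x: "x \<in> germs" "gact T x = at_right 0"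
      using gact_germs[OF T' ge] gact_inv(2)[OF c(2) ge] by (auto simp: x_def)
    have "x \<in> grid_germs M"
    proof (rule ccontr)
      assume "x \<notin> grid_germs M"
      note off = normal_off_grid[OF T x(1) this]
      then have "gact T (opp x) = at_right 0"
        using germs_at_0[OF gact_germs[OF c(2) off(1)]] x(2) by simp
      then show False using gact_inj[OF c(2) off(1) x(1)] x(2) opp_neq[OF x(1)] by simp
    qed
    then have "gact B x = at_right 0" using zero x(2) by blast
    then show ?thesis using c T' ge by (simp add: gact_mult x_def)
  qed
  ultimately obtain q where q: "line_homeo q" "?V = lin q"
    using no_discontinuity_imp_lin[OF V] by blast
  have "?V \<otimes>\<^bsub>GIET\<^esub> T = B" using c by (simp add: GIET.m_assoc)
  then have "B = lin q \<otimes>\<^bsub>GIET\<^esub> T" using q(2) by simp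
  then show ?thesis using q(1) by blast
qed

text \<open>The homeomorphism moves the discontinuities, in the coordinate of the line, to integers between 1
  and \<open>M\<close>.\<close>

lemma normalize:
  assumes A: "A \<in> carrier GIET" and card: "disc_count A \<le> M"
  shows "\<exists>q. line_homeo q \<and> normal M (A \<otimes>\<^bsub>GIET\<^esub> inv\<^bsub>GIET\<^esub> (lin q))"
proof -
  have fin: "finite (discontinuities A)" by (rule finite_discontinuities[OF A])
  obtain q where q: "line_homeo q"
    and qQ: "q ` stretch ` discontinuities A \<subseteq> real ` {1..card (stretch ` discontinuities A)}"
    using line_homeo_to_integers[OF finite_imageI[OF fin, of stretch]] by blast
  have "card (stretch ` discontinuities A) \<le> M"
    using card_image_le[OF fin, of stretch] card by (simp add: disc_count_def)
  then have "real ` {1..card (stretch ` discontinuities A)} \<subseteq> real ` {1..M}"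
    by (intro image_mono) simp
  with qQ have qM: "q ` stretch ` discontinuities A \<subseteq> real ` {1..M}" by (rule subset_trans)
  let ?q' = "inv_into UNIV q"
  have q': "line_homeo ?q'" using line_homeo_inv[OF q] .
  let ?B = "A \<otimes>\<^bsub>GIET\<^esub> lin ?q'"
  have B: "?B \<in> carrier GIET" using A lin_carrier[OF q'] by simp
  have "discontinuities ?B \<subseteq> grid M"
  proof (rule subsetI, rule ccontr)
    fix c assume c: "c \<in> discontinuities ?B" "c \<notin> grid M"
    then have c01: "0 < c" "c < 1" and neq: "loc (gact ?B (at_left c)) \<noteq> loc (gact ?B (at_right c))"
      by (auto simp: discontinuities_germs[OF B])
    have ge: "at_left c \<in> germs" "at_right c \<in> germs" using c01 by auto
    define a where "a = squash (?q' (stretch c))"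
    let ?x = "gact (lin ?q') (at_left c)" and ?y = "gact (lin ?q') (at_right c)"
    have xy: "?x \<in> germs" "?y \<in> germs" "loc ?x = a" "loc ?y = a"
      using gact_germs[OF lin_carrier[OF q']] ge loc_gact_lin[OF q'] c01 by (auto simp: a_def)
    have a01: "0 < a" "a < 1" by (auto simp: a_def squash_bounds)
    have "loc (gact A ?x) \<noteq> loc (gact A ?y)"
      using neq A lin_carrier[OF q'] ge by (simp add: gact_mult)
    then have "loc (gact A (at_left a)) \<noteq> loc (gact A (at_right a))"
      using germs_at[OF xy(1,3)] germs_at[OF xy(2,4)] by metis
    then have "a \<in> discontinuities A" using a01 by (simp add: discontinuities_germs[OF A])
    then have "q (stretch a) \<in> real ` {1..M}" using qM by blast
    moreover have "q (stretch a) = stretch c"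
      using line_homeo_bij[OF q] by (simp add: a_def bij_is_surj surj_f_inv_f)
    ultimately have "squash (stretch c) \<in> grid M" by (auto simp: grid_def)
    then show False using c c01 by simp
  qed
  then have "normal M ?B" using B by (simp add: normal_def)
  then show ?thesis using q lin_inv[OF q] by auto
qed

text \<open>A homeomorphism \<open>w n\<close> moves the discontinuities of \<open>A n\<close> to the grid. Up to a homeomorphism \<open>v n\<close> the
  result is determined by its pattern, hence equal to one of finitely many representatives \<open>T n\<close>.\<close>

lemma cheap_if_bounded_discontinuities:
  assumes A: "\<And>n. A n \<in> carrier GIET" and M: "\<And>n. disc_count (A n) \<le> M"
  shows "GIET.cheap A"
proof -
  obtain w where w: "\<And>n. line_homeo (w n)" and B: "\<And>n. normal M (A n \<otimes>\<^bsub>GIET\<^esub> inv\<^bsub>GIET\<^esub> (lin (w n)))"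
    using normalize[OF A M] by metis
  define B' where "B' n = A n \<otimes>\<^bsub>GIET\<^esub> inv\<^bsub>GIET\<^esub> (lin (w n))" for n
  define rep where "rep p = (SOME T. normal M T \<and> pattern M T = p)" for p
  have rep: "normal M (rep (pattern M (B' n))) \<and> pattern M (rep (pattern M (B' n))) = pattern M (B' n)" for n
    unfolding rep_def by (rule someI[of _ "B' n"]) (simp add: B B'_def)
  define T where "T n = rep (pattern M (B' n))" for n
  have T: "T n \<in> carrier GIET" for n using rep[of n] by (simp add: T_def normal_def)
  have "\<exists>q. line_homeo q \<and> B' n = lin q \<otimes>\<^bsub>GIET\<^esub> T n" for n
    using rep[of n] B[of n] by (intro same_pattern[of M]) (simp_all add: T_def B'_def)
  then obtain v where v: "\<And>n. line_homeo (v n)" and Bv: "\<And>n. B' n = lin (v n) \<otimes>\<^bsub>GIET\<^esub> T n" by metis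
  have "GIET.cheap T"
  proof (rule GIET.cheap_finite_range[of "range T"])
    have "range T \<subseteq> rep ` range (pattern M)" by (auto simp: T_def)
    then show "finite (range T)" using finite_patterns finite_subset by blast
  qed (use T in auto)
  then have "GIET.cheap (\<lambda>n. lin (v n) \<otimes>\<^bsub>GIET\<^esub> T n \<otimes>\<^bsub>GIET\<^esub> lin (w n))"
    using v w by (intro GIET.cheap_mult cheap_line_homeos)
  moreover have "lin (v n) \<otimes>\<^bsub>GIET\<^esub> T n \<otimes>\<^bsub>GIET\<^esub> lin (w n) = A n" for n
    using Bv[of n, symmetric] A[of n] lin_carrier[OF w[of n]] by (simp add: B'_def GIET.m_assoc)
  ultimately show ?thesis by simp
qed

theorem theorem2p8:
  fixes f :: "(real \<rightharpoonup> real) set"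
  assumes "f \<in> carrier GIET"
  shows "(distorted GIET f \<longleftrightarrow> bdd_above (range (\<lambda>n::nat. disc_count (f [^]\<^bsub>GIET\<^esub> n)))) \<and>
    (bdd_above (range (\<lambda>n::nat. disc_count (f [^]\<^bsub>GIET\<^esub> n))) \<longleftrightarrow> multihomeomorphism f)"
proof -
  let ?bounded = "bdd_above (range (\<lambda>n::nat. disc_count (f [^]\<^bsub>GIET\<^esub> n)))"
  have 13: "multihomeomorphism f" if "distorted GIET f"
    using finite_recurrent_imp_multihomeomorphism[OF assms distorted_imp_finite_recurrent[OF assms that]] .
  have 32: ?bounded if "multihomeomorphism f"
    using multihomeomorphism_imp_bounded[OF assms that] .
  have 21: "distorted GIET f" if bdd: ?bounded
  proof (rule GIET.distorted_if_cheap_squares[OF assms])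
    obtain M where "\<And>n::nat. disc_count (f [^]\<^bsub>GIET\<^esub> n) \<le> M" using bdd by (auto simp: bdd_above_def)
    then show "GIET.cheap (\<lambda>n. f [^]\<^bsub>GIET\<^esub> (n\<^sup>2))"
      using assms by (intro cheap_if_bounded_discontinuities[where M = M]) auto
  qed
  show ?thesis
  proof (intro conjI iffI)
    show ?bounded if "distorted GIET f" using 32[OF 13[OF that]] .
    show "distorted GIET f" if ?bounded using 21[OF that] .
    show "multihomeomorphism f" if ?bounded using 13[OF 21[OF that]] .
    show ?bounded if "multihomeomorphism f" using 32[OF that] .
  qed
qed

end
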